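(* Assume $u_0$ and the initial height functions $\sigma_n(\cdot,0)$ satisfy the hypotheses below, fix a positive integer $h$, a closed set $B\subseteq\mathbb R^d$ and $t>0$. Suppose that on the same probability space there are initial height functions $\zeta_n(\cdot,0)\in\Sigma$ with $\sigma_n(y,0)\le\zeta_n(y,0)\le\sigma_n(y,0)+h$ for all $n,y$, and that $\sigma_n(\cdot,\cdot)$ and $\zeta_n(\cdot,\cdot)$ are both constructed by the variational formula with the same Poisson point process (so that $\sigma_n(x,s)\le\zeta_n(x,s)\le\sigma_n(x,s)+h$ for all $n,x,s$). Let $A_n(s)=\{x\in\mathbb R^d:\zeta_n(x,s)=\sigma_n(x,s)+h\}$ and assume that almost surely, for every compact $K\subseteq\mathbb R^d$ and $\varepsilon>0$, $B^{(-\varepsilon)}\cap K\subseteq (n^{-1}A_n(0))\cap K\subseteq B^{(\varepsilon)}\cap K$ for all large enough $n$. Then: (1) If $W(B,t)=\emptyset$, then almost surely, for every compact $K$, $A_n(nt)\cap nK=\emptyset$ for all large enough $n$. (2) If $W(B,t)\neq\emptyset$, then almost surely, for every compact $K$ and $\varepsilon>0$, $\mathrm{bd}\{n^{-1}A_n(nt)\}\cap K\subseteq X(B,t)^{(\varepsilon)}\cap K$ for all large enough $n$. (3) If in addition no point of $W(\overline{B^c},t)$ is an interior point of $W(B,t)$, then almost surely, for every compact $K$ and $\varepsilon>0$, $W(B,t)^{(-\varepsilon)}\cap K\subseteq \{n^{-1}A_n(nt)\}\cap K\subseteq W(B,t)^{(\varepsilon)}\cap K$ for all large enough $n$.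
   Context: Order conventions: for $x,y\in\mathbb R^\nu$ write $x\le y$ if $x_i\le y_i$ for all $i$, and $x<y$ if $x_i<y_i$ for all $i$; $\mathbf 1=(1,\dots,1)$; $|x|_\infty=\max_i|x_i|$. Fix $d\ge2$. $\mathbb Z^*=\mathbb Z\cup\{\pm\infty\}$. The state space $\Sigma$ is the set of functions $\sigma:\mathbb R^d\to\mathbb Z^*$ such that (i) $x\le y$ implies $\sigma(x)\le\sigma(y)$; (ii) for every cube $[-q\mathbf 1,q\mathbf 1]$ there are finite partitions $-q=s_i^0<\dots<s_i^{m_i}=q$ of each coordinate axis such that $\sigma$ is constant on each rectangle $\prod_{i}[s_i^{k_i},s_i^{k_i+1})$; (iii) for every $b\in\mathbb R^d$, $\lim_{M\to\infty}\sup\{|y|_\infty^{-d/(d+1)}\sigma(y): y\le b,\ |y|_\infty\ge M\}=-\infty$. A rate-one Poisson point process on $\mathbb R^d\times(0,\infty)$ is given; for $y\le x$ and $t>0$, $\mathbf H((y,0),(x,t))$ is the maximal number of Poisson points on a strictly increasing chain (coordinatewise order in $\mathbb R^{d+1}$) in $\{(\eta,s):y<\eta\le x,0<s\le t\}$. Processes are defined from initial states by $\sigma(x,t)=\sup_{y\le x}\{\sigma(y,0)+\mathbf H((y,0),(x,t))\}$. Hypotheses on $u_0$ and $\sigma_n$: $u_0:\mathbb R^d\to\mathbb R$ is nondecreasing, locally Lipschitz, and for every $b$, $\lim_{M\to\infty}\sup\{|y|_\infty^{-d/(d+1)}u_0(y):y\le b,|y|_\infty\ge M\}=-\infty$; $\sigma_n(\cdot,0)$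 are random elements of $\Sigma$ with $n^{-1}\sigma_n(ny,0)\to u_0(y)$ a.s. for each $y$, and for every $b\in\mathbb R^d$, $C>0$, a.s. there are finite $M,N$ with $\sigma_n(ny,0)\le -Cn|y|_\infty^{d/(d+1)}$ whenever $n\ge N$, $y\le b$, $|y|_\infty\ge M$. $c_{d+1}$ is the a.s. limit of $n^{-1}\times$(maximal increasing chain length of a rate-one Poisson process in $(0,n\mathbf 1]\subseteq\mathbb R^{d+1}$); $g(x)=c_{d+1}(x_1\cdots x_d)^{1/(d+1)}$ for $x\ge0$, $g=-\infty$ otherwise; $u(x,t)=\sup_{y\le x}\{u_0(y)+tg((x-y)/t)\}$ for $t>0$. For $y\in\mathbb R^d$: $W(y,t)=\{x\in\mathbb R^d: x\ge y,\ u(x,t)=u_0(y)+tg((x-y)/t)\}$; for $B\subseteq\mathbb R^d$, $W(B,t)=\bigcup_{y\in B}W(y,t)$; for closed $B$, $X(B,t)=W(B,t)\cap W(\overline{B^c},t)$. For a set $B$ and $\varepsilon>0$: $B^{(\varepsilon)}=\{x: d(x,y)<\varepsilon\text{ for some }y\in B\}$ and $B^{(-\varepsilon)}=\{x\in B: d(x,y)\ge\varepsilon\text{ for all }y\notin B\}$ (Euclidean distance). $\mathrm{bd}$ denotes the topological boundary $\overline{A}\cap\overline{A^c}$. *)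

theory Defs
  imports "HOL-Analysis.Analysis" "HOL-Probability.Probability"
begin

text \<open>The library order on vectors is componentwise: x \<le> y iff all x$i \<le> y$i.
  The paper's strict order x < y means x$i < y$i for all i; we call it vlt.\<close>

definition vlt :: "real^'d \<Rightarrow> real^'d \<Rightarrow> bool" where
  "vlt x y \<longleftrightarrow> (\<forall>i. x$i < y$i)"

definition norm_inf :: "real^'d \<Rightarrow> real" where
  "norm_inf x = Max (range (\<lambda>i. \<bar>x$i\<bar>))"

definition st_lt :: "((real^'d) \<times> real) \<Rightarrow> ((real^'d) \<times> real) \<Rightarrow> bool" where
  "st_lt p q \<longleftrightarrow> vlt (fst p) (fst q) \<and> snd p < snd q"

definition growth_cond :: "(real^'d \<Rightarrow> ereal) \<Rightarrow> bool" where
  "growth_cond f \<longleftrightarrow> (\<forall>b::real^'d.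
     ((\<lambda>M::real. SUP y\<in>{y. y \<le> b \<and> M \<le> norm_inf y}.
          ereal (norm_inf y powr (- (real CARD('d) / (real CARD('d) + 1)))) * f y)
       \<longlongrightarrow> -\<infinity>) at_top)"

definition Zstar :: "ereal set" where
  "Zstar = range (\<lambda>k::int. ereal (real_of_int k)) \<union> {\<infinity>, -\<infinity>}"

definition locally_rect_const :: "(real^'d \<Rightarrow> ereal) \<Rightarrow> bool" where
  "locally_rect_const \<sigma> \<longleftrightarrow> (\<forall>q::real. q > 0 \<longrightarrow>
     (\<exists>S :: 'd \<Rightarrow> real list.
        (\<forall>i. sorted_wrt (<) (S i) \<and> length (S i) \<ge> 2 \<and> hd (S i) = - q \<and> last (S i) = q) \<and>
        (\<forall>k :: 'd \<Rightarrow> nat. (\<forall>i. k i + 1 < length (S i)) \<longrightarrow>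
           (\<exists>c. \<forall>x. (\<forall>i. S i ! k i \<le> x$i \<and> x$i < S i ! (k i + 1)) \<longrightarrow> \<sigma> x = c))))"

definition StateSpace :: "(real^'d \<Rightarrow> ereal) set" where
  "StateSpace = {\<sigma>. (\<forall>x. \<sigma> x \<in> Zstar) \<and> mono \<sigma> \<and> locally_rect_const \<sigma> \<and> growth_cond \<sigma>}"

definition st_chain :: "((real^'d) \<times> real) set \<Rightarrow> bool" where
  "st_chain C \<longleftrightarrow> finite C \<and> (\<forall>p\<in>C. \<forall>q\<in>C. p \<noteq> q \<longrightarrow> st_lt p q \<or> st_lt q p)"

definition Hlp :: "((real^'d) \<times> real) set \<Rightarrow> real^'d \<Rightarrow> real^'d \<Rightarrow> real \<Rightarrow> ereal" where
  "Hlp P y x t = (SUP C\<in>{C. st_chain C \<and>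
        C \<subseteq> P \<inter> {(\<eta>, s). vlt y \<eta> \<and> \<eta> \<le> x \<and> 0 < s \<and> s \<le> t}}. ereal (real (card C)))"

definition evolve :: "((real^'d) \<times> real) set \<Rightarrow> (real^'d \<Rightarrow> ereal) \<Rightarrow> real^'d \<Rightarrow> real \<Rightarrow> ereal" where
  "evolve P \<sigma>0 x t = (SUP y\<in>{y. y \<le> x}. \<sigma>0 y + Hlp P y x t)"

definition st_region :: "((real^'d) \<times> real) set" where
  "st_region = UNIV \<times> {0<..}"

definition poisson_pp :: "'w measure \<Rightarrow> ('w \<Rightarrow> ((real^'d) \<times> real) set) \<Rightarrow> bool" where
  "poisson_pp M P \<longleftrightarrow> prob_space M \<and>
     (\<forall>\<omega>. P \<omega> \<subseteq> st_region) \<and>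
     (AE \<omega> in M. \<forall>A. bounded A \<longrightarrow> finite (P \<omega> \<inter> A)) \<and>
     (\<forall>A \<in> sets lborel. bounded A \<longrightarrow> A \<subseteq> st_region \<longrightarrow>
        (\<lambda>\<omega>. card (P \<omega> \<inter> A)) \<in> measurable M (count_space UNIV) \<and>
        (\<forall>k::nat. measure M {\<omega>\<in>space M. card (P \<omega> \<inter> A) = k}
                 = measure lborel A ^ k / fact k * exp (- measure lborel A))) \<and>
     (\<forall>(I::nat set) A. finite I \<longrightarrow> disjoint_family_on A I \<longrightarrow>
        (\<forall>i\<in>I. A i \<in> sets lborel \<and> bounded (A i) \<and> A i \<subseteq> st_region) \<longrightarrow>
        prob_space.indep_vars M (\<lambda>_. count_space UNIV) (\<lambda>i \<omega>. card (P \<omega> \<inter> A i)) I)"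

definition gfun :: "real \<Rightarrow> real^'d \<Rightarrow> ereal" where
  "gfun c x = (if 0 \<le> x then ereal (c * (\<Prod>i\<in>UNIV. x$i) powr (1 / (real CARD('d) + 1)))
               else -\<infinity>)"

definition ufun :: "real \<Rightarrow> (real^'d \<Rightarrow> real) \<Rightarrow> real^'d \<Rightarrow> real \<Rightarrow> ereal" where
  "ufun c u0 x t = (SUP y\<in>{y. y \<le> x}. ereal (u0 y) + ereal t * gfun c ((1/t) *\<^sub>R (x - y)))"

definition Wpt :: "real \<Rightarrow> (real^'d \<Rightarrow> real) \<Rightarrow> real^'d \<Rightarrow> real \<Rightarrow> (real^'d) set" where
  "Wpt c u0 y t = {x. y \<le> x \<and> ufun c u0 x t = ereal (u0 y) + ereal t * gfun c ((1/t) *\<^sub>R (x - y))}"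

definition Wset :: "real \<Rightarrow> (real^'d \<Rightarrow> real) \<Rightarrow> (real^'d) set \<Rightarrow> real \<Rightarrow> (real^'d) set" where
  "Wset c u0 B t = (\<Union>y\<in>B. Wpt c u0 y t)"

definition Xset :: "real \<Rightarrow> (real^'d \<Rightarrow> real) \<Rightarrow> (real^'d) set \<Rightarrow> real \<Rightarrow> (real^'d) set" where
  "Xset c u0 B t = Wset c u0 B t \<inter> Wset c u0 (closure (- B)) t"

definition outer_nb :: "(real^'d) set \<Rightarrow> real \<Rightarrow> (real^'d) set" where
  "outer_nb B e = {x. \<exists>y\<in>B. dist x y < e}"

definition inner_nb :: "(real^'d) set \<Rightarrow> real \<Rightarrow> (real^'d) set" where
  "inner_nb B e = {x\<in>B. \<forall>y. y \<notin> B \<longrightarrow> dist x y \<ge> e}"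

definition scaleset :: "real \<Rightarrow> (real^'d) set \<Rightarrow> (real^'d) set" where
  "scaleset r A = (\<lambda>x. r *\<^sub>R x) ` A"

end

theory Submission
  imports Defs
begin

text \<open>
  Write \<open>y\<close> for a maximizer in the variational formula at \<open>x\<close>. Since heights are integers, a point \<open>x\<close>
  lies in \<open>A\<^sub>n(nt)\<close> only if some maximizer of \<open>\<sigma>\<^sub>n\<close> at \<open>x\<close> lies in \<open>A\<^sub>n(0)\<close>, and lies outside only if every
  maximizer does. After rescaling, maximizers stay bounded and their limit points \<open>(x, y)\<close> satisfy
  \<open>x \<in> W(y,t)\<close>; all three claims follow by passing to convergent subsequences.

  The probabilistic input is that \<open>n\<inverse> \<^bold>H((ny,0),(nx,nt)) \<rightarrow> t g((x-y)/t)\<close> almost surely for all rational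
  \<open>y < x\<close>, together with a bound \<open>\<^bold>H((ny,0),(nb,nt)) \<le> C n |y|\<^sup>d\<^sup>/\<^sup>(\<^sup>d\<^sup>+\<^sup>1\<^sup>)\<close> for large \<open>|y|\<close>. Approximating by
  grids, the law of the longest chain in a box depends only on its volume, and disjoint boxes are
  independent. The lower tail comes from stacking independent blocks. The upper tail comes from the
  hypothesis on \<open>c\<close> itself: along the diagonal, superadditivity bounds the chains in disjoint cubes of
  geometrically growing side, so the second Borel--Cantelli lemma makes the tail probabilities
  summable, and the first one transfers this to all boxes of the same volumes.
\<close>

section \<open>Boxes and chains\<close>

text \<open>Two obstacles shape the probability. The limit defining \<open>c\<close> concerns boxes
  with one fixed corner, while boxes between \<open>n y\<close> and \<open>n x\<close> move with
  \<open>n\<close>; equality of laws transfers tail probabilities but not almost sure limits, so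
  summable tails are needed first. The second Borel--Cantelli lemma needs independent, hence
  disjoint cubes. At distance \<open>s\<close> along the diagonal the limit leaves an error
  proportional to \<open>s\<close>, harmless only if the side of the cube there is also proportional
  to \<open>s\<close>. This forces geometric scales; monotonicity of chains in the box then fills in
  the \<open>n\<close> between two scales, at a cost vanishing as the ratio tends to 1. Grids serve
  two purposes: occupation of equal cells has a joint law that knows only the cell volume, and it
  makes chain events measurable although \<open>P\<close> is accessible only through counts.
  Maximizers range over unboundedly many \<open>y\<close>, which no pointwise limit controls; a
  union bound over chains, summable over dyadic shells and over \<open>n\<close>, gives the far
  bound, and the decay of the initial heights, available with any constant, beats it.\<close>

definition co :: "(real^'d) \<times> real \<Rightarrow> 'd option \<Rightarrow> real" where
  "co p i = (case i of None \<Rightarrow> snd p | Some j \<Rightarrow> fst p $ j)"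

definition corner :: "real^'d \<Rightarrow> real \<Rightarrow> 'd option \<Rightarrow> real" where
  "corner y a i = (case i of None \<Rightarrow> a | Some j \<Rightarrow> y $ j)"

text \<open>Indexing by \<open>'d option\<close>, with \<open>None\<close> for time, puts space and
  time on the same footing: the chain order is one quantifier and a volume one product. Boxes are
  open below and closed above, so that they tile and so that boxes touching at a corner are strictly
  ordered.\<close>

definition hbox :: "('d option \<Rightarrow> real) \<Rightarrow> ('d option \<Rightarrow> real) \<Rightarrow> ((real^'d) \<times> real) set" where
  "hbox l u = {p. \<forall>i. l i < co p i \<and> co p i \<le> u i}"

definition vol :: "('d::finite option \<Rightarrow> real) \<Rightarrow> ('d option \<Rightarrow> real) \<Rightarrow> real" where
  "vol l u = (\<Prod>i\<in>UNIV. u i - l i)"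

text \<open>A predicate "at least k points fit" replaces the extended real supremum
  \<open>Hlp\<close>; it is monotone, additive under stacking and describes an event directly.
  \<open>Hlp_ge_iff\<close> translates back.\<close>

definition has_chain :: "((real^'d) \<times> real) set \<Rightarrow> nat \<Rightarrow> bool" where
  "has_chain S k \<longleftrightarrow> (\<exists>C. st_chain C \<and> C \<subseteq> S \<and> card C = k)"

lemma co_simps [simp]: "co p None = snd p" "co p (Some j) = fst p $ j"
  by (simp_all add: co_def)

lemma corner_simps [simp]: "corner y a None = a" "corner y a (Some j) = y $ j"
  by (simp_all add: corner_def)

lemma all_option: "(\<forall>i. Q i) \<longleftrightarrow> Q None \<and> (\<forall>j. Q (Some j))"
  by (metis option.exhaust)

lemma st_lt_iff_co: "st_lt p q \<longleftrightarrow> (\<forall>i. co p i < co q i)"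
  by (auto simp: st_lt_def vlt_def all_option)

lemma hbox_corner:
  "hbox (corner y a) (corner x b) = {(\<eta>, s). vlt y \<eta> \<and> \<eta> \<le> x \<and> a < s \<and> s \<le> b}"
  by (auto simp: hbox_def vlt_def all_option less_eq_vec_def)

lemma hbox_mono: "\<lbrakk>\<And>i. l' i \<le> l i; \<And>i. u i \<le> u' i\<rbrakk> \<Longrightarrow> hbox l u \<subseteq> hbox l' u'"
  unfolding hbox_def by (auto intro: order_trans le_less_trans)

lemma prod_option: "(\<Prod>i\<in>UNIV. f i) = f None * (\<Prod>j\<in>UNIV. f (Some j))"
  for f :: "'d::finite option \<Rightarrow> 'b::comm_monoid_mult"
proof -
  have "(UNIV :: 'd option set) = insert None (range Some)"
    by (auto simp: UNIV_option_conv)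
  then have "(\<Prod>i\<in>UNIV. f i) = (\<Prod>i\<in>insert None (range Some). f i)"
    by simp
  also have "\<dots> = f None * (\<Prod>i\<in>range Some. f i)"
    by (rule prod.insert) auto
  finally show ?thesis
    by (simp add: prod.reindex)
qed

lemma vol_corner: "vol (corner y a) (corner x b) = (b - a) * (\<Prod>i\<in>UNIV. x $ i - y $ i)"
  by (simp add: vol_def prod_option)

lemma has_chain_mono: "has_chain S k \<Longrightarrow> S \<subseteq> T \<Longrightarrow> k' \<le> k \<Longrightarrow> has_chain T k'"
proof -
  assume "has_chain S k" and ST: "S \<subseteq> T" and k: "k' \<le> k"
  then obtain C where C: "st_chain C" "C \<subseteq> S" "card C = k"
    by (auto simp: has_chain_def)
  obtain C' where C': "C' \<subseteq> C" "card C' = k'"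
    using obtain_subset_with_card_n k C(3) by metis
  have "st_chain C'"
    using C(1) C'(1) unfolding st_chain_def by (meson finite_subset subsetD)
  then show "has_chain T k'"
    unfolding has_chain_def using C' C(2) ST by blast
qed

lemma has_chain_0 [simp]: "has_chain S 0"
  unfolding has_chain_def st_chain_def by (rule exI[of _ "{}"]) auto

lemma has_chain_add:
  assumes "has_chain S k" "has_chain T m" "\<And>p q. p \<in> S \<Longrightarrow> q \<in> T \<Longrightarrow> st_lt p q"
  shows "has_chain (S \<union> T) (k + m)"
proof -
  obtain C D where C: "st_chain C" "C \<subseteq> S" "card C = k" and D: "st_chain D" "D \<subseteq> T" "card D = m"
    using assms(1,2) unfolding has_chain_def by blast
  have "C \<inter> D = {}"
    using C(2) D(2) assms(3) by (force simp: st_lt_def)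
  then have "card (C \<union> D) = k + m"
    using C D by (simp add: card_Un_disjoint st_chain_def)
  moreover have "st_chain (C \<union> D)"
    using C D assms(3) unfolding st_chain_def by blast
  ultimately show ?thesis
    unfolding has_chain_def using C D by blast
qed

text \<open>Lengths are integers: if the supremum is at least k > 0, some chain is longer than k -
  1, hence has at least k points, even when the supremum is infinite.\<close>

lemma Hlp_ge_iff: "ereal (real k) \<le> Hlp P y x t \<longleftrightarrow> has_chain (P \<inter> hbox (corner y 0) (corner x t)) k"
proof
  assume "has_chain (P \<inter> hbox (corner y 0) (corner x t)) k"
  then show "ereal (real k) \<le> Hlp P y x t"
    unfolding has_chain_def Hlp_def hbox_corner by (auto intro!: SUP_upper)
next
  assume k: "ereal (real k) \<le> Hlp P y x t"
  show "has_chain (P \<inter> hbox (corner y 0) (corner x t)) k"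
  proof (cases "k = 0")
    case False
    then have "ereal (real k - 1) < Hlp P y x t"
      using k by (metis less_ereal.simps(1) less_le_trans diff_less_eq less_add_one)
    then obtain C where C: "st_chain C" "C \<subseteq> P \<inter> hbox (corner y 0) (corner x t)"
        "ereal (real k - 1) < ereal (real (card C))"
      unfolding Hlp_def hbox_corner less_SUP_iff by blast
    then have "k \<le> card C" by auto
    then show ?thesis
      using C has_chain_mono[of _ "card C"] unfolding has_chain_def by (metis order_refl has_chain_def has_chain_mono)
  qed simp
qed

lemma Hlp_nonneg: "0 \<le> Hlp P y x t"
  using Hlp_ge_iff[of 0] by (simp add: zero_ereal_def)

lemma Hlp_less: "\<not> has_chain (P \<inter> hbox (corner y 0) (corner x t)) k \<Longrightarrow> Hlp P y x t < ereal (real k)"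
  using Hlp_ge_iff[of k P y x t] by auto

lemma Hlp_mono:
  assumes "y' \<le> y" "x \<le> x'" "t \<le> t'"
  shows "Hlp P y x t \<le> Hlp P y' x' t'"
proof -
  have "hbox (corner y 0) (corner x t) \<subseteq> hbox (corner y' 0) (corner x' t')"
    using assms by (intro hbox_mono) (auto simp: less_eq_vec_def corner_def split: option.splits)
  then show ?thesis
    unfolding Hlp_def hbox_corner[symmetric] by (intro SUP_subset_mono) auto
qed

lemma Hlp_natE:
  assumes "Hlp P y x t < \<infinity>"
  obtains k :: nat where "Hlp P y x t = ereal (real k)"
proof -
  obtain r where r: "Hlp P y x t = ereal r" "0 \<le> r"
    using assms Hlp_nonneg[of P y x t] by (cases "Hlp P y x t") auto
  define m where "m = nat \<lfloor>r\<rfloor>"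
  have "real m \<le> r" "r < real m + 1"
    using r(2) unfolding m_def by linarith+
  have "\<not> has_chain (P \<inter> hbox (corner y 0) (corner x t)) (Suc m)"
    using Hlp_ge_iff[of "Suc m" P y x t] r \<open>r < real m + 1\<close> by simp
  have "Hlp P y x t \<le> ereal (real m)"
    unfolding Hlp_def
  proof (rule SUP_least)
    fix C assume C: "C \<in> {C. st_chain C \<and> C \<subseteq> P \<inter> {(\<eta>, s). vlt y \<eta> \<and> \<eta> \<le> x \<and> 0 < s \<and> s \<le> t}}"
    then have "has_chain (P \<inter> hbox (corner y 0) (corner x t)) (card C)"
      unfolding has_chain_def hbox_corner by blast
    then have "\<not> Suc m \<le> card C"
      using \<open>\<not> has_chain _ (Suc m)\<close> has_chain_mono by blast
    then show "ereal (real (card C)) \<le> ereal (real m)" by simp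
  qed
  then show ?thesis
    using r \<open>real m \<le> r\<close> that by (metis antisym ereal_less_eq(3))
qed

lemma box_subset_hbox:
  "box (\<chi> j. l (Some j), l None) (\<chi> j. u (Some j), u None) \<subseteq> hbox l u"
  "hbox l u \<subseteq> cbox (\<chi> j. l (Some j), l None) (\<chi> j. u (Some j), u None)"
  by (auto simp: hbox_def mem_box all_option Basis_prod_def Basis_vec_def inner_axis ball_Un less_imp_le)

lemma hbox_sets [measurable]: "hbox l u \<in> sets borel"
proof -
  have "hbox l u = (\<Inter>j. {p. l (Some j) < fst p $ j} \<inter> {p. fst p $ j \<le> u (Some j)})
      \<inter> ({p. l None < snd p} \<inter> {p. snd p \<le> u None})"
    by (auto simp: hbox_def all_option)
  also have "\<dots> \<in> sets borel"
    by (intro sets.Int sets.finite_INT borel_open[OF open_Collect_less] borel_closed[OF closed_Collect_le]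
        continuous_intros) auto
  finally show ?thesis .
qed

lemma bounded_hbox: "bounded (hbox l u)"
  using box_subset_hbox(2) bounded_cbox bounded_subset by blast

text \<open>The half-open box lies between the open and the closed box, which have the same Lebesgue
  measure.\<close>

lemma measure_hbox:
  assumes "\<And>i. l i \<le> u i"
  shows "measure lborel (hbox l u) = vol l u"
proof -
  let ?l = "(\<chi> j. l (Some j), l None)" and ?u = "(\<chi> j. u (Some j), u None)"
  have le: "?l \<bullet> b \<le> ?u \<bullet> b" if "b \<in> Basis" for b
    using that assms by (auto simp: Basis_prod_def Basis_vec_def inner_axis)
  have inj: "inj (\<lambda>j::'a. (axis j (1::real), 0::real))"
    by (auto simp: inj_on_def axis_eq_axis)
  have bas: "(Basis :: ((real^'a) \<times> real) set) = insert (0, 1) (range (\<lambda>j. (axis j 1, 0)))"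
    by (auto simp: Basis_prod_def Basis_vec_def)
  have v: "(\<Prod>b\<in>Basis. (?u - ?l) \<bullet> b) = vol l u"
    unfolding bas vol_def prod_option
    by (subst prod.insert) (auto simp: prod.reindex[OF inj] inner_axis)
  have "emeasure lborel (box ?l ?u) \<le> emeasure lborel (hbox l u)"
    "emeasure lborel (hbox l u) \<le> emeasure lborel (cbox ?l ?u)"
    using box_subset_hbox[of l u] by (intro emeasure_mono; simp)+
  then have "emeasure lborel (hbox l u) = ennreal (vol l u)"
    using le v emeasure_lborel_box[of ?l ?u] emeasure_lborel_cbox[of ?l ?u] by simp
  then show ?thesis
    using assms by (simp add: measure_def vol_def prod_nonneg)
qed

section \<open>Discretisation by grids\<close>

definition cells :: "nat \<Rightarrow> ('d::finite option \<Rightarrow> nat) set" where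
  "cells N = {\<kappa>. \<forall>i. \<kappa> i < N}"

definition cell :: "('d option \<Rightarrow> real) \<Rightarrow> ('d option \<Rightarrow> real) \<Rightarrow> nat \<Rightarrow> ('d option \<Rightarrow> nat) \<Rightarrow> ((real^'d) \<times> real) set"
  where "cell l u N \<kappa> = hbox (\<lambda>i. l i + (u i - l i) * real (\<kappa> i) / real N)
           (\<lambda>i. l i + (u i - l i) * (real (\<kappa> i) + 1) / real N)"

definition grid_chain :: "('d option \<Rightarrow> nat) set \<Rightarrow> bool" where
  "grid_chain D \<longleftrightarrow> (\<forall>\<kappa>\<in>D. \<forall>\<kappa>'\<in>D. \<kappa> \<noteq> \<kappa>' \<longrightarrow> (\<forall>i. \<kappa> i < \<kappa>' i) \<or> (\<forall>i. \<kappa>' i < \<kappa> i))"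

definition has_grid_chain :: "('d option \<Rightarrow> nat) set \<Rightarrow> nat \<Rightarrow> bool" where
  "has_grid_chain S k \<longleftrightarrow> (\<exists>D\<subseteq>S. grid_chain D \<and> card D = k)"

lemma cells_eq_PiE: "cells N = PiE UNIV (\<lambda>_. {..<N})"
  by (auto simp: cells_def PiE_def)

lemma finite_cells [simp]: "finite (cells N)"
  unfolding cells_eq_PiE by (rule finite_PiE) auto

lemma cell_le:
  assumes "\<kappa> i < \<kappa>' i" "l i < u i" "p \<in> cell l u N \<kappa>" "q \<in> cell l u N \<kappa>'" "N > 0"
  shows "co p i < co q i"
proof -
  have "co p i \<le> l i + (u i - l i) * (real (\<kappa> i) + 1) / real N"
    using assms by (auto simp: cell_def hbox_def)
  also have "\<dots> \<le> l i + (u i - l i) * real (\<kappa>' i) / real N"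
    using assms by (intro add_left_mono divide_right_mono mult_left_mono) auto
  also have "\<dots> < co q i"
    using assms by (auto simp: cell_def hbox_def)
  finally show ?thesis .
qed

lemma cell_disjoint:
  assumes "\<kappa> \<noteq> \<kappa>'" "\<And>i. l i < u i" "N > 0"
  shows "cell l u N \<kappa> \<inter> cell l u N \<kappa>' = {}"
proof -
  obtain i where "\<kappa> i \<noteq> \<kappa>' i" using assms(1) by blast
  then consider "\<kappa> i < \<kappa>' i" | "\<kappa>' i < \<kappa> i" by linarith
  then show ?thesis
    using cell_le[of \<kappa> i \<kappa>' l u _ N] cell_le[of \<kappa>' i \<kappa> l u _ N] assms(2,3) by cases (auto; metis less_irrefl)+
qed

lemma cell_subset:
  assumes "\<kappa> \<in> cells N" "\<And>i. l i < u i"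
  shows "cell l u N \<kappa> \<subseteq> hbox l u"
  unfolding cell_def
proof (rule hbox_mono)
  fix i
  have "Suc (\<kappa> i) \<le> N" using assms(1) by (simp add: cells_def Suc_leI)
  then have N: "real (\<kappa> i) + 1 \<le> real N" by linarith
  show "l i \<le> l i + (u i - l i) * real (\<kappa> i) / real N"
    using assms(2)[of i] by simp
  have "(u i - l i) * (real (\<kappa> i) + 1) \<le> (u i - l i) * real N"
    using N assms(2)[of i] by (intro mult_left_mono) auto
  then show "l i + (u i - l i) * (real (\<kappa> i) + 1) / real N \<le> u i"
    using N by (simp add: field_simps)
qed

lemma vol_cell:
  "vol (\<lambda>i. l i + (u i - l i) * real (\<kappa> i) / real N) (\<lambda>i. l i + (u i - l i) * (real (\<kappa> i) + 1) / real N)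
    = vol l u / real N ^ (CARD('d) + 1)" for \<kappa> :: "'d::finite option \<Rightarrow> nat"
proof -
  have "(l i + (u i - l i) * (real (\<kappa> i) + 1) / real N) - (l i + (u i - l i) * real (\<kappa> i) / real N)
      = (u i - l i) / real N" for i
    by (simp add: distrib_left add_divide_distrib)
  then show ?thesis
    by (simp add: vol_def prod_dividef card_UNIV_option)
qed

text \<open>One point is chosen in each occupied cell. A cell contains its upper faces but not its
  lower ones, so points of strictly ordered cells are strictly ordered even if the cells
  touch.\<close>

lemma has_chain_if_grid:
  assumes "has_grid_chain {\<kappa>\<in>cells N. S \<inter> cell l u N \<kappa> \<noteq> {}} k" "\<And>i. l i < u i" "N > 0"
  shows "has_chain (S \<inter> hbox l u) k"
proof -
  obtain D where D: "D \<subseteq> {\<kappa>\<in>cells N. S \<inter> cell l u N \<kappa> \<noteq> {}}" "grid_chain D" "card D = k"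
    using assms(1) by (auto simp: has_grid_chain_def)
  have "finite D" by (rule finite_subset[OF D(1)]) simp
  have "\<forall>\<kappa>\<in>D. \<exists>p. p \<in> S \<and> p \<in> cell l u N \<kappa>" using D(1) by blast
  then obtain f where f: "\<And>\<kappa>. \<kappa> \<in> D \<Longrightarrow> f \<kappa> \<in> S \<and> f \<kappa> \<in> cell l u N \<kappa>" by metis
  have lt: "st_lt (f \<kappa>) (f \<kappa>')" if "\<kappa> \<in> D" "\<kappa>' \<in> D" "\<forall>i. \<kappa> i < \<kappa>' i" for \<kappa> \<kappa>'
    unfolding st_lt_iff_co using cell_le[of \<kappa> _ \<kappa>' l u _ N] f that assms(2,3) by blast
  have "inj_on f D"
    using f cell_disjoint[of _ _ l u N] assms(2,3) by (intro inj_onI) (metis IntI empty_iff)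
  then have "card (f ` D) = k" using D(3) by (simp add: card_image)
  moreover have "st_chain (f ` D)"
    unfolding st_chain_def
  proof (intro conjI ballI impI)
    fix p q assume "p \<in> f ` D" "q \<in> f ` D" "p \<noteq> q"
    then obtain \<kappa> \<kappa>' where k: "\<kappa> \<in> D" "\<kappa>' \<in> D" "p = f \<kappa>" "q = f \<kappa>'" "\<kappa> \<noteq> \<kappa>'" by auto
    then have "(\<forall>i. \<kappa> i < \<kappa>' i) \<or> (\<forall>i. \<kappa>' i < \<kappa> i)" using D(2) by (auto simp: grid_chain_def)
    then show "st_lt p q \<or> st_lt q p" using lt k by blast
  qed (simp add: \<open>finite D\<close>)
  moreover have "f ` D \<subseteq> S \<inter> hbox l u"
    using f cell_subset[of _ N l u] D(1) assms(2) by blast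
  ultimately show ?thesis unfolding has_chain_def by blast
qed

text \<open>A fixed finite chain has a smallest coordinate gap; once the mesh is finer than every
  gap, its points occupy cells that are strictly ordered in all coordinates.\<close>

lemma eventually_grid_if_has_chain:
  fixes l u :: "'d::finite option \<Rightarrow> real"
  assumes "has_chain (S \<inter> hbox l u) k" and lu: "\<And>i. l i < u i"
  shows "\<forall>\<^sub>F N in sequentially. has_grid_chain {\<kappa>\<in>cells N. S \<inter> cell l u N \<kappa> \<noteq> {}} k"
proof -
  obtain C where C: "st_chain C" "C \<subseteq> S \<inter> hbox l u" "card C = k"
    using assms(1) by (auto simp: has_chain_def)
  have fin: "finite C" using C(1) by (simp add: st_chain_def)
  have ev1: "\<forall>\<^sub>F N in sequentially. st_lt p q \<longrightarrow> (u i - l i) < (co q i - co p i) * real N" for p q i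
  proof (cases "st_lt p q")
    case True
    then have "co q i - co p i > 0" by (simp add: st_lt_iff_co)
    moreover have "\<forall>\<^sub>F N in sequentially. (u i - l i) / (co q i - co p i) < real N"
      using filterlim_real_sequentially unfolding filterlim_at_top_dense by blast
    ultimately show ?thesis by (auto elim!: eventually_mono simp: field_simps)
  qed simp
  have ev: "\<forall>\<^sub>F N in sequentially. \<forall>p\<in>C. \<forall>q\<in>C. \<forall>i\<in>UNIV. st_lt p q \<longrightarrow> (u i - l i) < (co q i - co p i) * real N"
    by (intro eventually_ball_finite fin finite ballI ev1) 
  from ev eventually_gt_at_top[of 0] show ?thesis
  proof eventually_elim
    case (elim N)
    \<comment> \<open>Ceiling minus one, rather than floor, because a point on a grid hyperplane
      belongs to the cell below it.\<close>
    define f where "f p i = nat (\<lceil>(co p i - l i) * real N / (u i - l i)\<rceil> - 1)" for p i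
    have pos: "0 < (co p i - l i) * real N / (u i - l i)" 
      and le: "(co p i - l i) * real N / (u i - l i) \<le> real N" if "p \<in> C" for p i
    proof -
      have "l i < co p i" "co p i \<le> u i" using C(2) that by (auto simp: hbox_def)
      then show "0 < (co p i - l i) * real N / (u i - l i)" using elim lu[of i] by simp
      have "(co p i - l i) * real N \<le> (u i - l i) * real N"
        using \<open>co p i \<le> u i\<close> by (intro mult_right_mono) auto
      then show "(co p i - l i) * real N / (u i - l i) \<le> real N"
        using lu[of i] by (simp add: field_simps)
    qed
    have f1: "real (f p i) < (co p i - l i) * real N / (u i - l i)"
      and f2: "(co p i - l i) * real N / (u i - l i) \<le> real (f p i) + 1" if "p \<in> C" for p i
      using pos[OF that, of i] unfolding f_def by linarith+
    have cellp: "p \<in> cell l u N (f p)" if "p \<in> C" for p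
      unfolding cell_def hbox_def
    proof (intro CollectI allI conjI)
      fix i
      show "l i + (u i - l i) * real (f p i) / real N < co p i"
        using f1[OF that, of i] lu[of i] elim by (simp add: field_simps)
      show "co p i \<le> l i + (u i - l i) * (real (f p i) + 1) / real N"
        using f2[OF that, of i] lu[of i] elim by (simp add: field_simps)
    qed
    have fcells: "f p \<in> cells N" if "p \<in> C" for p
      unfolding cells_def using less_le_trans[OF f1[OF that] le[OF that]] by simp
    have flt: "f p i < f q i" if "p \<in> C" "q \<in> C" "st_lt p q" for p q i
    proof -
      have "u i - l i < (co q i - co p i) * real N" using elim that by blast
      then have "1 < (co q i - co p i) * real N / (u i - l i)" using lu[of i] by simp
      also have "\<dots> = (co q i - l i) * real N / (u i - l i) - (co p i - l i) * real N / (u i - l i)"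
        by (simp add: algebra_simps diff_divide_distrib)
      finally show ?thesis using f1[OF that(1), of i] f2[OF that(2), of i] by linarith
    qed
    have "inj_on f C"
    proof (rule inj_onI)
      fix p q assume pq: "p \<in> C" "q \<in> C" "f p = f q"
      show "p = q"
      proof (rule ccontr)
        assume "p \<noteq> q"
        then have "st_lt p q \<or> st_lt q p" using C(1) pq by (auto simp: st_chain_def)
        then show False using flt[of p q None] flt[of q p None] pq by auto
      qed
    qed
    then have "card (f ` C) = k" using C(3) by (simp add: card_image)
    moreover have "grid_chain (f ` C)"
      unfolding grid_chain_def
    proof (intro ballI impI)
      fix a b assume "a \<in> f ` C" "b \<in> f ` C" "a \<noteq> b"
      then obtain p q where pq: "p \<in> C" "q \<in> C" "a = f p" "b = f q" "p \<noteq> q" by auto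
      then have "st_lt p q \<or> st_lt q p" using C(1) by (auto simp: st_chain_def)
      then show "(\<forall>i. a i < b i) \<or> (\<forall>i. b i < a i)" using flt pq by blast
    qed
    moreover have "f ` C \<subseteq> {\<kappa>\<in>cells N. S \<inter> cell l u N \<kappa> \<noteq> {}}"
      using cellp fcells C(2) by blast
    ultimately show ?case unfolding has_grid_chain_def by blast
  qed
qed

section \<open>Two tools for probabilities of events\<close>

text \<open>Dominated convergence of indicators. It carries identities between probabilities from
  grids to the events they approximate, and turns almost sure eventual behaviour into convergence of
  probabilities.\<close>

lemma (in prob_space) prob_tendsto_of_AE:
  assumes "\<And>n. A n \<in> events" "B \<in> events" "AE \<omega> in M. \<forall>\<^sub>F n in sequentially. (\<omega> \<in> A n \<longleftrightarrow> \<omega> \<in> B)"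
  shows "(\<lambda>n. prob (A n)) \<longlonglongrightarrow> prob B"
proof -
  have "(\<lambda>n. \<integral>\<omega>. indicat_real (A n) \<omega> \<partial>M) \<longlonglongrightarrow> (\<integral>\<omega>. indicat_real B \<omega> \<partial>M)"
  proof (rule integral_dominated_convergence[where w = "\<lambda>_. 1"])
    show "AE \<omega> in M. (\<lambda>n. indicat_real (A n) \<omega>) \<longlonglongrightarrow> indicat_real B \<omega>"
      using assms(3)
    proof eventually_elim
      case (elim \<omega>)
      then have "\<forall>\<^sub>F n in sequentially. indicat_real (A n) \<omega> = indicat_real B \<omega>"
        by eventually_elim (simp add: indicator_def)
      then show ?case by (rule tendsto_eventually)
    qed
  qed (use assms in \<open>auto simp: indicator_def\<close>)
  then show ?thesis using assms by simp
qed

text \<open>\<open>poisson_pp\<close> states independence for families indexed by naturals only;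
  this moves it to other index types, such as pairs of a box and a cell.\<close>

lemma (in prob_space) indep_vars_reindex:
  assumes ind: "indep_vars (\<lambda>_. N) (\<lambda>n. X (g n)) (f ` I)" and gf: "\<And>i. i \<in> I \<Longrightarrow> g (f i) = i"
  shows "indep_vars (\<lambda>_. N) X I"
  unfolding indep_vars_def2 indep_sets_def
proof (intro conjI ballI allI impI)
  fix i assume "i \<in> I"
  then have "f i \<in> f ` I" by simp
  then have "random_variable N (X (g (f i)))" using ind unfolding indep_vars_def2 by blast
  then show rv: "random_variable N (X i)" using gf[OF \<open>i \<in> I\<close>] by simp
  then show "{X i -` A \<inter> space M |A. A \<in> sets N} \<subseteq> events" by (auto intro: measurable_sets)
next
  fix J A assume J: "J \<subseteq> I" "J \<noteq> {}" "finite J"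
    and A: "A \<in> (\<Pi> j\<in>J. {X j -` A \<inter> space M |A. A \<in> sets N})"
  have inj: "inj_on f J" using gf J(1) by (metis inj_onI subsetD)
  have *: "(\<And>J A. J \<subseteq> f ` I \<Longrightarrow> J \<noteq> {} \<Longrightarrow> finite J \<Longrightarrow>
       A \<in> (\<Pi> j\<in>J. {X (g j) -` A \<inter> space M |A. A \<in> sets N}) \<Longrightarrow> prob (\<Inter>j\<in>J. A j) = (\<Prod>j\<in>J. prob (A j)))"
    using ind unfolding indep_vars_def2 indep_sets_def by blast
  have "prob (\<Inter>j\<in>f ` J. A (g j)) = (\<Prod>j\<in>f ` J. prob (A (g j)))"
    using J A gf by (intro *) (auto simp: Pi_iff subset_iff)
  then show "prob (\<Inter>j\<in>J. A j) = (\<Prod>j\<in>J. prob (A j))"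
    using gf J(1) by (simp add: prod.reindex[OF inj] subset_iff image_image cong: INF_cong prod.cong)
qed

section \<open>Counting increasing chains of cells\<close>

text \<open>All coordinates order a grid chain in the same way, so the rank of an element among the
  coordinate values does not depend on the coordinate.\<close>

lemma grid_chain_rank:
  fixes D :: "('d option \<Rightarrow> nat) set"
  assumes "grid_chain D" "\<kappa> \<in> D"
  shows "card {a \<in> (\<lambda>\<kappa>. \<kappa> i) ` D. a < \<kappa> i} = card {\<kappa>'\<in>D. \<kappa>' None < \<kappa> None}"
proof -
  have 1: "{a \<in> (\<lambda>\<kappa>. \<kappa> i) ` D. a < \<kappa> i} = (\<lambda>\<kappa>. \<kappa> i) ` {\<kappa>'\<in>D. \<kappa>' None < \<kappa> None}"
    using assms unfolding grid_chain_def by (auto simp: image_iff) (metis order_less_asym less_irrefl)+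
  have "inj_on (\<lambda>\<kappa>. \<kappa> i) {\<kappa>'\<in>D. \<kappa>' None < \<kappa> None}"
    using assms unfolding grid_chain_def by (intro inj_onI) (metis (mono_tags, lifting) less_irrefl mem_Collect_eq)
  then show ?thesis unfolding 1 by (rule card_image)
qed

lemma rank_inj:
  fixes a b :: nat
  assumes "finite S" "a \<in> S" "b \<in> S" "card {x\<in>S. x < a} = card {x\<in>S. x < b}"
  shows "a = b"
proof (rule ccontr)
  assume "a \<noteq> b"
  have *: "card {x\<in>S. x < a} < card {x\<in>S. x < b}" if "a < b" "a \<in> S" for a b
    using that assms(1) by (intro psubset_card_mono) auto
  from \<open>a \<noteq> b\<close> show False using *[of a b] *[of b a] assms by (cases "a < b") auto
qed

text \<open>A chain is determined by its coordinate projections: the element of rank j has the j-th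
  smallest value in each coordinate. Each projection is a k-subset of N values, and there are d + 1
  of them.\<close>

lemma card_grid_chains:
  "card {D. D \<subseteq> (cells N :: ('d::finite option \<Rightarrow> nat) set) \<and> grid_chain D \<and> card D = k}
     \<le> (N choose k) ^ (CARD('d) + 1)" (is "card ?G \<le> _")
proof -
  let ?T = "{S. S \<subseteq> {..<N} \<and> card S = k}"
  let ?f = "\<lambda>D (i::'d option). (\<lambda>\<kappa>. \<kappa> i) ` D"
  have finT: "finite ?T" by simp
  have "inj_on ?f ?G"
  proof (rule inj_onI)
    fix D E assume D: "D \<in> ?G" and E: "E \<in> ?G" and eq: "?f D = ?f E"
    have sub: "D \<subseteq> E" if D: "D \<in> ?G" and E: "E \<in> ?G" and eq: "?f D = ?f E" for D E
    proof
      fix \<kappa> assume k: "\<kappa> \<in> D"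
      have "\<kappa> None \<in> ?f E None" using k fun_cong[OF eq, of None] by blast
      then obtain \<kappa>' where k': "\<kappa>' \<in> E" "\<kappa>' None = \<kappa> None" by auto
      have "\<kappa> i = \<kappa>' i" for i
      proof (rule rank_inj)
        have fin: "finite D" using D finite_subset[OF _ finite_cells] by blast
        show "finite (?f D i)" using fin by simp
        show "\<kappa> i \<in> ?f D i" using k by simp
        show "\<kappa>' i \<in> ?f D i" using k' fun_cong[OF eq, of i] by blast
        have "card {x \<in> ?f D i. x < \<kappa> i} = card {\<mu>\<in>D. \<mu> None < \<kappa> None}"
          using grid_chain_rank[of D \<kappa> i] D k by blast
        also have "\<dots> = card {x \<in> ?f D None. x < \<kappa> None}"
          using grid_chain_rank[of D \<kappa> None] D k by auto
        also have "\<dots> = card {x \<in> ?f E None. x < \<kappa>' None}"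
          using fun_cong[OF eq, of None] k' by auto
        also have "\<dots> = card {x \<in> ?f E i. x < \<kappa>' i}"
          using grid_chain_rank[of E \<kappa>' None] grid_chain_rank[of E \<kappa>' i] E k' by auto
        finally show "card {x \<in> ?f D i. x < \<kappa> i} = card {x \<in> ?f D i. x < \<kappa>' i}"
          using fun_cong[OF eq, of i] by simp
      qed
      then have "\<kappa> = \<kappa>'" by (rule ext)
      then show "\<kappa> \<in> E" using k' by simp
    qed
    show "D = E" using sub[OF D E eq] sub[OF E D eq[symmetric]] by blast
  qed
  moreover have "?f ` ?G \<subseteq> PiE UNIV (\<lambda>_. ?T)"
  proof (clarsimp simp: PiE_def)
    fix D :: "('d option \<Rightarrow> nat) set" and i :: "'d option" assume D: "D \<subseteq> cells N" "grid_chain D"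
    have "inj_on (\<lambda>\<kappa>. \<kappa> i) D"
      using D unfolding grid_chain_def by (intro inj_onI) (metis less_irrefl)
    then show "(\<lambda>\<kappa>. \<kappa> i) ` D \<subseteq> {..<N} \<and> card ((\<lambda>\<kappa>. \<kappa> i) ` D) = card D"
      using D(1) by (auto simp: card_image cells_def)
  qed
  moreover have "finite (PiE (UNIV :: 'd option set) (\<lambda>_. ?T))" 
    using finT by (intro finite_PiE) auto
  ultimately have "card ?G \<le> card (PiE (UNIV :: 'd option set) (\<lambda>_. ?T))"
    by (rule card_inj_on_le)
  also have "\<dots> = (N choose k) ^ (CARD('d) + 1)"
    by (subst card_PiE) (auto simp: n_subsets card_UNIV_option)
  finally show ?thesis .
qed

section \<open>Chains in a Poisson process\<close>

locale poisson =
  fixes M :: "'w measure" and P :: "'w \<Rightarrow> ((real^'d) \<times> real) set"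
  assumes PPP: "poisson_pp M P"

sublocale poisson \<subseteq> prob_space M
  using PPP by (simp add: poisson_pp_def)

context poisson
begin

text \<open>These are the sets for which \<open>poisson_pp\<close> supplies measurability, the law
  of the count and independence.\<close>

definition admissible :: "((real^'d) \<times> real) set \<Rightarrow> bool" where
  "admissible A \<longleftrightarrow> A \<in> sets borel \<and> bounded A \<and> A \<subseteq> st_region"

lemma AE_locally_finite: "AE \<omega> in M. \<forall>A. bounded A \<longrightarrow> finite (P \<omega> \<inter> A)"
  using PPP by (simp add: poisson_pp_def)

lemma measurable_card:
  assumes "admissible A"
  shows "(\<lambda>\<omega>. card (P \<omega> \<inter> A)) \<in> measurable M (count_space UNIV)"
  using PPP assms by (auto simp: poisson_pp_def admissible_def)

lemma occupied_sets [measurable]: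
  assumes "admissible A"
  shows "{\<omega>\<in>space M. card (P \<omega> \<inter> A) \<noteq> 0} \<in> events"
  using measurable_sets[OF measurable_card[OF assms], of "-{0}"] by (simp add: vimage_def Int_def conj_commute)

lemma prob_occupied:
  assumes "admissible A"
  shows "prob {\<omega>\<in>space M. card (P \<omega> \<inter> A) \<noteq> 0} = 1 - exp (- measure lborel A)"
proof -
  have "prob {\<omega>\<in>space M. card (P \<omega> \<inter> A) = 0} = measure lborel A ^ 0 / fact 0 * exp (- measure lborel A)"
    using PPP assms by (auto simp: poisson_pp_def admissible_def)
  moreover have "{\<omega>\<in>space M. card (P \<omega> \<inter> A) \<noteq> 0} = space M - {\<omega>\<in>space M. card (P \<omega> \<inter> A) = 0}"
    by auto
  moreover have "{\<omega>\<in>space M. card (P \<omega> \<inter> A) = 0} \<in> events"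
    using measurable_sets[OF measurable_card[OF assms], of "{0}"] by (simp add: vimage_def Int_def conj_commute)
  ultimately show ?thesis by (simp add: prob_compl)
qed

lemma indep_occupied:
  fixes I :: "'i set"
  assumes "finite I" "disjoint_family_on A I" "\<And>i. i \<in> I \<Longrightarrow> admissible (A i)"
  shows "indep_vars (\<lambda>_. count_space UNIV) (\<lambda>i \<omega>. card (P \<omega> \<inter> A i) \<noteq> 0) I"
proof -
  obtain f :: "'i \<Rightarrow> nat" where f: "inj_on f I" using finite_imp_inj_to_nat_seg[OF assms(1)] by blast
  define g where "g = the_inv_into I f"
  have gf: "g (f i) = i" if "i \<in> I" for i using the_inv_into_f_f[OF f that] by (simp add: g_def)
  have "disjoint_family_on (\<lambda>n. A (g n)) (f ` I)"
    using assms(2) gf unfolding disjoint_family_on_def by (metis (no_types, lifting) imageE)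
  moreover have "\<forall>i\<in>f ` I. A (g i) \<in> sets lborel \<and> bounded (A (g i)) \<and> A (g i) \<subseteq> st_region"
    using assms(3) gf by (auto simp: admissible_def)
  moreover have "\<forall>(I::nat set) A. finite I \<longrightarrow> disjoint_family_on A I \<longrightarrow>
        (\<forall>i\<in>I. A i \<in> sets lborel \<and> bounded (A i) \<and> A i \<subseteq> st_region) \<longrightarrow>
        indep_vars (\<lambda>_. count_space UNIV) (\<lambda>i \<omega>. card (P \<omega> \<inter> A i)) I"
    using PPP unfolding poisson_pp_def by (elim conjE)
  ultimately have "indep_vars (\<lambda>_. count_space UNIV) (\<lambda>n \<omega>. card (P \<omega> \<inter> A (g n))) (f ` I)"
    using assms(1) by simp
  then have "indep_vars (\<lambda>_. count_space UNIV) (\<lambda>i \<omega>. card (P \<omega> \<inter> A i)) I"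
    using gf by (rule indep_vars_reindex)
  then show ?thesis by (rule indep_vars_compose2) simp
qed

lemma prob_occupation_pattern:
  assumes "finite I" "disjoint_family_on A I" "\<And>i. i \<in> I \<Longrightarrow> admissible (A i)" "S \<subseteq> I"
  shows "prob {\<omega>\<in>space M. {i\<in>I. card (P \<omega> \<inter> A i) \<noteq> 0} = S}
      = (\<Prod>i\<in>I. if i \<in> S then 1 - exp (- measure lborel (A i)) else exp (- measure lborel (A i)))"
    (is "prob ?E = ?r")
    and "{\<omega>\<in>space M. {i\<in>I. card (P \<omega> \<inter> A i) \<noteq> 0} = S} \<in> events"
proof -
  have m: "(\<lambda>\<omega>. card (P \<omega> \<inter> A i) \<noteq> 0) -` {i \<in> S} \<inter> space M \<in> events" if "i \<in> I" for i
  proof -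
    have "(\<lambda>\<omega>. card (P \<omega> \<inter> A i) \<noteq> 0) -` {i \<in> S} \<inter> space M
        = (\<lambda>\<omega>. card (P \<omega> \<inter> A i)) -` {n. (n \<noteq> 0) = (i \<in> S)} \<inter> space M"
      by (simp only: vimage_def singleton_iff mem_Collect_eq)
    then show ?thesis using measurable_sets[OF measurable_card[OF assms(3)[OF that]], of "{n. (n \<noteq> 0) = (i \<in> S)}"]
      by (simp only: sets_count_space Pow_UNIV UNIV_I simp_thms)
  qed
  have E: "?E = space M \<inter> (\<Inter>i\<in>I. (\<lambda>\<omega>. card (P \<omega> \<inter> A i) \<noteq> 0) -` {i \<in> S} \<inter> space M)"
  proof -
    have *: "{i\<in>I. Q i} = S \<longleftrightarrow> (\<forall>i\<in>I. Q i = (i \<in> S))" for Q using assms(4) by blast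
    show ?thesis unfolding *
      by (simp only: set_eq_iff Int_iff INT_iff vimage_eq singleton_iff mem_Collect_eq) blast
  qed
  define Y where "Y i = (\<lambda>\<omega>. card (P \<omega> \<inter> A i) \<noteq> 0) -` {i \<in> S} \<inter> space M" for i
  have E': "?E = space M \<inter> (\<Inter>i\<in>I. Y i)" unfolding Y_def by (rule E)
  have mY: "Y i \<in> events" if "i \<in> I" for i unfolding Y_def using that by (rule m)
  have sub: "Y i \<subseteq> space M" for i by (auto simp: Y_def)
  show ev: "?E \<in> events"
  proof (cases "I = {}")
    case False
    then show ?thesis unfolding E' by (intro sets.Int sets.top sets.finite_INT assms(1) mY)
  qed (simp add: E')
  show "prob ?E = ?r"
  proof (cases "I = {}")
    case True
    then show ?thesis unfolding E' using prob_space by simp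
  next
    case False
    then have "?E = (\<Inter>i\<in>I. Y i)"
      unfolding E' using sub by blast
    then have "prob ?E = (\<Prod>i\<in>I. prob (Y i))"
      using indep_varsD_finite[OF indep_occupied[OF assms(1-3)] False assms(1), of "\<lambda>i. {i \<in> S}"]
      unfolding Y_def[symmetric] by (simp only: sets_count_space Pow_UNIV UNIV_I simp_thms)
    also have "\<dots> = ?r"
    proof (rule prod.cong[OF refl])
      fix i assume i: "i \<in> I"
      have "Y i = (if i \<in> S then {\<omega>\<in>space M. card (P \<omega> \<inter> A i) \<noteq> 0}
           else space M - {\<omega>\<in>space M. card (P \<omega> \<inter> A i) \<noteq> 0})"
        by (cases "i \<in> S") (auto simp: Y_def)
      then show "prob (Y i) =
          (if i \<in> S then 1 - exp (- measure lborel (A i)) else exp (- measure lborel (A i)))"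
        using prob_occupied[OF assms(3)[OF i]] occupied_sets[OF assms(3)[OF i]] by (simp add: prob_compl)
    qed
    finally show ?thesis .
  qed
qed

text \<open>Every event about occupied cells is a finite disjoint union of occupation patterns. The
  explicit sum involves the cells only through their measures; invariance of the chain law rests on
  this form.\<close>

lemma prob_occupation:
  assumes "finite I" "disjoint_family_on A I" "\<And>i. i \<in> I \<Longrightarrow> admissible (A i)"
  shows "{\<omega>\<in>space M. Q {i\<in>I. card (P \<omega> \<inter> A i) \<noteq> 0}} \<in> events"
    and "prob {\<omega>\<in>space M. Q {i\<in>I. card (P \<omega> \<inter> A i) \<noteq> 0}}
      = (\<Sum>S | S \<subseteq> I \<and> Q S. \<Prod>i\<in>I. if i \<in> S then 1 - exp (- measure lborel (A i)) else exp (- measure lborel (A i)))"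
proof -
  let ?p = "\<lambda>S. {\<omega>\<in>space M. {i\<in>I. card (P \<omega> \<inter> A i) \<noteq> 0} = S}"
  have E: "{\<omega>\<in>space M. Q {i\<in>I. card (P \<omega> \<inter> A i) \<noteq> 0}} = (\<Union>S\<in>{S. S \<subseteq> I \<and> Q S}. ?p S)"
    by auto
  have fin: "finite {S. S \<subseteq> I \<and> Q S}" using assms(1) by simp
  have m: "?p ` {S. S \<subseteq> I \<and> Q S} \<subseteq> events"
    using prob_occupation_pattern(2)[OF assms] by auto
  show "{\<omega>\<in>space M. Q {i\<in>I. card (P \<omega> \<inter> A i) \<noteq> 0}} \<in> events"
    unfolding E using m fin by (intro sets.finite_UN) auto
  have "prob (\<Union>S\<in>{S. S \<subseteq> I \<and> Q S}. ?p S) = (\<Sum>S | S \<subseteq> I \<and> Q S. prob (?p S))"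
    using fin m by (intro finite_measure_finite_Union) (auto simp: disjoint_family_on_def)
  also have "\<dots> = (\<Sum>S | S \<subseteq> I \<and> Q S. \<Prod>i\<in>I. if i \<in> S then 1 - exp (- measure lborel (A i)) else exp (- measure lborel (A i)))"
    by (rule sum.cong[OF refl], rule prob_occupation_pattern(1)[OF assms]) simp_all
  finally show "prob {\<omega>\<in>space M. Q {i\<in>I. card (P \<omega> \<inter> A i) \<noteq> 0}}
      = (\<Sum>S | S \<subseteq> I \<and> Q S. \<Prod>i\<in>I. if i \<in> S then 1 - exp (- measure lborel (A i)) else exp (- measure lborel (A i)))"
    unfolding E .
qed

definition gbox :: "('d option \<Rightarrow> real) \<Rightarrow> ('d option \<Rightarrow> real) \<Rightarrow> bool" where
  "gbox l u \<longleftrightarrow> (\<forall>i. l i < u i) \<and> 0 \<le> l None"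

definition grid_event :: "('d option \<Rightarrow> real) \<Rightarrow> ('d option \<Rightarrow> real) \<Rightarrow> nat \<Rightarrow> nat \<Rightarrow> 'w set" where
  "grid_event l u N k = {\<omega>\<in>space M. has_grid_chain {\<kappa>\<in>cells N. card (P \<omega> \<inter> cell l u N \<kappa>) \<noteq> 0} k}"

text \<open>A measurable version of "the box contains a chain of k points", which itself is not
  known to be measurable; the two agree wherever \<open>P\<close> is locally finite.
  \<open>Suc N\<close> avoids the grid without cells.\<close>

definition chain_event :: "('d option \<Rightarrow> real) \<Rightarrow> ('d option \<Rightarrow> real) \<Rightarrow> nat \<Rightarrow> 'w set" where
  "chain_event l u k = (\<Union>N. grid_event l u (Suc N) k)"

text \<open>The shape and position of the box have disappeared: only the common cell volume enters.
  The limit \<open>chain_prob\<close> is therefore the same for all boxes of equal volume.\<close>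

definition grid_prob :: "nat \<Rightarrow> nat \<Rightarrow> real \<Rightarrow> real" where
  "grid_prob N k v = (\<Sum>S | S \<subseteq> (cells N :: ('d option \<Rightarrow> nat) set) \<and> has_grid_chain S k.
     \<Prod>\<kappa>\<in>cells N. if \<kappa> \<in> S then 1 - exp (- (v / real N ^ (CARD('d) + 1))) else exp (- (v / real N ^ (CARD('d) + 1))))"

definition chain_prob :: "real \<Rightarrow> nat \<Rightarrow> real" where
  "chain_prob v k = lim (\<lambda>N. grid_prob (Suc N) k v)"

lemma admissible_cell: 
  assumes "gbox l u" "\<kappa> \<in> cells N"
  shows "admissible (cell l u N \<kappa>)"
proof -
  have "cell l u N \<kappa> \<subseteq> hbox l u" using cell_subset[of \<kappa> N l u] assms by (simp add: gbox_def)
  also have "\<dots> \<subseteq> st_region"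
    using assms by (auto simp: hbox_def st_region_def gbox_def all_option)
  finally show ?thesis
    by (simp add: admissible_def cell_def bounded_hbox)
qed

lemma measure_cell:
  assumes "gbox l u"
  shows "measure lborel (cell l u N \<kappa>) = vol l u / real N ^ (CARD('d) + 1)"
  unfolding cell_def
proof (subst measure_hbox)
  fix i
  show "l i + (u i - l i) * real (\<kappa> i) / real N \<le> l i + (u i - l i) * (real (\<kappa> i) + 1) / real N"
    using assms by (intro add_left_mono divide_right_mono mult_left_mono) (auto simp: gbox_def less_imp_le)
qed (rule vol_cell)

lemma disjoint_cells: "gbox l u \<Longrightarrow> N > 0 \<Longrightarrow> disjoint_family_on (cell l u N) I"
  unfolding disjoint_family_on_def gbox_def using cell_disjoint by blast

lemma grid_event_sets: "gbox l u \<Longrightarrow> N > 0 \<Longrightarrow> grid_event l u N k \<in> events"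
  unfolding grid_event_def
  by (rule prob_occupation(1)) (auto intro: disjoint_cells admissible_cell)

lemma prob_grid_event: "gbox l u \<Longrightarrow> N > 0 \<Longrightarrow> prob (grid_event l u N k) = grid_prob N k (vol l u)"
  using prob_occupation(2)[OF finite_cells disjoint_cells[of l u N] admissible_cell[of l u _ N],
      of N "\<lambda>S. has_grid_chain S k"]
  by (simp only: grid_event_def grid_prob_def measure_cell)

lemma chain_event_sets [measurable]: "gbox l u \<Longrightarrow> chain_event l u k \<in> events"
  unfolding chain_event_def using grid_event_sets by blast

text \<open>Local finiteness matters here because \<open>card\<close> of an infinite set is 0, so a
  nonzero count would not detect infinitely many points.\<close>

lemma grid_event_iff:
  assumes "\<forall>A. bounded A \<longrightarrow> finite (P \<omega> \<inter> A)" "\<omega> \<in> space M"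
  shows "\<omega> \<in> grid_event l u N k \<longleftrightarrow> has_grid_chain {\<kappa>\<in>cells N. P \<omega> \<inter> cell l u N \<kappa> \<noteq> {}} k"
proof -
  have "card (P \<omega> \<inter> cell l u N \<kappa>) \<noteq> 0 \<longleftrightarrow> P \<omega> \<inter> cell l u N \<kappa> \<noteq> {}" for \<kappa>
    using assms(1) bounded_hbox[of "\<lambda>i. l i + (u i - l i) * real (\<kappa> i) / real N"] by (simp add: cell_def card_gt_0_iff)
  then show ?thesis using assms(2) by (simp add: grid_event_def)
qed

lemma chain_event_iff:
  assumes "gbox l u" "\<forall>A. bounded A \<longrightarrow> finite (P \<omega> \<inter> A)" "\<omega> \<in> space M"
  shows "\<omega> \<in> chain_event l u k \<longleftrightarrow> has_chain (P \<omega> \<inter> hbox l u) k"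
proof
  assume "\<omega> \<in> chain_event l u k"
  then obtain N where "\<omega> \<in> grid_event l u (Suc N) k" by (auto simp: chain_event_def)
  then show "has_chain (P \<omega> \<inter> hbox l u) k"
    using grid_event_iff[OF assms(2,3)] has_chain_if_grid[of "Suc N" "P \<omega>" l u k] assms(1) by (auto simp: gbox_def)
next
  assume "has_chain (P \<omega> \<inter> hbox l u) k"
  then have "\<forall>\<^sub>F N in sequentially. \<omega> \<in> grid_event l u N k"
    using eventually_grid_if_has_chain[of "P \<omega>" l u k] assms(1) grid_event_iff[OF assms(2,3)] by (simp add: gbox_def)
  then obtain N where "\<omega> \<in> grid_event l u (Suc N) k"
    unfolding eventually_sequentially by (meson le_SucI order_refl)
  then show "\<omega> \<in> chain_event l u k" by (auto simp: chain_event_def)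
qed

lemma AE_chain_event:
  assumes "gbox l u"
  shows "AE \<omega> in M. \<omega> \<in> chain_event l u k \<longleftrightarrow> has_chain (P \<omega> \<inter> hbox l u) k"
  using AE_locally_finite AE_space by eventually_elim (use chain_event_iff assms in blast)

text \<open>The grid events need not increase with N, but for a given outcome they stabilise: a
  chain is seen by all sufficiently fine grids, and without a chain no grid shows one.\<close>

lemma AE_grid_event:
  assumes "gbox l u"
  shows "AE \<omega> in M. \<forall>\<^sub>F N in sequentially. \<omega> \<in> grid_event l u (Suc N) k \<longleftrightarrow> \<omega> \<in> chain_event l u k"
  using AE_locally_finite AE_space
proof eventually_elim
  case (elim \<omega>)
  show ?case
  proof (cases "\<omega> \<in> chain_event l u k")
    case True
    then have "has_chain (P \<omega> \<inter> hbox l u) k" using chain_event_iff assms elim by blast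
    then have "\<forall>\<^sub>F N in sequentially. \<omega> \<in> grid_event l u N k"
      using eventually_grid_if_has_chain[of "P \<omega>" l u k] assms grid_event_iff[OF elim] by (simp add: gbox_def)
    then have "\<forall>\<^sub>F N in sequentially. \<omega> \<in> grid_event l u (Suc N) k"
      by (subst eventually_sequentially_Suc)
    then show ?thesis using True by simp
  next
    case False
    then show ?thesis by (auto simp: chain_event_def)
  qed
qed

lemma grid_prob_tendsto:
  assumes "gbox l u"
  shows "(\<lambda>N. grid_prob (Suc N) k (vol l u)) \<longlonglongrightarrow> prob (chain_event l u k)"
proof -
  have "(\<lambda>N. prob (grid_event l u (Suc N) k)) \<longlonglongrightarrow> prob (chain_event l u k)"
    by (intro prob_tendsto_of_AE grid_event_sets chain_event_sets AE_grid_event assms zero_less_Suc)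
  then show ?thesis by (simp only: prob_grid_event[OF assms zero_less_Suc])
qed

lemma prob_chain_event:
  assumes "gbox l u"
  shows "prob (chain_event l u k) = chain_prob (vol l u) k"
  unfolding chain_prob_def using grid_prob_tendsto[OF assms, of k] by (simp add: limI)

text \<open>For a common mesh the cells of all boxes form one disjoint family, so grouping their
  occupation variables by box gives independent groups and a product formula. Refining the mesh
  preserves it.\<close>

lemma indep_chain_events:
  assumes "finite J" and g: "\<And>j. j \<in> J \<Longrightarrow> gbox (l j) (u j)"
    and disj: "disjoint_family_on (\<lambda>j. hbox (l j) (u j)) J"
  shows "prob (space M \<inter> (\<Inter>j\<in>J. - chain_event (l j) (u j) (k j)))
    = (\<Prod>j\<in>J. 1 - chain_prob (vol (l j) (u j)) (k j))"
proof (cases "J = {}")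
  case True
  then show ?thesis by (simp add: prob_space)
next
  case False
  let ?G = "\<lambda>N j. grid_event (l j) (u j) (Suc N) (k j)"
  let ?A = "\<lambda>N (j, \<kappa>). cell (l j) (u j) (Suc N) \<kappa>"
  have eq: "prob (space M \<inter> (\<Inter>j\<in>J. - ?G N j)) = (\<Prod>j\<in>J. 1 - grid_prob (Suc N) (k j) (vol (l j) (u j)))" for N
  proof -
    let ?I = "J \<times> (cells (Suc N) :: ('d option \<Rightarrow> nat) set)"
    let ?X = "\<lambda>i \<omega>. card (P \<omega> \<inter> ?A N i) \<noteq> 0"
    let ?K = "\<lambda>j. {j} \<times> (cells (Suc N) :: ('d option \<Rightarrow> nat) set)"
    have dis: "disjoint_family_on (?A N) ?I"
      unfolding disjoint_family_on_def
    proof (intro ballI impI)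
      fix m n assume mn: "m \<in> ?I" "n \<in> ?I" "m \<noteq> n"
      obtain j \<kappa> j' \<kappa>' where [simp]: "m = (j, \<kappa>)" "n = (j', \<kappa>')" by (cases m; cases n)
      show "?A N m \<inter> ?A N n = {}"
      proof (cases "j = j'")
        case True
        then show ?thesis using mn cell_disjoint[of \<kappa> \<kappa>' "l j" "u j" "Suc N"] g[of j] by (simp add: gbox_def)
      next
        case False
        then have d: "hbox (l j) (u j) \<inter> hbox (l j') (u j') = {}"
          using disj mn by (auto simp: disjoint_family_on_def)
        have "cell (l j) (u j) (Suc N) \<kappa> \<subseteq> hbox (l j) (u j)" "cell (l j') (u j') (Suc N) \<kappa>' \<subseteq> hbox (l j') (u j')"
          using mn g[of j] g[of j'] by (intro cell_subset; simp add: gbox_def)+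
        then show ?thesis using d by auto
      qed
    qed
    have ind: "indep_vars (\<lambda>_. count_space UNIV) ?X ?I"
      by (rule indep_occupied[OF _ dis]) (use assms(1) g admissible_cell in auto)
    \<comment> \<open>Each group records the whole occupation pattern of one box, of which the grid
      event is a function.\<close>
    have ind2: "indep_vars (\<lambda>j. PiM (?K j) (\<lambda>_. count_space UNIV)) (\<lambda>j \<omega>. restrict (\<lambda>i. ?X i \<omega>) (?K j)) J"
      by (rule indep_vars_restrict[OF ind]) (auto simp: disjoint_family_on_def)
    let ?S = "\<lambda>j. {f \<in> PiE (?K j) (\<lambda>_. UNIV :: bool set). \<not> has_grid_chain {\<kappa>\<in>cells (Suc N). f (j, \<kappa>)} (k j)}"
    have S: "?S j \<in> sets (PiM (?K j) (\<lambda>_. count_space UNIV))" for j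
      by (subst count_space_PiM_finite) auto
    have v: "(\<lambda>\<omega>. restrict (\<lambda>i. ?X i \<omega>) (?K j)) -` ?S j \<inter> space M = space M - ?G N j" for j
      by (auto simp: grid_event_def cong: conj_cong)
    have "prob (\<Inter>j\<in>J. space M - ?G N j) = (\<Prod>j\<in>J. prob (space M - ?G N j))"
      using indep_varsD_finite[OF ind2 False assms(1), of ?S] S unfolding v by simp
    moreover have "(\<Inter>j\<in>J. space M - ?G N j) = space M \<inter> (\<Inter>j\<in>J. - ?G N j)" using False by auto
    moreover have "prob (space M - ?G N j) = 1 - grid_prob (Suc N) (k j) (vol (l j) (u j))" if "j \<in> J" for j
      using prob_compl[OF grid_event_sets[of "l j" "u j"]] prob_grid_event[of "l j" "u j"] g[OF that] by simp
    ultimately show ?thesis by (simp cong: prod.cong)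
  qed
  have "(\<lambda>N. prob (space M \<inter> (\<Inter>j\<in>J. - ?G N j))) \<longlonglongrightarrow> prob (space M \<inter> (\<Inter>j\<in>J. - chain_event (l j) (u j) (k j)))"
  proof (rule prob_tendsto_of_AE)
    have *: "space M \<inter> (\<Inter>j\<in>J. - B j) = (\<Inter>j\<in>J. space M - B j)" for B using False by auto
    show "space M \<inter> (\<Inter>j\<in>J. - ?G N j) \<in> events" for N
      unfolding * using False assms(1) g grid_event_sets by (intro sets.finite_INT sets.compl_sets) auto
    show "space M \<inter> (\<Inter>j\<in>J. - chain_event (l j) (u j) (k j)) \<in> events"
      unfolding * using False assms(1) g chain_event_sets by (intro sets.finite_INT sets.compl_sets) auto
    have "AE \<omega> in M. \<forall>j\<in>J. \<forall>\<^sub>F N in sequentially. \<omega> \<in> ?G N j \<longleftrightarrow> \<omega> \<in> chain_event (l j) (u j) (k j)"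
      using assms(1) by (intro AE_finite_allI AE_grid_event g)
    then show "AE \<omega> in M. \<forall>\<^sub>F N in sequentially. \<omega> \<in> space M \<inter> (\<Inter>j\<in>J. - ?G N j) \<longleftrightarrow>
        \<omega> \<in> space M \<inter> (\<Inter>j\<in>J. - chain_event (l j) (u j) (k j))"
    proof eventually_elim
      case (elim \<omega>)
      then have "\<forall>\<^sub>F N in sequentially. \<forall>j\<in>J. \<omega> \<in> ?G N j \<longleftrightarrow> \<omega> \<in> chain_event (l j) (u j) (k j)"
        using assms(1) by (intro eventually_ball_finite)
      then show ?case by eventually_elim auto
    qed
  qed
  moreover have "(\<lambda>N. \<Prod>j\<in>J. 1 - grid_prob (Suc N) (k j) (vol (l j) (u j))) \<longlonglongrightarrow> (\<Prod>j\<in>J. 1 - chain_prob (vol (l j) (u j)) (k j))"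
    using grid_prob_tendsto[OF g] prob_chain_event[OF g] by (intro tendsto_prod tendsto_diff tendsto_const) auto
  ultimately show ?thesis unfolding eq by (rule LIMSEQ_unique)
qed

text \<open>A union bound over grid chains. There are at most \<open>(N choose k) ^ (d + 1)\<close>
  of them, each fully occupied with probability at most the k-th power of the cell volume. By
  \<open>(N choose k) \<le> N ^ k / k!\<close> all powers of N cancel, so the bound survives
  refinement.\<close>

lemma chain_prob_le_fact:
  assumes g: "gbox l u"
  shows "chain_prob (vol l u) k \<le> vol l u ^ k / fact k ^ (CARD('d) + 1)"
proof -
  let ?d = "CARD('d) + 1"
  let ?v = "vol l u"
  have v: "0 \<le> ?v" using g by (auto simp: vol_def gbox_def less_imp_le intro!: prod_nonneg)
  have "grid_prob N k ?v \<le> ?v ^ k / fact k ^ ?d" if N: "N > 0" for N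
  proof -
    let ?G = "{D. D \<subseteq> (cells N :: ('d option \<Rightarrow> nat) set) \<and> grid_chain D \<and> card D = k}"
    let ?E = "\<lambda>D. {\<omega>\<in>space M. {\<kappa>\<in>D. card (P \<omega> \<inter> cell l u N \<kappa>) \<noteq> 0} = D}"
    have finD: "finite D" if "D \<in> ?G" for D using that finite_subset[OF _ finite_cells] by blast
    have E: "?E D \<in> events" "prob (?E D) \<le> (?v / real N ^ ?d) ^ k" if D: "D \<in> ?G" for D
    proof -
      have a: "finite D" "disjoint_family_on (cell l u N) D" "\<And>\<kappa>. \<kappa> \<in> D \<Longrightarrow> admissible (cell l u N \<kappa>)"
        using finD[OF D] disjoint_cells[OF g N] apply simp_all
        using D admissible_cell[OF g] by blast
      show "?E D \<in> events" using prob_occupation_pattern(2)[OF a] by blast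
      have "prob (?E D) = (1 - exp (- (?v / real N ^ ?d))) ^ k"
        using prob_occupation_pattern(1)[OF a] D by (simp add: measure_cell[OF g])
      also have "\<dots> \<le> (?v / real N ^ ?d) ^ k"
        using exp_ge_add_one_self[of "- (?v / real N ^ ?d)"] v by (intro power_mono) (auto simp del: exp_ge_add_one_self)
      finally show "prob (?E D) \<le> (?v / real N ^ ?d) ^ k" .
    qed
    have "grid_event l u N k \<subseteq> (\<Union>D\<in>?G. ?E D)"
      by (auto simp: grid_event_def has_grid_chain_def)
    then have "prob (grid_event l u N k) \<le> prob (\<Union>D\<in>?G. ?E D)"
      using E by (intro finite_measure_mono sets.finite_UN) auto
    also have "\<dots> \<le> (\<Sum>D\<in>?G. prob (?E D))"
      using E by (intro finite_measure_subadditive_finite) auto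
    also have "\<dots> \<le> (\<Sum>D\<in>?G. (?v / real N ^ ?d) ^ k)"
      using E by (intro sum_mono) auto
    also have "\<dots> = real (card ?G) * (?v / real N ^ ?d) ^ k" by simp
    also have "\<dots> \<le> real ((N choose k) ^ ?d) * (?v / real N ^ ?d) ^ k"
      using card_grid_chains[where 'd = 'd, of N k] v by (intro mult_right_mono) (simp_all only: of_nat_le_iff, auto)
    also have "\<dots> \<le> (real N ^ k / fact k) ^ ?d * (?v / real N ^ ?d) ^ k"
    proof (intro mult_right_mono)
      have "real ((N choose k) * fact k) \<le> real (N ^ k)"
        using binomial_fact_pow[of N k] of_nat_le_iff by blast
      then have "real (N choose k) \<le> real N ^ k / fact k" by (simp add: field_simps)
      then show "real ((N choose k) ^ ?d) \<le> (real N ^ k / fact k) ^ ?d"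
        unfolding of_nat_power by (intro power_mono) auto
    qed (use v in auto)
    also have "\<dots> = ?v ^ k / fact k ^ ?d"
    proof -
      have "(real N ^ k) ^ ?d = (real N ^ ?d) ^ k" by (simp only: power_mult[symmetric] mult.commute)
      moreover have "(real N ^ ?d) ^ k \<noteq> 0" using N by simp
      moreover have "a / b * (c / a) = c / b" if "a \<noteq> 0" for a b c :: real using that by simp
      ultimately show ?thesis by (simp only: power_divide)
    qed
    finally show ?thesis using prob_grid_event[OF g N] by simp
  qed
  then show ?thesis
    using grid_prob_tendsto[OF g, of k] prob_chain_event[OF g, of k] by (intro LIMSEQ_le_const2[of "\<lambda>N. grid_prob (Suc N) k ?v"]) auto
qed

end

text \<open>A single term of the exponential series is below its sum; with x = k this is the
  Stirling-type bound \<open>k ^ k / k! \<le> exp k\<close>.\<close>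

lemma power_div_fact_le_exp: "0 \<le> x \<Longrightarrow> x ^ k / fact k \<le> exp (x::real)"
proof -
  assume x: "0 \<le> x"
  obtain s where s: "exp x = (\<Sum>m<Suc k. x ^ m / fact m) + exp s / fact (Suc k) * x ^ Suc k"
    using Maclaurin_exp_le[of x "Suc k"] by blast
  have "x ^ k / fact k \<le> (\<Sum>m<Suc k. x ^ m / fact m)"
    using x by (intro member_le_sum[of k "{..<Suc k}" "\<lambda>m. x ^ m / fact m"]) auto
  also have "\<dots> \<le> exp x" unfolding s using x by simp
  finally show ?thesis .
qed

lemma vol_cube: "vol (\<lambda>_ :: 'd::finite option. a) (\<lambda>_. b) = (b - a) ^ (CARD('d) + 1)"
  by (simp add: vol_def card_UNIV_option)

lemma has_chain_hbox_mono:
  assumes "has_chain (S \<inter> hbox l u) k" "\<And>i. l' i \<le> l i" "\<And>i. u i \<le> u' i" "k' \<le> k"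
  shows "has_chain (S \<inter> hbox l' u') k'"
  using assms(1) by (rule has_chain_mono) (use hbox_mono[of l' l u u'] assms(2-4) in blast)+

lemma real_ge_nat_ceiling_le: "x \<le> real k \<Longrightarrow> nat \<lceil>x\<rceil> \<le> k"
  by linarith

context poisson
begin

text \<open>The events themselves need not be nested, since the grids of the two boxes differ; the
  inclusion holds almost surely through \<open>has_chain\<close>.\<close>

lemma prob_chain_event_mono:
  assumes "gbox l u" "gbox l' u'" "hbox l u \<subseteq> hbox l' u'" "k' \<le> k"
  shows "prob (chain_event l u k) \<le> prob (chain_event l' u' k')"
proof (rule finite_measure_mono_AE)
  show "AE \<omega> in M. \<omega> \<in> chain_event l u k \<longrightarrow> \<omega> \<in> chain_event l' u' k'"
    using AE_chain_event[OF assms(1), of k] AE_chain_event[OF assms(2), of k']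
    by eventually_elim (use has_chain_mono assms(3,4) in blast)
qed (use assms in \<open>simp add: chain_event_sets\<close>)

lemma gbox_cube: "0 \<le> a \<Longrightarrow> a < b \<Longrightarrow> gbox (\<lambda>_. a) (\<lambda>_. b)"
  by (simp add: gbox_def)

lemma chain_prob_cube:
  assumes "0 \<le> a" "a < b"
  shows "prob (chain_event (\<lambda>_. a) (\<lambda>_. b) k) = chain_prob ((b - a) ^ (CARD('d) + 1)) k"
  using prob_chain_event[OF gbox_cube[OF assms]] by (simp only: vol_cube)

lemma chain_prob_mono:
  assumes "0 < s" "s \<le> s'" "k' \<le> k"
  shows "chain_prob (s ^ (CARD('d) + 1)) k \<le> chain_prob (s' ^ (CARD('d) + 1)) k'"
  using prob_chain_event_mono[of "\<lambda>_. 0" "\<lambda>_. s" "\<lambda>_. 0" "\<lambda>_. s'" k' k] assms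
    gbox_cube[of 0 s] gbox_cube[of 0 s'] chain_prob_cube[of 0 s k] chain_prob_cube[of 0 s' k']
    hbox_mono[of "\<lambda>_. 0" "\<lambda>_. 0" "\<lambda>_. s" "\<lambda>_. s'"] by simp

lemma AE_not_has_chain:
  assumes g: "\<And>n. gbox (l n) (u n)" and s: "summable (\<lambda>n. chain_prob (vol (l n) (u n)) (k n))"
  shows "AE \<omega> in M. \<forall>\<^sub>F n in sequentially. \<not> has_chain (P \<omega> \<inter> hbox (l n) (u n)) (k n)"
proof -
  have "AE \<omega> in M. \<forall>\<^sub>F n in sequentially. \<omega> \<in> space M - chain_event (l n) (u n) (k n)"
    using s by (intro borel_cantelli_AE1 chain_event_sets g) (auto simp: prob_chain_event[OF g] less_top[symmetric])
  moreover have "AE \<omega> in M. \<forall>n. \<omega> \<in> chain_event (l n) (u n) (k n) \<longleftrightarrow> has_chain (P \<omega> \<inter> hbox (l n) (u n)) (k n)"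
    unfolding AE_all_countable using AE_chain_event[OF g] by blast
  ultimately show ?thesis by eventually_elim (auto elim: eventually_mono)
qed

lemma AE_has_chain:
  assumes g: "\<And>n. gbox (l n) (u n)" and s: "summable (\<lambda>n. 1 - chain_prob (vol (l n) (u n)) (k n))"
  shows "AE \<omega> in M. \<forall>\<^sub>F n in sequentially. has_chain (P \<omega> \<inter> hbox (l n) (u n)) (k n)"
proof -
  have "AE \<omega> in M. \<forall>\<^sub>F n in sequentially. \<omega> \<in> space M - (space M - chain_event (l n) (u n) (k n))"
    using s by (intro borel_cantelli_AE1 sets.compl_sets chain_event_sets g)
      (auto simp: prob_compl chain_event_sets[OF g] prob_chain_event[OF g] less_top[symmetric])
  moreover have "AE \<omega> in M. \<forall>n. \<omega> \<in> chain_event (l n) (u n) (k n) \<longleftrightarrow> has_chain (P \<omega> \<inter> hbox (l n) (u n)) (k n)"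
    unfolding AE_all_countable using AE_chain_event[OF g] by blast
  ultimately show ?thesis by eventually_elim (auto elim: eventually_mono)
qed

text \<open>A quantitative second Borel--Cantelli argument. The event \<open>A m\<close> that
  nothing happens from m on has probability tending to 1, so some m gives more than 1/2. By
  independence the products of 1 - p j from there on stay above 1/2, and 1 - p \<le> exp (- p) keeps
  all partial sums below ln 2.\<close>

lemma summable_chain_prob:
  assumes g: "\<And>n. gbox (l n) (u n)" and d: "disjoint_family (\<lambda>n. hbox (l n) (u n))"
    and ae: "AE \<omega> in M. \<forall>\<^sub>F n in sequentially. \<not> has_chain (P \<omega> \<inter> hbox (l n) (u n)) (k n)"
  shows "summable (\<lambda>n. chain_prob (vol (l n) (u n)) (k n))"
proof -
  define E where "E n = chain_event (l n) (u n) (k n)" for n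
  define p where "p n = chain_prob (vol (l n) (u n)) (k n)" for n
  have E[measurable]: "E n \<in> events" for n unfolding E_def by (intro chain_event_sets g)
  have p: "prob (E n) = p n" for n unfolding E_def p_def by (rule prob_chain_event[OF g])
  have p01: "0 \<le> p n" "p n \<le> 1" for n unfolding p[symmetric] by auto
  have "AE \<omega> in M. \<forall>n. \<omega> \<in> E n \<longleftrightarrow> has_chain (P \<omega> \<inter> hbox (l n) (u n)) (k n)"
    unfolding AE_all_countable E_def using AE_chain_event[OF g] by blast
  with ae have ae': "AE \<omega> in M. \<forall>\<^sub>F n in sequentially. \<omega> \<notin> E n"
    by eventually_elim simp
  define A where "A m = space M - (\<Union>n\<in>{m..}. E n)" for m
  have A: "A m \<in> events" for m unfolding A_def by measurable
  have "(\<lambda>m. prob (A m)) \<longlonglongrightarrow> prob (space M)"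
  proof (rule prob_tendsto_of_AE[OF A])
    show "AE \<omega> in M. \<forall>\<^sub>F m in sequentially. \<omega> \<in> A m \<longleftrightarrow> \<omega> \<in> space M"
      using ae' AE_space
    proof eventually_elim
      case (elim \<omega>)
      then obtain N where N: "\<And>n. n \<ge> N \<Longrightarrow> \<omega> \<notin> E n" by (auto simp: eventually_sequentially)
      show ?case using eventually_ge_at_top[of N]
        by eventually_elim (use N elim in \<open>auto simp: A_def\<close>)
    qed
  qed simp
  then have "\<forall>\<^sub>F m in sequentially. 1/2 < prob (A m)"
    by (intro order_tendstoD) (auto simp: prob_space)
  then obtain m where m: "1/2 < prob (A m)" by (auto simp: eventually_sequentially)
  have bound: "(\<Sum>i<n. p (i + m)) \<le> ln 2" for n
  proof -
    have "A m \<subseteq> space M \<inter> (\<Inter>j\<in>{m..<m+n}. - E j)" by (auto simp: A_def)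
    moreover have "space M \<inter> (\<Inter>j\<in>{m..<m+n}. - E j) = space M - (\<Union>j\<in>{m..<m+n}. E j)" by auto
    moreover have "space M - (\<Union>j\<in>{m..<m+n}. E j) \<in> events" by measurable
    ultimately have "prob (A m) \<le> prob (space M \<inter> (\<Inter>j\<in>{m..<m+n}. - E j))"
      by (intro finite_measure_mono) simp_all
    also have "\<dots> = (\<Prod>j\<in>{m..<m+n}. 1 - p j)"
      unfolding E_def p_def
      by (rule indep_chain_events) (use g d in \<open>auto simp: disjoint_family_on_def\<close>)
    also have "\<dots> \<le> (\<Prod>j\<in>{m..<m+n}. exp (- p j))"
    proof (intro prod_mono conjI)
      fix j show "1 - p j \<le> exp (- p j)" using exp_ge_add_one_self[of "- p j"] by simp
    qed (use p01 in auto)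
    also have "\<dots> = exp (- (\<Sum>j\<in>{m..<m+n}. p j))"
      by (simp add: exp_sum[symmetric] sum_negf)
    also have "(\<Sum>j\<in>{m..<m+n}. p j) = (\<Sum>i<n. p (i + m))"
      using sum.shift_bounds_nat_ivl[of p 0 m n] by (simp add: lessThan_atLeast0 add.commute)
    finally have "1/2 < exp (- (\<Sum>i<n. p (i + m)))" using m by linarith
    then have "ln (1/2) < ln (exp (- (\<Sum>i<n. p (i + m))))" by (subst ln_less_cancel_iff) simp_all
    then show ?thesis by (simp add: ln_div)
  qed
  have "summable (\<lambda>i. p (i + m))"
    by (rule summableI_nonneg_bounded[of _ "ln 2"]) (use p01 bound in auto)
  then have "summable p" by (simp add: summable_iff_shift)
  then show ?thesis by (simp add: p_def[abs_def])
qed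

end

section \<open>Law of large numbers for chains\<close>

lemma corner_cube: "corner 0 0 = (\<lambda>_. 0)" "corner (r *\<^sub>R 1) r = (\<lambda>_. r)"
  by (auto simp: corner_def fun_eq_iff split: option.splits)

lemma limit_const_nonneg:
  assumes "(\<lambda>n. ereal (1 / real n) * Hlp S 0 (real n *\<^sub>R 1) (real n)) \<longlonglongrightarrow> ereal c"
  shows "0 \<le> c"
proof -
  have "0 \<le> ereal c"
    using assms by (rule LIMSEQ_le_const) (auto intro!: exI[of _ 0] ereal_0_le_mult Hlp_nonneg)
  then show ?thesis by simp
qed

lemma ereal_scaled_less:
  assumes "n > 0"
  shows "ereal (1 / real n) * H < ereal b \<longleftrightarrow> H < ereal (b * real n)"
    "ereal b < ereal (1 / real n) * H \<longleftrightarrow> ereal (b * real n) < H"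
  using assms by (cases H; simp add: field_simps)+

text \<open>The given limit runs over integer sides. A real side r is rounded down for long chains
  and up for their absence; one half of \<open>\<epsilon>\<close> is the error of the limit and the
  other pays for the rounding.\<close>

lemma cube_chain_asymptotics:
  assumes lim: "(\<lambda>n. ereal (1 / real n) * Hlp S 0 (real n *\<^sub>R 1) (real n)) \<longlonglongrightarrow> ereal c"
    and e: "\<epsilon> > 0"
  shows "\<forall>\<^sub>F r in at_top. \<forall>k. (real k \<le> (c - \<epsilon>) * r \<longrightarrow> has_chain (S \<inter> hbox (\<lambda>_. 0) (\<lambda>_. r)) k) \<and>
      ((c + \<epsilon>) * r \<le> real k \<longrightarrow> \<not> has_chain (S \<inter> hbox (\<lambda>_. 0) (\<lambda>_. r)) k)"
proof -
  have c: "0 \<le> c" using limit_const_nonneg[OF lim] .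
  have "\<forall>\<^sub>F n in sequentially. ereal (c - \<epsilon>/2) < ereal (1 / real n) * Hlp S 0 (real n *\<^sub>R 1) (real n)"
    "\<forall>\<^sub>F n in sequentially. ereal (1 / real n) * Hlp S 0 (real n *\<^sub>R 1) (real n) < ereal (c + \<epsilon>/2)"
    using lim e by (auto intro: order_tendstoD)
  then have "\<forall>\<^sub>F n in sequentially. ereal ((c - \<epsilon>/2) * real n) < Hlp S 0 (real n *\<^sub>R 1) (real n)
      \<and> Hlp S 0 (real n *\<^sub>R 1) (real n) < ereal ((c + \<epsilon>/2) * real n)"
    using eventually_gt_at_top[of 0] by eventually_elim (simp add: ereal_scaled_less)
  then obtain N where N: "\<And>n. n \<ge> N \<Longrightarrow> ereal ((c - \<epsilon>/2) * real n) < Hlp S 0 (real n *\<^sub>R 1) (real n)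
      \<and> Hlp S 0 (real n *\<^sub>R 1) (real n) < ereal ((c + \<epsilon>/2) * real n)"
    by (auto simp: eventually_sequentially)
  show ?thesis
    using eventually_ge_at_top[of "real N + 1"] eventually_ge_at_top[of "2 * (c + \<epsilon>) / \<epsilon>"]
  proof eventually_elim
    case (elim r)
    \<comment> \<open>The threshold on r makes the spare half exceed the effect of changing the side
      by at most 1.\<close>
    have r: "\<epsilon>/2 * r \<ge> c + \<epsilon>" using elim(2) e by (simp add: field_simps)
    show ?case
    proof (intro allI conjI impI)
      fix k assume k: "real k \<le> (c - \<epsilon>) * r"
      show "has_chain (S \<inter> hbox (\<lambda>_. 0) (\<lambda>_. r)) k"
      proof (cases "k = 0")
        case False
        define n where "n = nat \<lfloor>r\<rfloor>"
        have n: "real n \<le> r" "r - 1 \<le> real n" "n \<ge> N" using elim(1) unfolding n_def by linarith+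
        have ce: "c - \<epsilon> > 0"
        proof (rule ccontr)
          assume "\<not> c - \<epsilon> > 0"
          then have "(c - \<epsilon>) * r \<le> 0" using elim(1) by (simp add: mult_nonpos_nonneg)
          then show False using k False by simp
        qed
        have "(c - \<epsilon>/2) * (r - 1) \<le> (c - \<epsilon>/2) * real n" using n ce e by (intro mult_left_mono) auto
        moreover have "(c - \<epsilon>) * r \<le> (c - \<epsilon>/2) * (r - 1)" using r e c by (simp add: field_simps)
        ultimately have "real k \<le> (c - \<epsilon>/2) * real n" using k by linarith
        then have "ereal (real k) \<le> Hlp S 0 (real n *\<^sub>R 1) (real n)" using N[OF n(3)]
          by (meson ereal_less_eq(3) le_less_trans less_imp_le)
        then have "has_chain (S \<inter> hbox (\<lambda>_. 0) (\<lambda>_. real n)) k" by (simp add: Hlp_ge_iff corner_cube)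
        then show ?thesis using n(1) by (elim has_chain_hbox_mono) auto
      qed simp
    next
      fix k assume k: "(c + \<epsilon>) * r \<le> real k"
      define n where "n = nat \<lceil>r\<rceil>"
      have n: "r \<le> real n" "real n \<le> r + 1" "n \<ge> N" using elim(1) unfolding n_def by linarith+
      have "(c + \<epsilon>/2) * real n \<le> (c + \<epsilon>/2) * (r + 1)" using n c e by (intro mult_left_mono) auto
      also have "\<dots> \<le> (c + \<epsilon>) * r" using r e by (simp add: field_simps)
      finally have "(c + \<epsilon>/2) * real n \<le> real k" using k by linarith
      then have "\<not> ereal (real k) \<le> Hlp S 0 (real n *\<^sub>R 1) (real n)" using N[OF n(3)]
        by (meson ereal_less_eq(3) le_less_trans less_imp_le not_le order_less_le_trans)
      then have "\<not> has_chain (S \<inter> hbox (\<lambda>_. 0) (\<lambda>_. real n)) k" by (simp add: Hlp_ge_iff corner_cube)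
      then show "\<not> has_chain (S \<inter> hbox (\<lambda>_. 0) (\<lambda>_. r)) k"
        using has_chain_hbox_mono[of S "\<lambda>_. 0" "\<lambda>_. r" k "\<lambda>_. 0" "\<lambda>_. real n" k] n(1) by auto
    qed
  qed
qed

text \<open>Superadditivity along the diagonal: the two cubes share only a corner, and every point
  of the lower one is strictly below every point of the upper one.\<close>

lemma has_chain_stack:
  assumes "has_chain (S \<inter> hbox (\<lambda>_. a) (\<lambda>_. b)) k" "has_chain (S \<inter> hbox (\<lambda>_. b) (\<lambda>_. d)) m" "a \<le> b" "b \<le> d"
  shows "has_chain (S \<inter> hbox (\<lambda>_. a) (\<lambda>_. d)) (k + m)"
proof -
  have "has_chain ((S \<inter> hbox (\<lambda>_. a) (\<lambda>_. b)) \<union> (S \<inter> hbox (\<lambda>_. b) (\<lambda>_. d))) (k + m)"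
    using assms(1,2) proof (rule has_chain_add)
    show "st_lt p q" if "p \<in> S \<inter> hbox (\<lambda>_. a) (\<lambda>_. b)" "q \<in> S \<inter> hbox (\<lambda>_. b) (\<lambda>_. d)" for p q
      unfolding st_lt_iff_co
    proof
      fix i
      have "co p i \<le> b" "b < co q i" using that by (auto simp: hbox_def)
      then show "co p i < co q i" by (rule le_less_trans)
    qed
  qed
  moreover have "hbox (\<lambda>_. a) (\<lambda>_. b) \<subseteq> hbox (\<lambda>_. a) (\<lambda>_. d)" "hbox (\<lambda>_. b) (\<lambda>_. d) \<subseteq> hbox (\<lambda>_. a) (\<lambda>_. d)"
    using assms(3,4) by (intro hbox_mono; simp)+
  ultimately show ?thesis by (elim has_chain_mono) blast+
qed

lemma has_chain_blocks:
  assumes "m \<ge> 0"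
  shows "has_chain (S \<inter> hbox (\<lambda>_. 0) (\<lambda>_. real N * m))
    (card {i\<in>{..<N}. has_chain (S \<inter> hbox (\<lambda>_. real i * m) (\<lambda>_. real (Suc i) * m)) K} * K)"
proof (induction N)
  case (Suc N)
  let ?Q = "\<lambda>i. has_chain (S \<inter> hbox (\<lambda>_. real i * m) (\<lambda>_. real (Suc i) * m)) K"
  have *: "{i\<in>{..<Suc N}. ?Q i} = (if ?Q N then insert N {i\<in>{..<N}. ?Q i} else {i\<in>{..<N}. ?Q i})"
    by (auto simp: less_Suc_eq)
  show ?case
  proof (cases "?Q N")
    case True
    then have "has_chain (S \<inter> hbox (\<lambda>_. 0) (\<lambda>_. real (Suc N) * m)) (card {i\<in>{..<N}. ?Q i} * K + K)"
      using Suc.IH assms by (intro has_chain_stack[of S 0 "real N * m"]) (auto intro!: mult_right_mono)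
    then show ?thesis unfolding * using True by (simp add: add.commute)
  next
    case False
    then show ?thesis unfolding * using Suc.IH assms
      by (auto elim!: has_chain_hbox_mono intro!: mult_right_mono)
  qed
qed simp

lemma geometric_index:
  fixes \<rho> r :: real
  assumes rho: "\<rho> > 1" and r: "\<rho> ^ J \<le> r"
  obtains j where "j \<ge> J" "\<rho> ^ j \<le> r" "r \<le> \<rho> ^ Suc j"
proof -
  obtain m where m: "r < \<rho> ^ m" using real_arch_pow[OF rho] by blast
  define j where "j = (LEAST m. r < \<rho> ^ m)"
  have j: "r < \<rho> ^ j" unfolding j_def using m by (rule LeastI)
  have "\<rho> ^ J < \<rho> ^ j" using r j by linarith
  then have "J < j" using rho by (metis power_less_imp_less_exp)
  then obtain i where i: "j = Suc i" "J \<le> i" by (cases j) auto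
  have "\<not> r < \<rho> ^ i" using not_less_Least[of i "\<lambda>m. r < \<rho> ^ m"] i by (simp add: j_def)
  then show ?thesis using i j that[of i] by auto
qed

locale poisson_limit = poisson M P for M :: "'w measure" and P :: "'w \<Rightarrow> ((real^'d) \<times> real) set" +
  fixes c :: real
  assumes cube_limit: "AE \<omega> in M. (\<lambda>n. ereal (1 / real n) * Hlp (P \<omega>) 0 (real n *\<^sub>R 1) (real n)) \<longlonglongrightarrow> ereal c"
begin

lemma c_nonneg: "0 \<le> c"
proof -
  have "AE \<omega> in M. 0 \<le> c" using cube_limit by eventually_elim (rule limit_const_nonneg)
  then show ?thesis by simp
qed

lemma AE_cube_asymptotics:
  assumes "\<epsilon> > 0"
  shows "AE \<omega> in M. \<forall>\<^sub>F r in at_top. \<forall>k. (real k \<le> (c - \<epsilon>) * r \<longrightarrow> has_chain (P \<omega> \<inter> hbox (\<lambda>_. 0) (\<lambda>_. r)) k) \<and>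
      ((c + \<epsilon>) * r \<le> real k \<longrightarrow> \<not> has_chain (P \<omega> \<inter> hbox (\<lambda>_. 0) (\<lambda>_. r)) k)"
  using cube_limit by eventually_elim (rule cube_chain_asymptotics[OF _ assms])

text \<open>The cubes stacked along the diagonal are disjoint, and by superadditivity the limit along the
  diagonal bounds the chains in almost all of them. Hence the second Borel--Cantelli lemma turns the
  almost sure limit into a summable upper tail.\<close>

lemma summable_upper_tail:
  assumes a: "a > 0" and rho: "\<rho> > 1" and e: "\<epsilon> > 0"
  shows "summable (\<lambda>j. chain_prob ((a * \<rho> ^ j) ^ (CARD('d) + 1)) (nat \<lceil>(c + \<epsilon>) * (a * \<rho> ^ j)\<rceil>))"
proof -
  \<comment> \<open>The sum a (1 + \<rho> + ... + \<rho> ^ (j - 1)), so the cube from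
    \<open>s j\<close> to \<open>s (Suc j)\<close> has side a \<rho> ^ j.\<close>
  define s where "s j = a * (\<rho> ^ j - 1) / (\<rho> - 1)" for j :: nat
  have sdiff: "s (Suc j) - s j = a * \<rho> ^ j" for j
    using rho by (simp add: s_def diff_divide_distrib[symmetric] field_simps)
  have s_less: "s j < s (Suc j)" for j using sdiff[of j] a rho by (smt (verit) mult_pos_pos zero_less_power)
  have s_nn: "0 \<le> s j" for j using a rho by (simp add: s_def)
  have s_mono: "i \<le> j \<Longrightarrow> s i \<le> s j" for i j by (rule lift_Suc_mono_le) (use s_less less_imp_le in auto)
  have pinf: "filterlim (\<lambda>j. \<rho> ^ j) at_top sequentially"
    unfolding filterlim_at_top
  proof (intro allI)
    fix Z :: real
    obtain N where "Z < \<rho> ^ N" using real_arch_pow[OF rho] by blast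
    then have "Z \<le> \<rho> ^ j" if "j \<ge> N" for j
      using power_increasing[OF that, of \<rho>] rho by linarith
    then show "\<forall>\<^sub>F j in sequentially. Z \<le> \<rho> ^ j" by (auto simp: eventually_sequentially)
  qed
  have s_inf: "filterlim s at_top sequentially"
  proof -
    have "filterlim (\<lambda>j. (a / (\<rho> - 1)) * (\<rho> ^ j - 1)) at_top sequentially"
      using a rho filterlim_tendsto_pos_mult_at_top[OF tendsto_const[of "a/(\<rho>-1)"]]
        filterlim_tendsto_add_at_top[OF tendsto_const[of "-1"] pinf] by auto
    then show ?thesis by (simp add: s_def[abs_def])
  qed
  \<comment> \<open>The distance \<open>s (Suc j)\<close> is at most \<rho> / (\<rho> - 1) times the
    side of cube j. With this \<open>\<epsilon>'\<close> the errors of the limit at both ends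
    together cost at most half of \<open>\<epsilon>\<close> times the side.\<close>
  define \<epsilon>' where "\<epsilon>' = \<epsilon> * (\<rho> - 1) / (4 * \<rho>)"
  have e': "\<epsilon>' > 0" using e rho by (simp add: \<epsilon>'_def)
  have small: "\<epsilon>' * (s (Suc j) + s j) \<le> \<epsilon> * (a * \<rho> ^ j) / 2" for j
  proof -
    have "s (Suc j) + s j \<le> 2 * s (Suc j)" using s_less[of j] by simp
    also have "\<dots> \<le> 2 * (a * \<rho> ^ Suc j / (\<rho> - 1))"
      unfolding s_def using a rho by (intro mult_left_mono divide_right_mono) auto
    finally have "\<epsilon>' * (s (Suc j) + s j) \<le> \<epsilon>' * (2 * (a * \<rho> ^ Suc j / (\<rho> - 1)))"
      using e' by (intro mult_left_mono) auto
    also have "\<dots> = \<epsilon> * (a * \<rho> ^ j) / 2" using rho by (simp add: \<epsilon>'_def field_simps)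
    finally show ?thesis .
  qed
  let ?k = "\<lambda>j. nat \<lceil>(c + \<epsilon>) * (a * \<rho> ^ j)\<rceil>"
  have "summable (\<lambda>j. chain_prob (vol (\<lambda>_ :: 'd option. s j) (\<lambda>_. s (Suc j))) (?k j))"
  proof (rule summable_chain_prob)
    show "gbox (\<lambda>_. s j) (\<lambda>_. s (Suc j))" for j using gbox_cube s_nn s_less by blast
    show "disjoint_family (\<lambda>j. hbox (\<lambda>_ :: 'd option. s j) (\<lambda>_. s (Suc j)))"
      unfolding disjoint_family_on_def
    proof (intro ballI impI)
      fix i j :: nat assume "i \<noteq> j"
      have "hbox (\<lambda>_ :: 'd option. s i) (\<lambda>_. s (Suc i)) \<inter> hbox (\<lambda>_. s j) (\<lambda>_. s (Suc j)) = {}" if "i < j" for i j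
      proof -
        have "s (Suc i) \<le> s j" using s_mono[of "Suc i" j] that by simp
        then have "\<not> (s j < x \<and> x \<le> s (Suc i))" for x by linarith
        then show ?thesis unfolding hbox_def by blast
      qed
      then show "hbox (\<lambda>_ :: 'd option. s i) (\<lambda>_. s (Suc i)) \<inter> hbox (\<lambda>_. s j) (\<lambda>_. s (Suc j)) = {}"
        using \<open>i \<noteq> j\<close> by (metis Int_commute nat_neq_iff)
    qed
    show "AE \<omega> in M. \<forall>\<^sub>F j in sequentially. \<not> has_chain (P \<omega> \<inter> hbox (\<lambda>_. s j) (\<lambda>_. s (Suc j))) (?k j)"
      using AE_cube_asymptotics[OF e']
    proof eventually_elim
      case (elim \<omega>)
      have ev: "\<forall>\<^sub>F j in sequentially. \<forall>k. (real k \<le> (c - \<epsilon>') * s j \<longrightarrow> has_chain (P \<omega> \<inter> hbox (\<lambda>_. 0) (\<lambda>_. s j)) k) \<and>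
          ((c + \<epsilon>') * s j \<le> real k \<longrightarrow> \<not> has_chain (P \<omega> \<inter> hbox (\<lambda>_. 0) (\<lambda>_. s j)) k)"
        using s_inf elim unfolding filterlim_iff by blast
      \<comment> \<open>This makes the other half at least 1, which covers the floor in
        \<open>k0\<close> below.\<close>
      have ev2: "\<forall>\<^sub>F j in sequentially. 2 / (\<epsilon> * a) \<le> \<rho> ^ j"
        using pinf unfolding filterlim_at_top by blast
      from ev ev[unfolded eventually_sequentially_Suc[symmetric, of "\<lambda>j. \<forall>k. (real k \<le> (c - \<epsilon>') * s j \<longrightarrow> has_chain (P \<omega> \<inter> hbox (\<lambda>_. 0) (\<lambda>_. s j)) k) \<and>
          ((c + \<epsilon>') * s j \<le> real k \<longrightarrow> \<not> has_chain (P \<omega> \<inter> hbox (\<lambda>_. 0) (\<lambda>_. s j)) k)"]] ev2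
      show ?case
      proof eventually_elim
        case (elim j)
        show ?case
        proof
          assume ch: "has_chain (P \<omega> \<inter> hbox (\<lambda>_. s j) (\<lambda>_. s (Suc j))) (?k j)"
          \<comment> \<open>The length already available below the cube. Stacking a long chain in
            the cube on top would exceed the upper bound at \<open>s (Suc j)\<close>. If the bound
            is negative, \<open>nat\<close> gives 0 and the chain is empty.\<close>
          define k0 where "k0 = nat \<lfloor>(c - \<epsilon>') * s j\<rfloor>"
          have "has_chain (P \<omega> \<inter> hbox (\<lambda>_. 0) (\<lambda>_. s j)) k0"
          proof (cases "(c - \<epsilon>') * s j \<ge> 0")
            case True
            then have "real k0 \<le> (c - \<epsilon>') * s j" unfolding k0_def by simp
            then show ?thesis using elim(1) by blast
          qed (simp add: k0_def)
          then have "has_chain (P \<omega> \<inter> hbox (\<lambda>_. 0) (\<lambda>_. s (Suc j))) (k0 + ?k j)"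
            using ch s_nn[of j] s_less[of j] by (intro has_chain_stack[of _ 0 "s j"]) auto
          then have "\<not> (c + \<epsilon>') * s (Suc j) \<le> real (k0 + ?k j)" using elim(2) by blast
          moreover have "real k0 \<ge> (c - \<epsilon>') * s j - 1" unfolding k0_def by linarith
          moreover have "real (?k j) \<ge> (c + \<epsilon>) * (s (Suc j) - s j)" unfolding sdiff by linarith
          ultimately have "(c + \<epsilon>') * s (Suc j) > (c - \<epsilon>') * s j - 1 + (c + \<epsilon>) * (s (Suc j) - s j)" by simp
          then have "\<epsilon>' * (s (Suc j) + s j) > \<epsilon> * (s (Suc j) - s j) - 1" by (simp add: algebra_simps)
          then have "\<epsilon> * (a * \<rho> ^ j) / 2 < 1" using small[of j] unfolding sdiff by linarith
          moreover have "\<epsilon> * (a * \<rho> ^ j) / 2 \<ge> 1" using elim(3) e a by (simp add: field_simps)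
          ultimately show False by linarith
        qed
      qed
    qed
  qed
  then show ?thesis unfolding vol_cube sdiff .
qed

lemma gbox_corner: "(\<And>i. y $ i < x $ i) \<Longrightarrow> 0 < t \<Longrightarrow> gbox (corner y 0) (corner x t)"
  by (auto simp: gbox_def corner_def split: option.splits)

section \<open>Almost sure limits for rescaled boxes\<close>

text \<open>For n between \<rho> ^ j and \<rho> ^ (j + 1) the rescaled box lies in one slightly
  larger box attached to j. One summable sequence of boxes therefore controls all n, and the
  enlargement vanishes as \<rho> tends to 1.\<close>

lemma AE_upper:
  assumes yx: "\<And>i. y $ i < x $ i" and t: "t > 0" and d: "\<delta> > 0"
  shows "AE \<omega> in M. \<forall>\<^sub>F n in sequentially. \<forall>k.
    real n * (c * root (CARD('d) + 1) (t * (\<Prod>i\<in>UNIV. x $ i - y $ i)) + \<delta>) \<le> real k \<longrightarrow>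
    \<not> has_chain (P \<omega> \<inter> hbox (corner (real n *\<^sub>R y) 0) (corner (real n *\<^sub>R x) (real n * t))) k"
proof -
  let ?D = "CARD('d) + 1"
  let ?G = "c * root ?D (t * (\<Prod>i\<in>UNIV. x $ i - y $ i))"
  \<comment> \<open>For n in the window of index j, \<open>n * x $ i\<close> is extremal at the
    right end if the coordinate is nonnegative and at the left end otherwise; \<open>max\<close> and
    \<open>min\<close> choose the right one.\<close>
  define xp where "xp e i = max (x $ i) ((1 + e) * x $ i)" for e i
  define ym where "ym e i = min (y $ i) ((1 + e) * y $ i)" for e i
  define a where "a e = root ?D ((1 + e) * t * (\<Prod>i\<in>UNIV. xp e i - ym e i))" for e
  \<comment> \<open>At e = 0 this expression is the desired limit. One e serves as enlargement
    ratio, as error of the upper tail and as margin.\<close>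
  have "isCont (\<lambda>e. (c + e) * a e + e) 0"
    unfolding a_def xp_def ym_def by (intro continuous_intros isCont_real_root[THEN isCont_o2[rotated]])
  then have "((\<lambda>e. (c + e) * a e + e) \<longlongrightarrow> ?G) (at_right 0)"
    by (auto simp: isCont_def a_def xp_def ym_def intro: filterlim_mono[OF _ order_refl at_le])
  then have "\<forall>\<^sub>F e in at_right 0. (c + e) * a e + e < ?G + \<delta>"
    using d by (intro order_tendstoD) auto
  moreover have "\<forall>\<^sub>F e in at_right (0::real). 0 < e" by (simp add: eventually_at_right_less)
  ultimately have "\<forall>\<^sub>F e in at_right 0. 0 < e \<and> (c + e) * a e + e < ?G + \<delta>"
    by eventually_elim simp
  then obtain e where e: "0 < e" "(c + e) * a e + e < ?G + \<delta>"
    using eventually_happens'[OF trivial_limit_at_right_real] by blast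
  define \<rho> where "\<rho> = 1 + e"
  have rho: "\<rho> > 1" using e by (simp add: \<rho>_def)
  have xy: "ym e i < xp e i" for i using yx[of i] by (auto simp: ym_def xp_def)
  have prodpos: "(\<Prod>i\<in>UNIV. xp e i - ym e i) > 0" using xy by (intro prod_pos) auto
  have apos: "a e > 0" unfolding a_def using prodpos t e by (intro real_root_gt_zero mult_pos_pos) auto
  define l where "l j = corner (\<rho> ^ j *\<^sub>R (\<chi> i. ym e i)) 0" for j :: nat
  define u where "u j = corner (\<rho> ^ j *\<^sub>R (\<chi> i. xp e i)) (\<rho> ^ Suc j * t)" for j :: nat
  have g: "gbox (l j) (u j)" for j
    unfolding l_def u_def using rho t xy by (intro gbox_corner) (auto intro!: mult_strict_left_mono)
  have vol: "vol (l j) (u j) = (a e * \<rho> ^ j) ^ ?D" for j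
  proof -
    have "vol (l j) (u j) = \<rho> ^ Suc j * t * (\<Prod>i\<in>UNIV. \<rho> ^ j * (xp e i - ym e i))"
      by (simp add: l_def u_def vol_corner right_diff_distrib)
    also have "\<dots> = (\<rho> * t * (\<Prod>i\<in>UNIV. xp e i - ym e i)) * (\<rho> ^ j) ^ ?D"
      by (simp add: prod.distrib mult_ac)
    also have "\<rho> * t * (\<Prod>i\<in>UNIV. xp e i - ym e i) = a e ^ ?D"
      unfolding a_def \<rho>_def by (rule real_root_pow_pos2[symmetric]) (use prodpos t e in auto)
    finally show ?thesis by (simp only: power_mult_distrib)
  qed
  have "AE \<omega> in M. \<forall>\<^sub>F j in sequentially. \<not> has_chain (P \<omega> \<inter> hbox (l j) (u j)) (nat \<lceil>(c + e) * (a e * \<rho> ^ j)\<rceil>)"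
    by (rule AE_not_has_chain[OF g]) (simp only: vol summable_upper_tail[OF apos rho e(1)])
  then show ?thesis
  proof eventually_elim
    case (elim \<omega>)
    then obtain J where J: "\<And>j. j \<ge> J \<Longrightarrow> \<not> has_chain (P \<omega> \<inter> hbox (l j) (u j)) (nat \<lceil>(c + e) * (a e * \<rho> ^ j)\<rceil>)"
      by (auto simp: eventually_sequentially)
    have "\<forall>\<^sub>F n in sequentially. 1 / e \<le> real n"
      using filterlim_real_sequentially unfolding filterlim_at_top by blast
    moreover have "\<forall>\<^sub>F n in sequentially. \<rho> ^ J \<le> real n"
      using filterlim_real_sequentially unfolding filterlim_at_top by blast
    ultimately show ?case
    proof eventually_elim
      case (elim n)
      obtain j where j: "j \<ge> J" "\<rho> ^ j \<le> real n" "real n \<le> \<rho> ^ Suc j"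
        using geometric_index[OF rho elim(2)] .
      show ?case
      proof (intro allI impI notI)
        fix k assume k: "real n * (?G + \<delta>) \<le> real k"
          and ch: "has_chain (P \<omega> \<inter> hbox (corner (real n *\<^sub>R y) 0) (corner (real n *\<^sub>R x) (real n * t))) k"
        have rj: "\<rho> ^ j > 0" using rho by simp
        have lo: "\<rho> ^ j * ym e i \<le> real n * y $ i" for i
        proof (cases "y $ i \<ge> 0")
          case True
          then have "ym e i = y $ i" using e by (simp add: ym_def min_def algebra_simps)
          then show ?thesis using j True by (simp add: mult_right_mono)
        next
          case False
          then have "ym e i = \<rho> * y $ i" using e by (simp add: ym_def min_def \<rho>_def algebra_simps zero_le_mult_iff)
          then have "\<rho> ^ j * ym e i = \<rho> ^ Suc j * y $ i" by simp
          also have "\<dots> \<le> real n * y $ i" using j(3) False by (intro mult_right_mono_neg) auto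
          finally show ?thesis .
        qed
        have hi: "real n * x $ i \<le> \<rho> ^ j * xp e i" for i
        proof (cases "x $ i \<ge> 0")
          case True
          then have "xp e i = \<rho> * x $ i" using e by (simp add: xp_def max_def \<rho>_def algebra_simps mult_nonneg_nonneg)
          then have "\<rho> ^ j * xp e i = \<rho> ^ Suc j * x $ i" by simp
          moreover have "real n * x $ i \<le> \<rho> ^ Suc j * x $ i" using j(3) True by (intro mult_right_mono) auto
          ultimately show ?thesis by linarith
        next
          case False
          then have "xp e i = x $ i" using e by (simp add: xp_def max_def algebra_simps zero_le_mult_iff)
          then show ?thesis using j False by (simp add: mult_right_mono_neg)
        qed
        have "nat \<lceil>(c + e) * (a e * \<rho> ^ j)\<rceil> \<le> k"
        proof -
          have "(c + e) * (a e * \<rho> ^ j) \<le> (c + e) * (a e * real n)"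
            using c_nonneg e apos j(2) by (intro mult_left_mono) auto
          also have "\<dots> \<le> real n * (?G + \<delta>)"
          proof -
            have "(c + e) * a e \<le> ?G + \<delta>" using e by linarith
            then have "real n * ((c + e) * a e) \<le> real n * (?G + \<delta>)" by (intro mult_left_mono) auto
            then show ?thesis by (simp add: mult_ac)
          qed
          finally show ?thesis using k by (intro real_ge_nat_ceiling_le) linarith
        qed
        then have "has_chain (P \<omega> \<inter> hbox (l j) (u j)) (nat \<lceil>(c + e) * (a e * \<rho> ^ j)\<rceil>)"
          using lo hi j(3) t
          by (intro has_chain_hbox_mono[OF ch]) (auto simp: l_def u_def corner_def split: option.splits)
        then show False using J[OF j(1)] by blast
      qed
    qed
  qed
qed

section \<open>Lower tail from independent blocks\<close>

text \<open>If at least N - r of the N diagonal blocks hold a chain of K points, stacking these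
  chains is enough. Failure thus forces some r blocks to be bad simultaneously; there are at most 2
  ^ N choices of them, each of probability \<open>q ^ r\<close>.\<close>

lemma lower_tail_blocks:
  assumes m: "m > 0" and r: "0 < r" "r \<le> N"
    and q: "q = 1 - chain_prob (m ^ (CARD('d) + 1)) K"
  shows "1 - chain_prob ((real N * m) ^ (CARD('d) + 1)) ((N - r) * K) \<le> 2 ^ N * q ^ r"
proof -
  define E where "E i = chain_event (\<lambda>_. real i * m) (\<lambda>_. real (Suc i) * m) K" for i
  have g: "gbox (\<lambda>_. real i * m) (\<lambda>_. real (Suc i) * m)" for i using m by (intro gbox_cube) auto
  have E[measurable]: "E i \<in> events" for i unfolding E_def by (rule chain_event_sets[OF g])
  have N: "N > 0" using r by simp
  let ?T = "{S. S \<subseteq> {..<N} \<and> card S = r}"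
  have gN: "gbox (\<lambda>_. 0) (\<lambda>_. real N * m)" using m N by (intro gbox_cube) auto
  have "AE \<omega> in M. \<forall>i. \<omega> \<in> E i \<longleftrightarrow> has_chain (P \<omega> \<inter> hbox (\<lambda>_. real i * m) (\<lambda>_. real (Suc i) * m)) K"
    unfolding AE_all_countable E_def using AE_chain_event[OF g] by blast
  then have "AE \<omega> in M. \<omega> \<in> space M - chain_event (\<lambda>_. 0) (\<lambda>_. real N * m) ((N - r) * K) \<longrightarrow>
      \<omega> \<in> (\<Union>S\<in>?T. space M \<inter> (\<Inter>i\<in>S. - E i))"
    using AE_chain_event[OF gN, of "(N - r) * K"]
  proof eventually_elim
    case (elim \<omega>)
    show ?case
    proof
      assume w: "\<omega> \<in> space M - chain_event (\<lambda>_. 0) (\<lambda>_. real N * m) ((N - r) * K)"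
      have "has_chain (P \<omega> \<inter> hbox (\<lambda>_. 0) (\<lambda>_. real N * m)) (card {i\<in>{..<N}. \<omega> \<in> E i} * K)"
        using has_chain_blocks[of m "P \<omega>" N K] m elim(1) by simp
      then have "\<not> (N - r) * K \<le> card {i\<in>{..<N}. \<omega> \<in> E i} * K"
        using elim(2) w has_chain_mono[OF _ order_refl] by blast
      then have "card {i\<in>{..<N}. \<omega> \<in> E i} < N - r" by (metis mult_le_mono1 not_le)
      moreover have "card {i\<in>{..<N}. \<omega> \<in> E i} + card {i\<in>{..<N}. \<omega> \<notin> E i} = N"
        by (subst card_Un_disjoint[symmetric]) (auto intro!: arg_cong[where f = card, of _ "{..<N}", simplified])
      ultimately have "r \<le> card {i\<in>{..<N}. \<omega> \<notin> E i}" by linarith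
      then obtain S where "S \<subseteq> {i\<in>{..<N}. \<omega> \<notin> E i}" "card S = r"
        by (metis obtain_subset_with_card_n)
      then show "\<omega> \<in> (\<Union>S\<in>?T. space M \<inter> (\<Inter>i\<in>S. - E i))" using w by auto
    qed
  qed
  have ev: "space M \<inter> (\<Inter>i\<in>S. - E i) \<in> events" if "S \<in> ?T" for S
  proof -
    have "space M \<inter> (\<Inter>i\<in>S. - E i) = space M - (\<Union>i\<in>S. E i)" by auto
    moreover have "finite S" using that finite_subset by blast
    ultimately show ?thesis by simp
  qed
  have finT: "finite ?T" by simp
  have pr: "prob (space M \<inter> (\<Inter>i\<in>S. - E i)) = q ^ r" if S: "S \<in> ?T" for S
  proof -
    have "prob (space M \<inter> (\<Inter>i\<in>S. - E i)) = (\<Prod>i\<in>S. 1 - chain_prob (vol (\<lambda>_::'d option. real i * m) (\<lambda>_. real (Suc i) * m)) K)"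
      unfolding E_def
    proof (rule indep_chain_events)
      show "finite S" using S finite_subset by blast
      show "disjoint_family_on (\<lambda>i. hbox (\<lambda>_::'d option. real i * m) (\<lambda>_. real (Suc i) * m)) S"
        unfolding disjoint_family_on_def
      proof (intro ballI impI)
        fix i j :: nat assume "i \<noteq> j"
        have "hbox (\<lambda>_::'d option. real i * m) (\<lambda>_. real (Suc i) * m) \<inter> hbox (\<lambda>_. real j * m) (\<lambda>_. real (Suc j) * m) = {}"
          if "i < j" for i j
        proof -
          have "real (Suc i) * m \<le> real j * m" using that m by (intro mult_right_mono) auto
          then have "\<not> (real j * m < x \<and> x \<le> real (Suc i) * m)" for x by linarith
          then show ?thesis unfolding hbox_def by blast
        qed
        then show "hbox (\<lambda>_::'d option. real i * m) (\<lambda>_. real (Suc i) * m) \<inter> hbox (\<lambda>_. real j * m) (\<lambda>_. real (Suc j) * m) = {}"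
          using \<open>i \<noteq> j\<close> by (metis Int_commute nat_neq_iff)
      qed
    qed (rule g)
    also have "\<dots> = (\<Prod>i\<in>S. q)"
      unfolding vol_cube q by (simp add: algebra_simps)
    finally show ?thesis using S by simp
  qed
  have "1 - chain_prob ((real N * m) ^ (CARD('d) + 1)) ((N - r) * K)
      = prob (space M - chain_event (\<lambda>_. 0) (\<lambda>_. real N * m) ((N - r) * K))"
    using prob_compl[OF chain_event_sets[OF gN]] chain_prob_cube[of 0 "real N * m"] m N by simp
  also have "\<dots> \<le> prob (\<Union>S\<in>?T. space M \<inter> (\<Inter>i\<in>S. - E i))"
    by (rule finite_measure_mono_AE) (fact, use ev finT in \<open>intro sets.finite_UN, auto\<close>)
  also have "\<dots> \<le> (\<Sum>S\<in>?T. prob (space M \<inter> (\<Inter>i\<in>S. - E i)))"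
    using ev finT by (intro finite_measure_subadditive_finite) auto
  also have "\<dots> = real (card ?T) * q ^ r" using pr by simp
  also have "\<dots> \<le> 2 ^ N * q ^ r"
  proof (rule mult_right_mono)
    have "card ?T \<le> card (Pow {..<N})" by (intro card_mono) auto
    then have "real (card ?T) \<le> real (2 ^ N)" by (simp only: card_Pow finite_lessThan card_lessThan of_nat_le_iff)
    then show "real (card ?T) \<le> 2 ^ N" by simp
    have "chain_prob (m ^ (CARD('d) + 1)) K \<le> 1"
      using chain_prob_cube[of 0 m K] m prob_le_1[of "chain_event (\<lambda>_. 0) (\<lambda>_. m) K"] by simp
    then show "0 \<le> q ^ r" unfolding q by simp
  qed
  finally show ?thesis .
qed

text \<open>Almost sure convergence weakened to convergence in probability. No rate is available, so
  a single good block size is fixed and independence of many blocks supplies the rate.\<close>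

lemma block_prob_tendsto_1:
  assumes e: "\<epsilon> > 0"
  shows "(\<lambda>m. chain_prob ((real (Suc m)) ^ (CARD('d) + 1)) (nat \<lfloor>(c - \<epsilon>) * real (Suc m)\<rfloor>)) \<longlonglongrightarrow> 1"
proof -
  let ?E = "\<lambda>m. chain_event (\<lambda>_. 0) (\<lambda>_. real (Suc m)) (nat \<lfloor>(c - \<epsilon>) * real (Suc m)\<rfloor>)"
  have g: "gbox (\<lambda>_. 0) (\<lambda>_. real (Suc m))" for m by (intro gbox_cube) auto
  have "(\<lambda>m. prob (?E m)) \<longlonglongrightarrow> prob (space M)"
  proof (rule prob_tendsto_of_AE)
    show "?E m \<in> events" for m by (rule chain_event_sets[OF g])
    have "AE \<omega> in M. \<forall>m. \<omega> \<in> ?E m \<longleftrightarrow> has_chain (P \<omega> \<inter> hbox (\<lambda>_. 0) (\<lambda>_. real (Suc m))) (nat \<lfloor>(c - \<epsilon>) * real (Suc m)\<rfloor>)"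
      unfolding AE_all_countable using AE_chain_event[OF g] by blast
    then show "AE \<omega> in M. \<forall>\<^sub>F m in sequentially. \<omega> \<in> ?E m \<longleftrightarrow> \<omega> \<in> space M"
      using AE_cube_asymptotics[OF e] AE_space
    proof eventually_elim
      case (elim \<omega>)
      have "filterlim (\<lambda>m. real (Suc m)) at_top sequentially"
        by (rule filterlim_compose[OF filterlim_real_sequentially filterlim_Suc])
      then have "\<forall>\<^sub>F m in sequentially. \<forall>k. real k \<le> (c - \<epsilon>) * real (Suc m) \<longrightarrow> has_chain (P \<omega> \<inter> hbox (\<lambda>_. 0) (\<lambda>_. real (Suc m))) k"
        using elim(2) unfolding filterlim_iff by (auto elim!: allE eventually_mono)
      then show ?case
      proof eventually_elim
        case (elim m)
        have "has_chain (P \<omega> \<inter> hbox (\<lambda>_. 0) (\<lambda>_. real (Suc m))) (nat \<lfloor>(c - \<epsilon>) * real (Suc m)\<rfloor>)"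
        proof (cases "(c - \<epsilon>) * real (Suc m) \<ge> 0")
          case True
          then show ?thesis using elim of_nat_floor by blast
        qed simp
        then show ?case using \<open>\<forall>m. \<omega> \<in> ?E m \<longleftrightarrow> _ m\<close> \<open>\<omega> \<in> space M\<close> by blast
      qed
    qed
  qed simp
  then show ?thesis using chain_prob_cube[of 0] by (simp add: prob_space del: of_nat_Suc)
qed

text \<open>Since only the volume matters, the box is exchanged for a cube of side n v, which holds
  \<open>p * r n\<close> diagonal blocks of side m. Allowing \<open>r n\<close> bad ones loses the
  fraction 1/p of the length and makes the failure probability exponentially small in n.\<close>

lemma AE_lower:
  assumes yx: "\<And>i. y $ i < x $ i" and t: "t > 0" and d: "\<delta> > 0"
  shows "AE \<omega> in M. \<forall>\<^sub>F n in sequentially. \<forall>k.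
    real k \<le> real n * (c * root (CARD('d) + 1) (t * (\<Prod>i\<in>UNIV. x $ i - y $ i)) - \<delta>) \<longrightarrow>
    has_chain (P \<omega> \<inter> hbox (corner (real n *\<^sub>R y) 0) (corner (real n *\<^sub>R x) (real n * t))) k"
proof -
  let ?D = "CARD('d) + 1"
  define V where "V = t * (\<Prod>i\<in>UNIV. x $ i - y $ i)"
  define v where "v = root ?D V"
  have V: "V > 0" unfolding V_def using yx t by (intro mult_pos_pos prod_pos) auto
  have v: "v > 0" unfolding v_def using V by (intro real_root_gt_zero) auto
  have vV: "v ^ ?D = V" unfolding v_def using V by (intro real_root_pow_pos2) auto
  \<comment> \<open>The discarded blocks, a fraction 1/p, may cost a quarter of
    \<open>\<delta>\<close> per unit of n.\<close>
  obtain p :: nat where p: "p > 0" "c / real p \<le> \<delta> / (4 * v)"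
  proof -
    obtain p :: nat where "c / (\<delta> / (4 * v)) < real p" using reals_Archimedean2 by blast
    then have "c / (\<delta> / (4 * v)) < real (Suc p)" by simp
    then have "c / real (Suc p) \<le> \<delta> / (4 * v)" using d v by (simp add: field_simps)
    then show ?thesis using that[of "Suc p"] by simp
  qed
  define \<epsilon> where "\<epsilon> = \<delta> / (4 * v)"
  have e: "\<epsilon> > 0" using d v by (simp add: \<epsilon>_def)
  \<comment> \<open>A bad block must have probability at most 4 ^ (-p): the number of ways to choose
    bad blocks is bounded by 2 ^ (p r), and 2 ^ (p r) 4 ^ (-p r) is still small.\<close>
  have "\<forall>\<^sub>F m in sequentially. 1 - (1/4) ^ p < chain_prob ((real (Suc m)) ^ ?D) (nat \<lfloor>(c - \<epsilon>) * real (Suc m)\<rfloor>)"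
    using block_prob_tendsto_1[OF e] by (intro order_tendstoD) auto
  then have "\<forall>\<^sub>F m in sequentially. 1 - (1/4) ^ p < chain_prob ((real (Suc m)) ^ ?D) (nat \<lfloor>(c - \<epsilon>) * real (Suc m)\<rfloor>)
      \<and> 4 * v / \<delta> \<le> real m"
    using filterlim_real_sequentially unfolding filterlim_at_top
    by (auto intro: eventually_conj)
  then obtain m1 where m1: "1 - (1/4) ^ p < chain_prob ((real (Suc m1)) ^ ?D) (nat \<lfloor>(c - \<epsilon>) * real (Suc m1)\<rfloor>)"
      "4 * v / \<delta> \<le> real m1"
    by (auto simp: eventually_sequentially)
  define m where "m = real (Suc m1)"
  define K where "K = nat \<lfloor>(c - \<epsilon>) * m\<rfloor>"
  define q where "q = 1 - chain_prob (m ^ ?D) K"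
  have m: "m > 0" "4 * v / \<delta> \<le> m" using m1(2) by (auto simp: m_def)
  have q: "q \<le> (1/4) ^ p" using m1(1) unfolding q_def K_def m_def by simp
  have q0: "0 \<le> q"
    using chain_prob_cube[of 0 m K] m prob_le_1[of "chain_event (\<lambda>_. 0) (\<lambda>_. m) K"] unfolding q_def by simp
  define r where "r n = nat \<lfloor>real n * v / (real p * m)\<rfloor>" for n :: nat
  define k where "k n = (p - 1) * r n * K" for n
  have r1: "real (r n) \<le> real n * v / (real p * m)" for n
    unfolding r_def using v m by (intro of_nat_floor) auto
  have r2: "real n * v / (real p * m) - 1 \<le> real (r n)" for n
    unfolding r_def using v m by linarith
  define w where "w = v / (real p * m)"
  have w: "w > 0" using v m p by (simp add: w_def)
  have le1: "chain_prob ((real n * v) ^ ?D) j \<ge> 0" if "n > 0" for n j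
    using chain_prob_cube[of 0 "real n * v" j] v that measure_nonneg[of M "chain_event (\<lambda>_. 0) (\<lambda>_. real n * v) j"] by simp
  have tail: "1 - chain_prob ((real n * v) ^ ?D) (k n) \<le> (1/2) ^ r n" if n: "n > 0" for n
  proof (cases "r n = 0")
    case True
    then show ?thesis using le1[OF n, of "k n"] by simp
  next
    case False
    have "1 - chain_prob ((real n * v) ^ ?D) (k n) \<le> 1 - chain_prob ((real (p * r n) * m) ^ ?D) (k n)"
    proof -
      have "0 < real (p * r n) * m" using False p m by simp
      moreover have "real (p * r n) * m \<le> real n * v" using r1[of n] p m by (simp add: field_simps)
      ultimately show ?thesis using chain_prob_mono[of "real (p * r n) * m" "real n * v" "k n" "k n"] by simp
    qed
    also have "\<dots> = 1 - chain_prob ((real (p * r n) * m) ^ ?D) ((p * r n - r n) * K)"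
      unfolding k_def by (simp add: diff_mult_distrib)
    also have "1 - chain_prob ((real (p * r n) * m) ^ ?D) ((p * r n - r n) * K) \<le> 2 ^ (p * r n) * q ^ r n"
      using False p m by (intro lower_tail_blocks) (auto simp: q_def)
    also have "\<dots> \<le> 2 ^ (p * r n) * ((1/4) ^ p) ^ r n"
      using q q0 by (intro mult_left_mono power_mono) auto
    also have "\<dots> = (1/2) ^ (p * r n)"
      by (simp add: power_mult[symmetric] power_mult_distrib[symmetric])
    also have "\<dots> \<le> (1/2) ^ r n" using p by (intro power_decreasing) auto
    finally show ?thesis .
  qed
  \<comment> \<open>Since \<open>r n\<close> is at least n w - 1, the bound (1/2) ^
    \<open>r n\<close> is at most 2 z ^ n, a geometric series.\<close>
  define z where "z = (1/2) powr w"
  have z: "0 < z" "z < 1" unfolding z_def powr_def using w by (auto simp: ln_div)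
  have rz: "(1/2::real) ^ r n \<le> 2 * z ^ n" for n
  proof -
    have "(1/2::real) ^ r n = (1/2) powr real (r n)" by (simp add: powr_realpow)
    also have "\<dots> \<le> (1/2) powr (real n * w - 1)"
      using r2[of n] by (intro powr_mono') (auto simp: w_def)
    also have "\<dots> = 2 * ((1/2) powr w) powr real n"
      by (simp add: powr_diff powr_powr mult.commute)
    also have "\<dots> = 2 * z ^ n" using z by (simp add: z_def[symmetric] powr_realpow)
    finally show ?thesis .
  qed
  let ?l = "\<lambda>n. corner (real n *\<^sub>R y) 0" and ?u = "\<lambda>n. corner (real n *\<^sub>R x) (real n * t)"
  have g: "gbox (?l (Suc n)) (?u (Suc n))" for n
    using yx t by (intro gbox_corner) auto
  have vol: "vol (?l n) (?u n) = (real n * v) ^ ?D" for n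
  proof -
    have "vol (?l n) (?u n) = real n * t * (\<Prod>i\<in>UNIV. real n * (x $ i - y $ i))"
      by (simp add: vol_corner right_diff_distrib)
    also have "\<dots> = real n ^ ?D * V" by (simp add: V_def prod.distrib mult_ac)
    finally show ?thesis by (simp only: power_mult_distrib vV)
  qed
  have "summable (\<lambda>n. 1 - chain_prob (vol (?l (Suc n)) (?u (Suc n))) (k (Suc n)))"
  proof (rule summable_comparison_test')
    show "summable (\<lambda>n. 2 * z ^ Suc n)" using z by (simp add: summable_geometric summable_mult)
    show "norm (1 - chain_prob (vol (?l (Suc n)) (?u (Suc n))) (k (Suc n))) \<le> 2 * z ^ Suc n" for n
    proof -
      have "chain_prob (vol (?l (Suc n)) (?u (Suc n))) (k (Suc n)) \<le> 1"
        using prob_chain_event[OF g, of n] prob_le_1 by metis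
      moreover have "1 - chain_prob (vol (?l (Suc n)) (?u (Suc n))) (k (Suc n)) \<le> 2 * z ^ Suc n"
        unfolding vol using order_trans[OF tail[OF zero_less_Suc] rz] .
      ultimately show ?thesis by simp
    qed
  qed
  from AE_has_chain[OF g this]
  show ?thesis
  proof eventually_elim
    case (elim \<omega>)
    then have ev: "\<forall>\<^sub>F n in sequentially. has_chain (P \<omega> \<inter> hbox (?l n) (?u n)) (k n)"
      by (subst (asm) eventually_sequentially_Suc)
    define C where "C = real p * m * c"
    have "\<forall>\<^sub>F n in sequentially. 4 * C / \<delta> \<le> real n" 
      using filterlim_real_sequentially unfolding filterlim_at_top by blast
    with ev eventually_gt_at_top[of 0] show ?case
    proof eventually_elim
      case (elim n)
      show ?case
      proof (intro allI impI)
        fix j assume j: "real j \<le> real n * (c * root ?D (t * (\<Prod>i\<in>UNIV. x $ i - y $ i)) - \<delta>)"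
        then have j': "real j \<le> real n * (c * v - \<delta>)" by (simp add: v_def V_def)
        show "has_chain (P \<omega> \<inter> hbox (?l n) (?u n)) j"
        proof (cases "j = 0")
          case False
          have cv: "c * v - \<delta> > 0"
          proof (rule ccontr)
            assume "\<not> c * v - \<delta> > 0"
            then have "real n * (c * v - \<delta>) \<le> 0" by (simp add: mult_nonneg_nonpos)
            then show False using j' False by simp
          qed
          \<comment> \<open>One \<open>\<epsilon>\<close> is the error of the limit inside a block.
            The other pays for the floor in \<open>K\<close>, because m is large enough that m
            \<epsilon> \<ge> 1.\<close>
          define b where "b = c - 2 * \<epsilon>"
          have b: "0 \<le> b" "b \<le> c"
          proof -
            have "4 * \<epsilon> < c" using cv v unfolding \<epsilon>_def by (simp add: field_simps)
            then show "0 \<le> b" "b \<le> c" using e unfolding b_def by linarith+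
          qed
          have K: "real K \<ge> (c - \<epsilon>) * m - 1" unfolding K_def by linarith
          have K2: "m * (c - \<epsilon>) - 1 \<ge> m * (c - 2 * \<epsilon>)"
          proof -
            have "m * \<epsilon> \<ge> 1" using m(2) d v unfolding \<epsilon>_def by (simp add: field_simps)
            then show ?thesis by (simp add: algebra_simps)
          qed
          have Kb: "m * b \<le> real K" using K K2 unfolding b_def by (simp add: mult.commute)
          \<comment> \<open>The loss n \<delta> splits into four quarters n v \<epsilon>. Two are
            inside b, one is kept for the discarded blocks, and the last exceeds C, which pays for
            the floor in \<open>r n\<close>.\<close>
          have "real n * (c * v - \<delta>) \<le> real n * v * b - real n * v * \<epsilon> - C"
          proof -
            have "real n * v * \<epsilon> = real n * \<delta> / 4" unfolding \<epsilon>_def using v by simp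
            moreover have "C \<le> real n * \<delta> / 4" using elim(3) d by (simp add: field_simps)
            moreover have "real n * v * b = real n * (c * v) - 2 * (real n * v * \<epsilon>)"
              unfolding b_def by (simp add: algebra_simps)
            ultimately show ?thesis unfolding right_diff_distrib by linarith
          qed
          also have "\<dots> \<le> real n * v * b - real n * v / real p * b - (real p - 1) * m * b"
          proof -
            have "real n * v / real p * b \<le> real n * v / real p * c" using b v by (intro mult_left_mono) auto
            also have "\<dots> = real n * v * (c / real p)" by simp
            also have "\<dots> \<le> real n * v * \<epsilon>" using p(2) v unfolding \<epsilon>_def by (intro mult_left_mono) auto
            finally have "real n * v / real p * b \<le> real n * v * \<epsilon>" .
            moreover have "(real p - 1) * m * b \<le> C"
              unfolding C_def using b m p by (intro mult_mono) auto
            ultimately show ?thesis by linarith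
          qed
          also have "\<dots> = (real p - 1) * (real n * v / (real p * m) - 1) * (m * b)"
            using m p by (simp add: field_simps)
          also have "\<dots> \<le> (real p - 1) * real (r n) * (m * b)"
            using r2[of n] p m b by (intro mult_right_mono mult_left_mono) auto
          also have "\<dots> \<le> (real p - 1) * real (r n) * real K"
            using Kb p by (intro mult_left_mono) auto
          also have "\<dots> = real (k n)" unfolding k_def using p by (simp add: of_nat_diff)
          finally have "j \<le> k n" using j' by simp
          then show ?thesis using elim(1) has_chain_mono by blast
        qed simp
      qed
    qed
  qed
qed

text \<open>The exceptional null set must not depend on \<open>\<delta>\<close>, so the two bounds
  are collected for \<delta> = 1/(m + 1) only. A general \<open>\<delta>\<close> then uses one half
  for the limit and one half for rounding to an integer length.\<close>

lemma AE_Hlp_limit: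
  assumes yx: "\<And>i. y $ i < x $ i" and t: "t > 0"
  shows "AE \<omega> in M. \<forall>\<delta>>0. \<forall>\<^sub>F n in sequentially.
    ereal (real n * (c * root (CARD('d) + 1) (t * (\<Prod>i\<in>UNIV. x $ i - y $ i)) - \<delta>))
       \<le> Hlp (P \<omega>) (real n *\<^sub>R y) (real n *\<^sub>R x) (real n * t) \<and>
    Hlp (P \<omega>) (real n *\<^sub>R y) (real n *\<^sub>R x) (real n * t)
       \<le> ereal (real n * (c * root (CARD('d) + 1) (t * (\<Prod>i\<in>UNIV. x $ i - y $ i)) + \<delta>))"
proof -
  define G where "G = c * root (CARD('d) + 1) (t * (\<Prod>i\<in>UNIV. x $ i - y $ i))"
  let ?S = "\<lambda>\<omega> n. P \<omega> \<inter> hbox (corner (real n *\<^sub>R y) 0) (corner (real n *\<^sub>R x) (real n * t))"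
  have "AE \<omega> in M. \<forall>m. \<forall>\<^sub>F n in sequentially. \<forall>k.
      (real n * (G + 1 / real (Suc m)) \<le> real k \<longrightarrow> \<not> has_chain (?S \<omega> n) k) \<and>
      (real k \<le> real n * (G - 1 / real (Suc m)) \<longrightarrow> has_chain (?S \<omega> n) k)"
    unfolding AE_all_countable
  proof
    fix m
    have d: "1 / real (Suc m) > 0" by simp
    show "AE \<omega> in M. \<forall>\<^sub>F n in sequentially. \<forall>k.
      (real n * (G + 1 / real (Suc m)) \<le> real k \<longrightarrow> \<not> has_chain (?S \<omega> n) k) \<and>
      (real k \<le> real n * (G - 1 / real (Suc m)) \<longrightarrow> has_chain (?S \<omega> n) k)"
      using AE_upper[OF yx t d] AE_lower[OF yx t d] unfolding G_def[symmetric]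
      by eventually_elim (auto elim: eventually_elim2)
  qed
  then show ?thesis
    unfolding G_def[symmetric]
  proof eventually_elim
    case (elim \<omega>)
    show ?case
    proof (intro allI impI)
      fix \<delta> :: real assume d: "\<delta> > 0"
      obtain m where m: "1 / real (Suc m) < \<delta> / 2" using d nat_approx_posE[of "\<delta>/2"] by auto
      have "\<forall>\<^sub>F n in sequentially. 2 / \<delta> \<le> real n"
        using filterlim_real_sequentially unfolding filterlim_at_top by blast
      with elim[rule_format, of m]
      show "\<forall>\<^sub>F n in sequentially. ereal (real n * (G - \<delta>)) \<le> Hlp (P \<omega>) (real n *\<^sub>R y) (real n *\<^sub>R x) (real n * t) \<and>
          Hlp (P \<omega>) (real n *\<^sub>R y) (real n *\<^sub>R x) (real n * t) \<le> ereal (real n * (G + \<delta>))"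
      proof eventually_elim
        case (elim n)
        have n: "real n * (\<delta> / 2) \<ge> 1" using elim(2) d by (simp add: field_simps)
        have nm: "real n * (1 / real (Suc m)) \<le> real n * (\<delta> / 2)" using m by (intro mult_left_mono) auto
        have "Hlp (P \<omega>) (real n *\<^sub>R y) (real n *\<^sub>R x) (real n * t) \<le> ereal (real n * (G + \<delta>))"
        proof -
          define k where "k = nat \<lceil>real n * (G + 1 / real (Suc m))\<rceil>"
          have "real n * (G + 1 / real (Suc m)) \<ge> 0" 
            using c_nonneg yx t unfolding G_def by (intro mult_nonneg_nonneg add_nonneg_nonneg real_root_ge_zero prod_nonneg) (auto intro: less_imp_le)
          then have k: "real n * (G + 1 / real (Suc m)) \<le> real k" "real k \<le> real n * (G + 1 / real (Suc m)) + 1"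
            unfolding k_def by linarith+
          have "Hlp (P \<omega>) (real n *\<^sub>R y) (real n *\<^sub>R x) (real n * t) < ereal (real k)"
            using elim(1) k(1) by (intro Hlp_less) blast
          also have "real k \<le> real n * (G + \<delta>)"
            using k(2) n nm unfolding distrib_left by linarith
          finally show ?thesis by (simp add: less_imp_le)
        qed
        moreover have "ereal (real n * (G - \<delta>)) \<le> Hlp (P \<omega>) (real n *\<^sub>R y) (real n *\<^sub>R x) (real n * t)"
        proof (cases "real n * (G - 1 / real (Suc m)) \<ge> 0")
          case True
          define k where "k = nat \<lfloor>real n * (G - 1 / real (Suc m))\<rfloor>"
          have k: "real k \<le> real n * (G - 1 / real (Suc m))" "real n * (G - 1 / real (Suc m)) - 1 \<le> real k"
            unfolding k_def using True by linarith+
          have "real n * (G - \<delta>) \<le> real k" using k(2) n nm unfolding right_diff_distrib by linarith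
          then have "ereal (real n * (G - \<delta>)) \<le> ereal (real k)" by simp
          also have "\<dots> \<le> Hlp (P \<omega>) (real n *\<^sub>R y) (real n *\<^sub>R x) (real n * t)"
            unfolding Hlp_ge_iff using elim(1) k(1) by blast
          finally show ?thesis .
        next
          case False
          then have "real n * (G - \<delta>) \<le> 0" using n nm unfolding right_diff_distrib by linarith
          then show ?thesis using Hlp_nonneg by (metis ereal_less_eq(3) order_trans zero_ereal_def)
        qed
        ultimately show ?case by blast
      qed
    qed
  qed
qed

section \<open>Uniform bound for far starting points\<close>

text \<open>All y with \<open>norm_inf y\<close> between 2 ^ j and 2 ^ (j + 1) share one larger box
  with lower corner -2 ^ (j + 1) in each spatial coordinate. Its volume has (d + 1)-th root of order
  n \<beta> ^ j, and the factorial bound makes longer chains summably rare in j and in n.\<close>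

lemma AE_Hlp_tail:
  assumes b: "b > 0" and t: "t > 0"
  obtains C Mb where "C > 0" "Mb > 0" "AE \<omega> in M. \<forall>\<^sub>F n in sequentially. \<forall>y.
      y \<le> b *\<^sub>R 1 \<longrightarrow> Mb \<le> norm_inf y \<longrightarrow>
      Hlp (P \<omega>) (real n *\<^sub>R y) (real n *\<^sub>R (b *\<^sub>R 1)) (real n * t)
        \<le> ereal (C * real n * norm_inf y powr (real CARD('d) / (real CARD('d) + 1)))"
proof -
  let ?D = "CARD('d) + 1"
  define \<alpha> where "\<alpha> = real CARD('d) / (real CARD('d) + 1)"
  have alpha: "\<alpha> > 0" unfolding \<alpha>_def by simp
  \<comment> \<open>The factor by which \<open>norm_inf y powr \<alpha>\<close> grows over one
    dyadic shell.\<close>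
  define \<beta> where "\<beta> = 2 powr \<alpha>"
  have beta: "\<beta> > 1" unfolding \<beta>_def powr_def using alpha by simp
  have betaD: "\<beta> ^ ?D = 2 ^ CARD('d)"
  proof -
    have "\<beta> ^ ?D = \<beta> powr real ?D" using beta by (intro powr_realpow[symmetric]) simp
    also have "\<dots> = 2 powr real CARD('d)" unfolding \<beta>_def powr_powr by (simp add: \<alpha>_def add.commute)
    finally show ?thesis by (simp add: powr_realpow)
  qed
  define A where "A = root ?D (t * 2 ^ CARD('d))"
  have A: "A > 0" unfolding A_def using t by (intro real_root_gt_zero) auto
  have AD: "A ^ ?D = t * 2 ^ CARD('d)" unfolding A_def using t by (intro real_root_pow_pos2) auto
  \<comment> \<open>The first entry makes the factorial bound at most 2 ^ (-k), using
    \<open>k ^ k / k! \<le> exp k\<close>. The second, with Bernoulli's inequality for \<beta> ^ j,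
    makes k at least n + j, so the sum over j is finite and summable in n.\<close>
  define C where "C = max (2 * exp 1 * A) (1 / (\<beta> - 1)) + 1"
  have C: "C \<ge> 1" "C \<ge> 2 * exp 1 * A" "C * (\<beta> - 1) \<ge> 1"
  proof -
    show "C \<ge> 1" "C \<ge> 2 * exp 1 * A" unfolding C_def using A by (auto simp: le_max_iff_disj)
    have "1 / (\<beta> - 1) \<le> C" unfolding C_def by auto
    then show "C * (\<beta> - 1) \<ge> 1" using beta by (simp add: field_simps)
  qed
  define k where "k n j = nat \<lceil>C * (real n * \<beta> ^ j)\<rceil>" for n j :: nat
  have k1: "C * (real n * \<beta> ^ j) \<le> real (k n j)" for n j unfolding k_def by linarith
  have k2: "real (k n j) \<le> C * (real n * \<beta> ^ j) + 1" for n j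
    unfolding k_def using C beta by (simp add: of_nat_ceiling)
  define l where "l n j = corner ((- (real n * 2 ^ j)) *\<^sub>R (1 :: real^'d)) 0" for n j :: nat
  define u where "u n = corner (real n *\<^sub>R (b *\<^sub>R (1 :: real^'d))) (real n * t)" for n :: nat
  \<comment> \<open>From this shell on b \<le> 2 ^ j, so the side n b + n 2 ^ j is at most twice n 2
    ^ j.\<close>
  obtain j0 :: nat where j0: "b < 2 ^ j0" using real_arch_pow[of 2 b] by auto
  have g: "gbox (l n j) (u n)" if "n > 0" for n j
    unfolding l_def u_def
  proof (rule gbox_corner)
    fix i
    have "- (real n * 2 ^ j) < 0" "0 < real n * b" using that b by auto
    then show "((- (real n * 2 ^ j)) *\<^sub>R (1 :: real^'d)) $ i < (real n *\<^sub>R b *\<^sub>R (1 :: real^'d)) $ i" for i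
      by (simp del: neg_less_0_iff_less)
  qed (use that t in auto)
  have tail: "chain_prob (vol (l n j) (u n)) (k n j) \<le> (1/2) ^ (n + j)" if n: "n > 0" and j: "j \<ge> j0" for n j
  proof -
    have b2: "b \<le> 2 ^ j" using j0 power_increasing[OF j, of "2::real"] by linarith
    define X where "X = real n * \<beta> ^ j * A"
    have X: "X > 0" unfolding X_def using n beta A by simp
    have "vol (l n j) (u n) = real n * t * (real n * b + real n * 2 ^ j) ^ CARD('d)"
      by (simp add: l_def u_def vol_corner)
    also have "\<dots> \<le> real n * t * (real n * (2 * 2 ^ j)) ^ CARD('d)"
    proof (intro mult_left_mono power_mono)
      show "real n * b + real n * 2 ^ j \<le> real n * (2 * 2 ^ j)"
        using mult_left_mono[OF b2, of "real n"] by (simp add: algebra_simps)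
    qed (use b t in auto)
    also have "\<dots> = real n ^ ?D * (2 ^ CARD('d)) ^ j * (t * 2 ^ CARD('d))"
      by (simp add: power_mult_distrib power_mult[symmetric] mult_ac)
    also have "\<dots> = X ^ ?D"
      unfolding X_def power_mult_distrib AD betaD[symmetric] by (simp only: power_mult[symmetric] mult.commute)
    finally have vle: "vol (l n j) (u n) \<le> X ^ ?D" .
    have v0: "0 \<le> vol (l n j) (u n)" using g[OF n] by (auto simp: vol_def gbox_def less_imp_le intro!: prod_nonneg)
    have kpos: "real (k n j) > 0" using k1[of n j] C n beta by (smt (verit) mult_pos_pos of_nat_0_less_iff zero_less_power)
    have kX: "2 * exp 1 * X \<le> real (k n j)"
    proof -
      have "2 * exp 1 * X = (2 * exp 1 * A) * (real n * \<beta> ^ j)" by (simp add: X_def)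
      also have "\<dots> \<le> C * (real n * \<beta> ^ j)" using C beta by (intro mult_right_mono) auto
      finally show ?thesis using k1[of n j] by linarith
    qed
    have nj: "n + j \<le> k n j"
    proof -
      have "1 + real j * (\<beta> - 1) \<le> \<beta> ^ j" using Bernoulli_inequality[of "\<beta> - 1" j] beta by simp
      then have "C * (1 + real j * (\<beta> - 1)) \<le> C * \<beta> ^ j" using C by (intro mult_left_mono) auto
      moreover have "1 + real j \<le> C * (1 + real j * (\<beta> - 1))"
      proof -
        have "real j * 1 \<le> real j * (C * (\<beta> - 1))" using C by (intro mult_left_mono) auto
        then show ?thesis using C(1) by (simp add: algebra_simps)
      qed
      ultimately have "real n * (1 + real j) \<le> real n * (C * \<beta> ^ j)" by (intro mult_left_mono) auto
      moreover have "real n + real j \<le> real n * (1 + real j)"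
      proof -
        have "1 * real j \<le> real n * real j" using n by (intro mult_right_mono) auto
        then show ?thesis by (simp add: algebra_simps)
      qed
      ultimately show ?thesis using k1[of n j] by (simp add: mult_ac)
    qed
    have "X ^ k n j / fact (k n j) \<le> (1/2) ^ k n j"
    proof -
      have "real (k n j) ^ k n j / fact (k n j) \<le> exp 1 ^ k n j"
        using power_div_fact_le_exp[of "real (k n j)" "k n j"] by (simp add: exp_of_nat_mult[symmetric])
      then have "(X / real (k n j)) ^ k n j * (real (k n j) ^ k n j / fact (k n j)) \<le> (X / real (k n j)) ^ k n j * exp 1 ^ k n j"
        using X by (intro mult_left_mono) auto
      moreover have "(X / real (k n j)) ^ k n j * (real (k n j) ^ k n j / fact (k n j)) = X ^ k n j / fact (k n j)"
        using kpos by (simp add: power_divide)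
      moreover have "(X / real (k n j)) ^ k n j * exp 1 ^ k n j = (X / real (k n j) * exp 1) ^ k n j"
        by (simp only: power_mult_distrib)
      moreover have "(X / real (k n j) * exp 1) ^ k n j \<le> (1/2) ^ k n j"
        using kX kpos X by (intro power_mono) (auto simp: field_simps)
      ultimately show ?thesis by linarith
    qed
    then have "(X ^ k n j / fact (k n j)) ^ ?D \<le> ((1/2) ^ k n j) ^ ?D"
      using X by (intro power_mono) auto
    also have "\<dots> \<le> ((1/2) ^ k n j) ^ 1" by (intro power_decreasing) (auto simp: power_le_one)
    also have "\<dots> \<le> (1/2) ^ (n + j)" using nj by (simp add: power_decreasing)
    finally have "(X ^ k n j / fact (k n j)) ^ ?D \<le> (1/2) ^ (n + j)" .
    moreover have "chain_prob (vol (l n j) (u n)) (k n j) \<le> (X ^ ?D) ^ k n j / fact (k n j) ^ ?D"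
      using chain_prob_le_fact[OF g[OF n, of j], of "k n j"] power_mono[OF vle v0, of "k n j"]
      by (smt (verit) divide_right_mono fact_ge_zero zero_le_power)
    moreover have "(X ^ ?D) ^ k n j / fact (k n j) ^ ?D = (X ^ k n j / fact (k n j)) ^ ?D"
      unfolding power_divide by (simp only: power_mult[symmetric] mult.commute)
    ultimately show ?thesis by linarith
  qed
  define E where "E n = (\<Union>j. chain_event (l (Suc n) (j + j0)) (u (Suc n)) (k (Suc n) (j + j0)))" for n
  have E: "E n \<in> events" for n unfolding E_def using chain_event_sets[OF g] by blast
  have pE: "prob (E n) \<le> (1/2) ^ n" for n
  proof -
    let ?e = "\<lambda>j. chain_event (l (Suc n) (j + j0)) (u (Suc n)) (k (Suc n) (j + j0))"
    have pe: "prob (?e j) \<le> (1/2) ^ Suc n * (1/2) ^ j" for j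
    proof -
      have "prob (?e j) \<le> (1/2) ^ (Suc n + (j + j0))"
        using tail[of "Suc n" "j + j0"] prob_chain_event[OF g] by simp
      also have "\<dots> \<le> (1/2) ^ (Suc n + j)" by (intro power_decreasing) auto
      finally show ?thesis by (simp add: power_add)
    qed
    have sg: "summable (\<lambda>j. (1/2::real) ^ Suc n * (1/2) ^ j)" by (intro summable_mult summable_geometric) simp
    have s: "summable (\<lambda>j. prob (?e j))"
      by (rule summable_comparison_test'[OF sg]) (use pe in auto)
    have "prob (E n) \<le> (\<Sum>j. prob (?e j))"
      unfolding E_def using s chain_event_sets[OF g] by (intro finite_measure_subadditive_countably) auto
    also have "\<dots> \<le> (\<Sum>j. (1/2) ^ Suc n * (1/2) ^ j)" by (rule suminf_le[OF pe s sg])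
    also have "\<dots> = (1/2) ^ n" by (subst suminf_mult) (auto simp: suminf_geometric)
    finally show ?thesis .
  qed
  have "AE \<omega> in M. \<forall>\<^sub>F n in sequentially. \<omega> \<in> space M - E n"
  proof (rule borel_cantelli_AE1[OF E])
    show "summable (\<lambda>n. prob (E n))"
      by (rule summable_comparison_test'[of "\<lambda>n. (1/2) ^ n"]) (use pE in auto)
  qed (simp add: less_top[symmetric])
  moreover have "AE \<omega> in M. \<forall>n j. \<omega> \<in> chain_event (l (Suc n) (j + j0)) (u (Suc n)) (k (Suc n) (j + j0)) \<longleftrightarrow>
      has_chain (P \<omega> \<inter> hbox (l (Suc n) (j + j0)) (u (Suc n))) (k (Suc n) (j + j0))"
    unfolding AE_all_countable using AE_chain_event[OF g] by blast
  ultimately have "AE \<omega> in M. \<forall>\<^sub>F n in sequentially. \<forall>y.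
      y \<le> b *\<^sub>R 1 \<longrightarrow> 2 ^ j0 \<le> norm_inf y \<longrightarrow>
      Hlp (P \<omega>) (real n *\<^sub>R y) (real n *\<^sub>R (b *\<^sub>R 1)) (real n * t)
        \<le> ereal ((C + 1) * \<beta> * real n * norm_inf y powr \<alpha>)"
  proof eventually_elim
    case (elim \<omega>)
    then have "\<forall>\<^sub>F n in sequentially. \<forall>j\<ge>j0. \<not> has_chain (P \<omega> \<inter> hbox (l (Suc n) j) (u (Suc n))) (k (Suc n) j)"
      unfolding E_def by (auto elim!: eventually_mono simp: le_iff_add add.commute)
    then have ev: "\<forall>\<^sub>F n in sequentially. \<forall>j\<ge>j0. \<not> has_chain (P \<omega> \<inter> hbox (l n j) (u n)) (k n j)"
      by (subst (asm) eventually_sequentially_Suc)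
    from ev eventually_gt_at_top[of 0] show ?case
    proof eventually_elim
      case (elim n)
      show ?case
      proof (intro allI impI)
        fix y :: "real^'d" assume "y \<le> b *\<^sub>R 1" and N: "2 ^ j0 \<le> norm_inf y"
        obtain j where j: "j \<ge> j0" "2 ^ j \<le> norm_inf y" "norm_inf y \<le> 2 ^ Suc j"
          using geometric_index[of 2 j0 "norm_inf y"] N by auto
        have yi: "- (2 ^ Suc j) \<le> y $ i" for i
        proof -
          have "\<bar>y $ i\<bar> \<le> norm_inf y" unfolding norm_inf_def by (intro Max_ge) auto
          then show ?thesis using j(3) by linarith
        qed
        have "\<not> has_chain (P \<omega> \<inter> hbox (corner (real n *\<^sub>R y) 0) (corner (real n *\<^sub>R (b *\<^sub>R 1)) (real n * t))) (k n (Suc j))"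
        proof
          assume "has_chain (P \<omega> \<inter> hbox (corner (real n *\<^sub>R y) 0) (corner (real n *\<^sub>R (b *\<^sub>R 1)) (real n * t))) (k n (Suc j))"
          then have "has_chain (P \<omega> \<inter> hbox (l n (Suc j)) (u n)) (k n (Suc j))"
          proof (rule has_chain_hbox_mono)
            fix i
            show "l n (Suc j) i \<le> corner (real n *\<^sub>R y) 0 i"
              using mult_left_mono[OF yi, of "real n"] by (cases i) (auto simp: l_def)
          qed (auto simp: u_def)
          then show False using elim(1) j(1) by (meson le_SucI)
        qed
        then have "Hlp (P \<omega>) (real n *\<^sub>R y) (real n *\<^sub>R (b *\<^sub>R 1)) (real n * t) < ereal (real (k n (Suc j)))"
          by (rule Hlp_less)
        also have "real (k n (Suc j)) \<le> (C + 1) * \<beta> * real n * norm_inf y powr \<alpha>"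
        proof -
          have b1: "1 \<le> real n * \<beta> ^ Suc j"
          proof -
            have "1 * 1 \<le> real n * \<beta> ^ Suc j" using elim(2) beta by (intro mult_mono one_le_power) auto
            then show ?thesis by simp
          qed
          have "real (k n (Suc j)) \<le> C * (real n * \<beta> ^ Suc j) + real n * \<beta> ^ Suc j" using k2[of n "Suc j"] b1 by linarith
          also have "\<dots> = (C + 1) * \<beta> * real n * \<beta> ^ j" by (simp add: algebra_simps)
          also have "\<dots> \<le> (C + 1) * \<beta> * real n * norm_inf y powr \<alpha>"
          proof (intro mult_left_mono)
            have "\<beta> ^ j = (2 ^ j) powr \<alpha>"
              unfolding \<beta>_def by (simp add: powr_realpow[symmetric] powr_powr mult.commute)
            also have "\<dots> \<le> norm_inf y powr \<alpha>" using j(2) alpha by (intro powr_mono2) auto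
            finally show "\<beta> ^ j \<le> norm_inf y powr \<alpha>" .
          qed (use C beta in auto)
          finally show ?thesis .
        qed
        finally show "Hlp (P \<omega>) (real n *\<^sub>R y) (real n *\<^sub>R (b *\<^sub>R 1)) (real n * t)
            \<le> ereal ((C + 1) * \<beta> * real n * norm_inf y powr \<alpha>)" by (simp add: less_imp_le)
      qed
    qed
  qed
  then show ?thesis using that[of "(C + 1) * \<beta>" "2 ^ j0"] C beta unfolding \<alpha>_def by simp
qed

end

section \<open>Limits of maximizers\<close>

text \<open>The value t g (z / t) by homogeneity, written through the volume of the space-time box.
  It is real and continuous everywhere, while \<open>gfun\<close> drops to -\<infinity> off the
  orthant.\<close>

definition Gfun :: "real \<Rightarrow> real \<Rightarrow> real^'d \<Rightarrow> real" where
  "Gfun c t z = c * root (CARD('d) + 1) (t * (\<Prod>i\<in>UNIV. z $ i))"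

lemma gfun_scaled:
  fixes z :: "real^'d"
  assumes "t > 0" "0 \<le> z"
  shows "ereal t * gfun c ((1 / t) *\<^sub>R z) = ereal (Gfun c t z)"
proof -
  let ?D = "CARD('d) + 1"
  let ?Z = "\<Prod>i\<in>UNIV. z $ i"
  have z: "z $ i \<ge> 0" for i using assms(2) by (simp add: less_eq_vec_def)
  have Z: "?Z \<ge> 0" using z by (simp add: prod_nonneg)
  have p: "(\<Prod>i\<in>UNIV. ((1 / t) *\<^sub>R z) $ i) = ?Z / t ^ CARD('d)"
    by (simp add: prod_dividef)
  have rt: "w powr (1 / (real CARD('d) + 1)) = root ?D w" if "w \<ge> 0" for w
  proof (cases "w = 0")
    case False
    then show ?thesis using that root_powr_inverse[of ?D w] by (simp add: add.commute)
  qed simp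
  have "t * root ?D (?Z / t ^ CARD('d)) = root ?D (t ^ ?D) * root ?D (?Z / t ^ CARD('d))"
    using assms by (subst real_root_power_cancel) auto
  also have "\<dots> = root ?D (t * ?Z)"
    unfolding real_root_mult[symmetric] using assms by simp
  finally have "t * (c * root ?D (?Z / t ^ CARD('d))) = Gfun c t z"
    unfolding Gfun_def by (simp add: mult.left_commute)
  moreover have "0 \<le> (1 / t) *\<^sub>R z" using assms z by (simp add: less_eq_vec_def)
  moreover have "?Z / t ^ CARD('d) \<ge> 0" using Z assms by simp
  ultimately show ?thesis unfolding gfun_def p by (simp add: rt)
qed

lemma Gfun_mono:
  assumes "0 \<le> c" "0 \<le> t" "\<And>i. 0 \<le> z $ i" "\<And>i. z $ i \<le> z' $ i"
  shows "Gfun c t z \<le> Gfun c t z'"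
  unfolding Gfun_def using assms
  by (intro mult_left_mono real_root_le_mono prod_mono) auto

lemma continuous_Gfun: "continuous_on UNIV (Gfun c t)"
  unfolding Gfun_def by (intro continuous_intros)

text \<open>An element within 1/2 of the finite supremum is an integer, and no larger integer lies
  below the supremum. This is what makes maximizers exist.\<close>

lemma int_Sup_attained:
  fixes A :: "ereal set"
  assumes A: "\<And>a. a \<in> A \<Longrightarrow> a < \<infinity> \<Longrightarrow> a = -\<infinity> \<or> (\<exists>k::int. a = ereal (real_of_int k))" and S: "Sup A = ereal v"
  shows "ereal v \<in> A" "\<exists>k::int. v = real_of_int k"
proof -
  have "ereal (v - 1/2) < Sup A" using S by simp
  then obtain a where a: "a \<in> A" "ereal (v - 1/2) < a" by (auto simp: less_Sup_iff)
  have fin: "b < \<infinity>" if "b \<in> A" for b using Sup_upper[OF that] S by auto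
  obtain k :: int where k: "a = ereal (real_of_int k)" using A[OF a(1) fin[OF a(1)]] a(2) by auto
  have "b \<le> a" if b: "b \<in> A" for b
  proof -
    from A[OF b fin[OF b]] show ?thesis
    proof
      assume "\<exists>m::int. b = ereal (real_of_int m)"
      then obtain m :: int where m: "b = ereal (real_of_int m)" by blast
      have "real_of_int m \<le> v" using Sup_upper[OF b] S m by simp
      moreover have "v - 1/2 < real_of_int k" using a(2) k by simp
      ultimately have "m \<le> k" by linarith
      then show ?thesis using m k by simp
    qed simp
  qed
  then have "Sup A = a" using a(1) by (meson Sup_eqI)
  then show "ereal v \<in> A" "\<exists>k::int. v = real_of_int k" using a(1) S k by auto
qed

text \<open>Almost sure limits can be collected only at countably many points; monotonicity in the
  endpoints reaches the others.\<close>

definition rat_vec :: "(real^'d) set" where "rat_vec = {y. \<forall>i. y $ i \<in> \<rat>}"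

lemma rat_vec_between:
  assumes "\<And>i. a $ i < b $ i"
  obtains w where "w \<in> rat_vec" "\<And>i. a $ i < w $ i" "\<And>i. w $ i < b $ i"
proof -
  have "\<forall>i. \<exists>r\<in>\<rat>. a $ i < r \<and> r < b $ i" using assms Rats_dense_in_real by blast
  then obtain f where "\<forall>i. f i \<in> \<rat> \<and> a $ i < f i \<and> f i < b $ i" by metis
  then show ?thesis using that[of "\<chi> i. f i"] by (simp add: rat_vec_def)
qed

lemma countable_rat_vec: "countable (rat_vec :: (real^'d) set)"
proof -
  have "rat_vec \<subseteq> (\<lambda>f. \<chi> i. f i) ` (PiE (UNIV :: 'd set) (\<lambda>_. \<rat>))"
  proof
    fix y :: "real^'d" assume "y \<in> rat_vec"
    then have "(\<lambda>i. y $ i) \<in> PiE UNIV (\<lambda>_. \<rat>)" "y = (\<chi> i. y $ i)" by (auto simp: rat_vec_def)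
    then show "y \<in> (\<lambda>f. \<chi> i. f i) ` (PiE UNIV (\<lambda>_. \<rat>))" by (metis image_eqI)
  qed
  moreover have "countable (PiE (UNIV :: 'd set) (\<lambda>_. \<rat> :: real set))"
    by (intro countable_PiE) (auto simp: countable_rat)
  ultimately show ?thesis by (rule countable_subset[OF _ countable_image])
qed

lemma abs_le_norm_inf: "\<bar>y $ i\<bar> \<le> norm_inf y"
  unfolding norm_inf_def by (intro Max_ge) auto

lemma scaleR_nat_vec_mono: "a \<le> b \<Longrightarrow> real n *\<^sub>R a \<le> real n *\<^sub>R b" for a b :: "real^'d"
  by (auto simp: less_eq_vec_def intro: mult_left_mono)

lemma Hlp_finite:
  assumes "\<And>A. bounded A \<Longrightarrow> finite (S \<inter> A)"
  shows "Hlp S y x t < \<infinity>"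
proof -
  let ?B = "S \<inter> hbox (corner y 0) (corner x t)"
  have fin: "finite ?B" using assms bounded_hbox by blast
  have "Hlp S y x t \<le> ereal (real (card ?B))"
    unfolding Hlp_def hbox_corner[symmetric] by (intro SUP_least) (auto intro: card_mono[OF fin])
  then show ?thesis by auto
qed

lemma evolve_scaled:
  assumes "r > 0"
  shows "evolve S f (r *\<^sub>R x) s = (SUP y\<in>{y. y \<le> x}. f (r *\<^sub>R y) + Hlp S (r *\<^sub>R y) (r *\<^sub>R x) s)"
proof -
  have "{y. y \<le> r *\<^sub>R x} = (\<lambda>y. r *\<^sub>R y) ` {y. y \<le> x}"
  proof (intro equalityI subsetI)
    fix y assume "y \<in> {y. y \<le> r *\<^sub>R x}"
    then have "(1 / r) *\<^sub>R y \<le> x" using assms by (simp add: less_eq_vec_def field_simps)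
    then show "y \<in> (\<lambda>y. r *\<^sub>R y) ` {y. y \<le> x}"
      using assms by (intro image_eqI[of _ _ "(1 / r) *\<^sub>R y"]) auto
  qed (use assms in \<open>auto simp: less_eq_vec_def\<close>)
  then show ?thesis unfolding evolve_def by (simp add: image_image)
qed

text \<open>No point has time in (0, 0], so only the initial term remains, and monotonicity puts its
  supremum at the endpoint.\<close>

lemma evolve_0:
  assumes "mono f"
  shows "evolve S f x 0 = f x"
proof -
  have "{C. st_chain C \<and> C \<subseteq> S \<inter> {(\<eta>, s). vlt y \<eta> \<and> \<eta> \<le> x \<and> 0 < s \<and> s \<le> 0}} = {{}}" for y
    by (auto simp: st_chain_def)
  then have "Hlp S y x 0 = 0" for y
    unfolding Hlp_def by (simp add: zero_ereal_def)
  then show ?thesis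
    unfolding evolve_def using assms by (auto intro!: antisym SUP_least SUP_upper simp: mono_def)
qed

lemma isCont_small_positive:
  fixes f :: "real \<Rightarrow> real"
  assumes "isCont f 0" "e > 0"
  obtains \<delta> where "\<delta> > 0" "\<bar>f \<delta> - f 0\<bar> < e"
proof -
  have "\<forall>\<^sub>F x in at_right 0. \<bar>f x - f 0\<bar> < e"
    using assms tendsto_mono[OF at_le, of "{0<..}" UNIV f "f 0" 0] by (auto simp: isCont_def tendsto_iff dist_real_def)
  moreover have "\<forall>\<^sub>F x in at_right (0::real). 0 < x" by (simp add: eventually_at_right_less)
  ultimately have "\<forall>\<^sub>F x in at_right 0. 0 < x \<and> \<bar>f x - f 0\<bar> < e" by eventually_elim simp
  then show ?thesis using eventually_happens'[OF trivial_limit_at_right_real] that by blast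
qed

text \<open>The common frame of the compactness arguments: a failing claim fails along a
  subsequence, which may be taken with positive indices so that division by them is
  meaningful.\<close>

lemma eventually_if_no_subsequence:
  fixes Q :: "nat \<Rightarrow> bool"
  assumes "\<And>r :: nat \<Rightarrow> nat. strict_mono r \<Longrightarrow> (\<And>k. r k > 0) \<Longrightarrow> (\<And>k. \<not> Q (r k)) \<Longrightarrow> False"
  shows "\<forall>\<^sub>F n in sequentially. Q n"
proof -
  have "\<forall>\<^sub>F n in sequentially. n > 0 \<longrightarrow> Q n"
  proof (rule ccontr)
    assume "\<not> (\<forall>\<^sub>F n in sequentially. n > 0 \<longrightarrow> Q n)"
    then have "\<exists>r :: nat \<Rightarrow> nat. strict_mono r \<and> (\<forall>k. \<not> (r k > 0 \<longrightarrow> Q (r k)))"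
      by (rule not_eventually_sequentiallyD)
    then obtain r :: "nat \<Rightarrow> nat" where "strict_mono r" "\<forall>k. \<not> (r k > 0 \<longrightarrow> Q (r k))" by blast
    then show False using assms[of r] by blast
  qed
  with eventually_gt_at_top[of 0] show ?thesis by eventually_elim blast
qed

section \<open>Limits of maximizers for one fixed realization\<close>

text \<open>What is retained of the randomness at one outcome. All parameters are countable
  (rational points, natural b and C) or harmless (\<open>\<delta>\<close>), so that almost every
  outcome satisfies everything at once.\<close>

locale height_limit =
  fixes S :: "((real^'d) \<times> real) set" and c t :: real and u0 :: "real^'d \<Rightarrow> real"
    and \<sigma> :: "nat \<Rightarrow> real^'d \<Rightarrow> ereal"
  assumes c: "0 \<le> c" and t: "0 < t" and u0_mono: "mono u0" and u0_cont: "continuous_on UNIV u0"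
    and locfin: "\<And>A. bounded A \<Longrightarrow> finite (S \<inter> A)"
    and \<sigma>_Zstar: "\<And>n x. \<sigma> n x \<in> Zstar" and \<sigma>_mono: "\<And>n. mono (\<sigma> n)"
    and \<sigma>_lim: "\<And>y. y \<in> rat_vec \<Longrightarrow> (\<lambda>n. ereal (1 / real n) * \<sigma> n (real n *\<^sub>R y)) \<longlonglongrightarrow> ereal (u0 y)"
    and \<sigma>_bound: "\<And>b C :: nat. C > 0 \<Longrightarrow> \<exists>Mb N. \<forall>n\<ge>N. \<forall>y. y \<le> real b *\<^sub>R 1 \<and> norm_inf y \<ge> Mb \<longrightarrow>
        \<sigma> n (real n *\<^sub>R y) \<le> ereal (- real C * real n * norm_inf y powr (real CARD('d) / (real CARD('d) + 1)))"
    and Hlp_lim: "\<And>y x \<delta>. y \<in> rat_vec \<Longrightarrow> x \<in> rat_vec \<Longrightarrow> (\<And>i. y $ i < x $ i) \<Longrightarrow> \<delta> > 0 \<Longrightarrow>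
        \<forall>\<^sub>F n in sequentially.
          ereal (real n * (Gfun c t (x - y) - \<delta>)) \<le> Hlp S (real n *\<^sub>R y) (real n *\<^sub>R x) (real n * t) \<and>
          Hlp S (real n *\<^sub>R y) (real n *\<^sub>R x) (real n * t) \<le> ereal (real n * (Gfun c t (x - y) + \<delta>))"
    and Hlp_tail: "\<And>b :: nat. b > 0 \<Longrightarrow> \<exists>C>0. \<exists>Mb>0. \<forall>\<^sub>F n in sequentially. \<forall>y.
        y \<le> real b *\<^sub>R 1 \<longrightarrow> Mb \<le> norm_inf y \<longrightarrow>
        Hlp S (real n *\<^sub>R y) (real n *\<^sub>R (real b *\<^sub>R 1)) (real n * t)
          \<le> ereal (C * real n * norm_inf y powr (real CARD('d) / (real CARD('d) + 1)))"
begin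

definition payoff :: "nat \<Rightarrow> real^'d \<Rightarrow> real^'d \<Rightarrow> ereal" where
  "payoff n x y = \<sigma> n (real n *\<^sub>R y) + Hlp S (real n *\<^sub>R y) (real n *\<^sub>R x) (real n * t)"

definition is_max :: "nat \<Rightarrow> real^'d \<Rightarrow> real^'d \<Rightarrow> bool" where
  "is_max n x y \<longleftrightarrow> y \<le> x \<and> payoff n x y = evolve S (\<sigma> n) (real n *\<^sub>R x) (real n * t)"

lemma \<sigma>_lim_bounds:
  assumes "y \<in> rat_vec" "e > 0"
  shows "\<forall>\<^sub>F n in sequentially. ereal (real n * (u0 y - e)) \<le> \<sigma> n (real n *\<^sub>R y) \<and>
    \<sigma> n (real n *\<^sub>R y) \<le> ereal (real n * (u0 y + e))"
proof -
  have "\<forall>\<^sub>F n in sequentially. ereal (u0 y - e) < ereal (1 / real n) * \<sigma> n (real n *\<^sub>R y)"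
    "\<forall>\<^sub>F n in sequentially. ereal (1 / real n) * \<sigma> n (real n *\<^sub>R y) < ereal (u0 y + e)"
    using \<sigma>_lim[OF assms(1)] assms(2) by (auto intro: order_tendstoD)
  with eventually_gt_at_top[of 0] show ?thesis
    by eventually_elim (auto simp: ereal_scaled_less mult.commute less_imp_le)
qed

lemma payoff_le_evolve: "n > 0 \<Longrightarrow> y \<le> x \<Longrightarrow> payoff n x y \<le> evolve S (\<sigma> n) (real n *\<^sub>R x) (real n * t)"
  unfolding payoff_def by (subst evolve_scaled) (auto intro!: SUP_upper)

lemma Hlp_nat: obtains k :: nat where "Hlp S y x s = ereal (real k)"
  using Hlp_natE[OF Hlp_finite[OF locfin]] by blast

lemma int_valued:
  assumes "f \<in> Zstar" "f + Hlp S y x s < \<infinity>"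
  shows "f + Hlp S y x s = -\<infinity> \<or> (\<exists>k::int. f + Hlp S y x s = ereal (real_of_int k))"
proof -
  obtain k :: nat where k: "Hlp S y x s = ereal (real k)" by (rule Hlp_nat)
  consider "f = \<infinity>" | "f = -\<infinity>" | m :: int where "f = ereal (real_of_int m)"
    using assms(1) by (auto simp: Zstar_def)
  then show ?thesis
  proof cases
    case 3
    then have "f + Hlp S y x s = ereal (real_of_int (m + int k))" using k by simp
    then show ?thesis by blast
  qed (use assms k in auto)
qed

text \<open>Uniformly for x in a cube, starting points far away lose against the corner
  \<open>- p\<close>, because the initial heights decay with a larger constant than chains can gain.
  The remaining ones have bounded payoff, so the supremum is finite and, being a supremum of
  integers, attained.\<close>

lemma maximizers:
  fixes q :: nat
  assumes q: "q > 0"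
  shows "\<exists>R. \<forall>\<^sub>F n in sequentially. \<forall>x. (\<forall>i. \<bar>x $ i\<bar> \<le> real q) \<longrightarrow>
    (\<exists>v::real. evolve S (\<sigma> n) (real n *\<^sub>R x) (real n * t) = ereal v) \<and>
    (\<exists>y. is_max n x y) \<and> (\<forall>y. is_max n x y \<longrightarrow> norm_inf y \<le> R)"
proof -
  let ?a = "real CARD('d) / (real CARD('d) + 1)"
  have a: "?a > 0" by simp
  obtain C Mb where C: "C > 0" "Mb > 0" and H: "\<forall>\<^sub>F n in sequentially. \<forall>y.
        y \<le> real q *\<^sub>R 1 \<longrightarrow> Mb \<le> norm_inf y \<longrightarrow>
        Hlp S (real n *\<^sub>R y) (real n *\<^sub>R (real q *\<^sub>R 1)) (real n * t) \<le> ereal (C * real n * norm_inf y powr ?a)"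
    using Hlp_tail[OF q] by blast
  \<comment> \<open>Exceeds the chain constant by at least 1, leaving a net decay of at least n
    \<open>norm_inf y powr ?a\<close>.\<close>
  define C' where "C' = nat \<lceil>C\<rceil> + 1"
  have C': "real C' \<ge> C + 1" "C' > 0" unfolding C'_def by linarith+
  obtain Mb' N where S: "\<forall>n\<ge>N. \<forall>y. y \<le> real q *\<^sub>R 1 \<and> norm_inf y \<ge> Mb' \<longrightarrow>
        \<sigma> n (real n *\<^sub>R y) \<le> ereal (- real C' * real n * norm_inf y powr ?a)"
    using \<sigma>_bound[OF C'(2)] by blast
  define p where "p = real q *\<^sub>R (1 :: real^'d)"
  have prat: "p \<in> rat_vec" "- p \<in> rat_vec" by (auto simp: p_def rat_vec_def)
  \<comment> \<open>Chosen so that - w < u0 (- p) - 1: a net loss of n w already falls below the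
    value reached from \<open>- p\<close>.\<close>
  define w where "w = \<bar>u0 (- p)\<bar> + 2"
  define R where "R = Max {Mb, Mb', w powr (1 / ?a)}"
  have R: "Mb \<le> R" "Mb' \<le> R" "w powr (1 / ?a) \<le> R" unfolding R_def by auto
  have ev: "\<forall>\<^sub>F n in sequentially. ereal (real n * (u0 (- p) - 1)) \<le> \<sigma> n (real n *\<^sub>R (- p))"
    using \<sigma>_lim_bounds[OF prat(2), of 1] by (auto elim: eventually_mono)
  have ev2: "\<forall>\<^sub>F n in sequentially. \<sigma> n (real n *\<^sub>R p) \<le> ereal (real n * (u0 p + 1))"
    using \<sigma>_lim_bounds[OF prat(1), of 1] by (auto elim: eventually_mono)
  have "\<forall>\<^sub>F n in sequentially. \<forall>x. (\<forall>i. \<bar>x $ i\<bar> \<le> real q) \<longrightarrow>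
    (\<exists>v::real. evolve S (\<sigma> n) (real n *\<^sub>R x) (real n * t) = ereal v) \<and>
    (\<exists>y. is_max n x y) \<and> (\<forall>y. is_max n x y \<longrightarrow> norm_inf y \<le> R)"
    using ev ev2 H eventually_ge_at_top[of N] eventually_gt_at_top[of 0]
  proof eventually_elim
    case (elim n)
    show ?case
    proof (intro allI impI)
      fix x :: "real^'d" assume x: "\<forall>i. \<bar>x $ i\<bar> \<le> real q"
      let ?E = "evolve S (\<sigma> n) (real n *\<^sub>R x) (real n * t)"
      have xp: "x \<le> p" "- p \<le> x" using x unfolding p_def less_eq_vec_def abs_le_iff by (simp_all add: minus_le_iff)
      have nx: "real n *\<^sub>R x \<le> real n *\<^sub>R p" using xp by (auto simp: less_eq_vec_def intro: mult_left_mono)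
      have lower: "ereal (real n * (u0 (- p) - 1)) \<le> ?E"
      proof -
        have "ereal (real n * (u0 (- p) - 1)) \<le> \<sigma> n (real n *\<^sub>R (- p)) + 0" using elim(1) by simp
        also have "\<dots> \<le> payoff n x (- p)" unfolding payoff_def by (intro add_left_mono Hlp_nonneg)
        also have "\<dots> \<le> ?E" using elim xp by (intro payoff_le_evolve) auto
        finally show ?thesis .
      qed
      have far: "payoff n x y < ereal (real n * (u0 (- p) - 1))" if y: "y \<le> x" "\<not> norm_inf y \<le> R" for y
      proof -
        have yp: "y \<le> real q *\<^sub>R 1" using y(1) xp(1) unfolding p_def by (rule order_trans)
        have w0: "w > 0" by (simp add: w_def)
        have big: "w \<le> norm_inf y powr ?a"
        proof -
          have "w = (w powr (1 / ?a)) powr ?a" using w0 by (simp add: powr_powr)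
          also have "\<dots> \<le> norm_inf y powr ?a" using R(3) y(2) a by (intro powr_mono2) auto
          finally show ?thesis .
        qed
        have "Hlp S (real n *\<^sub>R y) (real n *\<^sub>R x) (real n * t) \<le> Hlp S (real n *\<^sub>R y) (real n *\<^sub>R p) (real n * t)"
          using nx by (intro Hlp_mono) auto
        also have "\<dots> \<le> ereal (C * real n * norm_inf y powr ?a)"
          using elim(3) yp R(1) y(2) unfolding p_def by auto
        finally have h: "Hlp S (real n *\<^sub>R y) (real n *\<^sub>R x) (real n * t) \<le> ereal (C * real n * norm_inf y powr ?a)" .
        have s: "\<sigma> n (real n *\<^sub>R y) \<le> ereal (- real C' * real n * norm_inf y powr ?a)"
          using S elim(4) yp R(2) y(2) by auto
        have "payoff n x y \<le> ereal (- real C' * real n * norm_inf y powr ?a) + ereal (C * real n * norm_inf y powr ?a)"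
          unfolding payoff_def by (intro add_mono s h)
        also have "\<dots> = ereal (- ((real C' - C) * (real n * norm_inf y powr ?a)))" by (simp add: algebra_simps)
        also have "\<dots> \<le> ereal (- (1 * (real n * w)))"
        proof -
          have "1 * (real n * w) \<le> (real C' - C) * (real n * norm_inf y powr ?a)"
            using C' big w0 by (intro mult_mono) auto
          then show ?thesis by simp
        qed
        also have "\<dots> < ereal (real n * (u0 (- p) - 1))"
        proof -
          have "- w < u0 (- p) - 1" unfolding w_def by linarith
          then have "real n * (- w) < real n * (u0 (- p) - 1)" using elim(5) by (intro mult_strict_left_mono) auto
          then show ?thesis by simp
        qed
        finally show ?thesis .
      qed
      obtain hh :: nat where hh: "Hlp S (real n *\<^sub>R ((- R) *\<^sub>R 1)) (real n *\<^sub>R p) (real n * t) = ereal (real hh)"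
        by (rule Hlp_nat)
      \<comment> \<open>Any finite bound will do, and it may depend on n: its only purpose is to
        exclude the value \<infinity>.\<close>
      define Bd where "Bd = max (real n * (u0 (- p) - 1)) (real n * (u0 p + 1) + real hh)"
      have upper: "payoff n x y \<le> ereal Bd" if y: "y \<le> x" for y
      proof (cases "norm_inf y \<le> R")
        case True
        have "\<sigma> n (real n *\<^sub>R y) \<le> \<sigma> n (real n *\<^sub>R p)"
          using order_trans[OF y xp(1)] by (intro monoD[OF \<sigma>_mono]) (auto simp: less_eq_vec_def intro: mult_left_mono)
        then have s: "\<sigma> n (real n *\<^sub>R y) \<le> ereal (real n * (u0 p + 1))" using elim(2) by (rule order_trans)
        have "(- R) *\<^sub>R 1 \<le> y"
          unfolding less_eq_vec_def
        proof
          fix i show "((- R) *\<^sub>R 1) $ i \<le> y $ i" using abs_le_norm_inf[of y i] True by (simp add: abs_le_iff)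
        qed
        then have "Hlp S (real n *\<^sub>R y) (real n *\<^sub>R x) (real n * t) \<le> Hlp S (real n *\<^sub>R ((- R) *\<^sub>R 1)) (real n *\<^sub>R p) (real n * t)"
          using xp(1) by (intro Hlp_mono scaleR_nat_vec_mono) auto
        then have h: "Hlp S (real n *\<^sub>R y) (real n *\<^sub>R x) (real n * t) \<le> ereal (real hh)" by (simp only: hh)
        have "payoff n x y \<le> ereal (real n * (u0 p + 1)) + ereal (real hh)"
          unfolding payoff_def by (intro add_mono s h)
        also have "\<dots> \<le> ereal Bd" unfolding Bd_def by simp
        finally show ?thesis .
      next
        case False
        then have "payoff n x y \<le> ereal (real n * (u0 (- p) - 1))" using far[OF y] by (simp add: less_imp_le)
        also have "\<dots> \<le> ereal Bd" unfolding Bd_def by simp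
        finally show ?thesis .
      qed
      have E: "?E = Sup (payoff n x ` {y. y \<le> x})"
        unfolding payoff_def using elim(5) by (subst evolve_scaled) auto
      have "?E \<le> ereal Bd" unfolding E using upper by (intro SUP_least) auto
      then obtain v where v: "?E = ereal v" using lower by (cases ?E) auto
      have "ereal v \<in> payoff n x ` {y. y \<le> x}"
      proof (rule int_Sup_attained(1))
        show "a = -\<infinity> \<or> (\<exists>k::int. a = ereal (real_of_int k))" if "a \<in> payoff n x ` {y. y \<le> x}" "a < \<infinity>" for a
          using that int_valued[OF \<sigma>_Zstar] unfolding payoff_def by blast
      qed (use v E in simp)
      then have ex: "\<exists>y. is_max n x y" unfolding is_max_def using v by auto
      have "norm_inf y \<le> R" if "is_max n x y" for y
      proof (rule ccontr)
        assume "\<not> norm_inf y \<le> R"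
        then have "payoff n x y < ?E" using far[of y] lower that unfolding is_max_def by (meson less_le_trans)
        then show False using that by (simp add: is_max_def)
      qed
      then show "(\<exists>v::real. ?E = ereal v) \<and> (\<exists>y. is_max n x y) \<and> (\<forall>y. is_max n x y \<longrightarrow> norm_inf y \<le> R)"
        using v ex by blast
    qed
  qed
  then show ?thesis by blast
qed

text \<open>At \<open>X k\<close> the maximizer beats every competitor. Both payoffs are bounded by
  nearby rational points through monotonicity; dividing by n and letting the rational points
  approach gives optimality of y at x against every z.\<close>

lemma limit_of_maximizers:
  assumes r: "filterlim r at_top sequentially" and X: "X \<longlonglongrightarrow> x" and Y: "Y \<longlonglongrightarrow> y"
    and max: "\<And>k. is_max (r k) (X k) (Y k)"
  shows "x \<in> Wpt c u0 y t"
proof -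
  have yx: "y \<le> x"
    unfolding less_eq_vec_def
  proof
    fix i
    show "y $ i \<le> x $ i"
      using max by (intro LIMSEQ_le[OF tendsto_vec_nth[OF Y] tendsto_vec_nth[OF X]])
        (auto simp: is_max_def less_eq_vec_def)
  qed
  have evr: "\<forall>\<^sub>F k in sequentially. Q (r k)" if "\<forall>\<^sub>F n in sequentially. Q n" for Q
    using r that by (simp add: filterlim_iff)
  have evlt: "\<forall>\<^sub>F k in sequentially. \<forall>i\<in>UNIV. Z k $ i < w $ i" if "Z \<longlonglongrightarrow> z" "\<And>i. z $ i < w $ i" for Z :: "nat \<Rightarrow> real^'d" and z w
    by (intro eventually_ball_finite ballI order_tendstoD(2)[OF tendsto_vec_nth[OF that(1)]] that(2)) simp
  have evgt: "\<forall>\<^sub>F k in sequentially. \<forall>i\<in>UNIV. w $ i < Z k $ i" if "Z \<longlonglongrightarrow> z" "\<And>i. w $ i < z $ i" for Z :: "nat \<Rightarrow> real^'d" and z w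
    by (intro eventually_ball_finite ballI order_tendstoD(1)[OF tendsto_vec_nth[OF that(1)]] that(2)) simp
  have key: "u0 z + Gfun c t (x - z) \<le> u0 y + Gfun c t (x - y)" if z: "z \<le> x" for z
  proof (rule field_le_epsilon)
    fix e' :: real assume "e' > 0"
    \<comment> \<open>Three \<open>e\<close> are allowed on the side of z and four on the side of y:
      two on each come from the limits at rational points, the rest covers continuity.\<close>
    define e where "e = e' / 7"
    have e: "e > 0" using \<open>e' > 0\<close> by (simp add: e_def)
    define f where "f d = \<bar>u0 (y + (2 * d) *\<^sub>R 1) - u0 y\<bar> + \<bar>Gfun c t (x - y + (4 * d) *\<^sub>R 1) - Gfun c t (x - y)\<bar> + \<bar>u0 (z - (2 * d) *\<^sub>R 1) - u0 z\<bar>" for d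
    have cu: "isCont u0 w" and cG: "isCont (Gfun c t) w" for w
      using u0_cont continuous_Gfun by (auto simp: continuous_on_eq_continuous_at)
    have "isCont f 0"
      unfolding f_def by (intro continuous_intros isCont_o2[OF _ cu] isCont_o2[OF _ cG])
    then obtain d where d: "d > 0" "\<bar>f d - f 0\<bar> < e" using isCont_small_positive[OF _ e] by blast
    have fd: "f d < e" using d(2) by (auto simp: f_def)
    obtain yp where yp: "yp \<in> rat_vec" "\<And>i. (y + d *\<^sub>R 1) $ i < yp $ i" "\<And>i. yp $ i < (y + (2 * d) *\<^sub>R 1) $ i"
      by (rule rat_vec_between[of "y + d *\<^sub>R 1" "y + (2 * d) *\<^sub>R 1"]) (use d in auto)
    obtain ym where ym: "ym \<in> rat_vec" "\<And>i. (y - (2 * d) *\<^sub>R 1) $ i < ym $ i" "\<And>i. ym $ i < (y - d *\<^sub>R 1) $ i"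
      by (rule rat_vec_between[of "y - (2 * d) *\<^sub>R 1" "y - d *\<^sub>R 1"]) (use d in auto)
    obtain xp where xp: "xp \<in> rat_vec" "\<And>i. (x + d *\<^sub>R 1) $ i < xp $ i" "\<And>i. xp $ i < (x + (2 * d) *\<^sub>R 1) $ i"
      by (rule rat_vec_between[of "x + d *\<^sub>R 1" "x + (2 * d) *\<^sub>R 1"]) (use d in auto)
    obtain xm where xm: "xm \<in> rat_vec" "\<And>i. (x - d *\<^sub>R 1) $ i < xm $ i" "\<And>i. xm $ i < x $ i"
      by (rule rat_vec_between[of "x - d *\<^sub>R 1" x]) (use d in auto)
    \<comment> \<open>\<open>zm\<close> is pushed down by more than d while \<open>xm\<close> stays
      within d below x. Hence \<open>zm\<close> is strictly below \<open>xm\<close> even where z and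
      x share a coordinate, and \<open>xm - zm\<close> still dominates \<open>x - z\<close>.\<close>
    obtain zm where zm: "zm \<in> rat_vec" "\<And>i. (z - (2 * d) *\<^sub>R 1) $ i < zm $ i" "\<And>i. zm $ i < (z - d *\<^sub>R 1) $ i"
      by (rule rat_vec_between[of "z - (2 * d) *\<^sub>R 1" "z - d *\<^sub>R 1"]) (use d in auto)
    have yxi: "y $ i \<le> x $ i" and zxi: "z $ i \<le> x $ i" for i
      using yx z by (auto simp: less_eq_vec_def)
    have ymxp: "ym $ i < xp $ i" for i
      using ym(3)[of i] xp(2)[of i] yxi[of i] d by simp
    have zmxm: "zm $ i < xm $ i" for i
      using zm(3)[of i] xm(2)[of i] zxi[of i] d by simp
    have G1: "Gfun c t (xp - ym) \<le> Gfun c t (x - y + (4 * d) *\<^sub>R 1)"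
    proof (rule Gfun_mono)
      fix i
      show "0 \<le> (xp - ym) $ i" using ymxp[of i] by simp
      show "(xp - ym) $ i \<le> (x - y + (4 * d) *\<^sub>R 1) $ i" using xp(3)[of i] ym(2)[of i] by simp
    qed (use c t in auto)
    have G2: "Gfun c t (x - z) \<le> Gfun c t (xm - zm)"
    proof (rule Gfun_mono)
      fix i
      show "0 \<le> (x - z) $ i" using zxi[of i] by simp
      show "(x - z) $ i \<le> (xm - zm) $ i" using xm(2)[of i] zm(3)[of i] by simp
    qed (use c t in auto)
    have U1: "u0 yp \<le> u0 (y + (2 * d) *\<^sub>R 1)"
      using yp(3) by (intro monoD[OF u0_mono]) (auto simp: less_eq_vec_def less_imp_le)
    have U2: "u0 (z - (2 * d) *\<^sub>R 1) \<le> u0 zm"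
      using zm(2) by (intro monoD[OF u0_mono]) (auto simp: less_eq_vec_def less_imp_le)
    have f1: "u0 yp + Gfun c t (xp - ym) \<le> u0 y + Gfun c t (x - y) + e"
      and f2: "u0 z + Gfun c t (x - z) - e \<le> u0 zm + Gfun c t (xm - zm)"
      using fd G1 G2 U1 U2 unfolding f_def by linarith+
    have lims: "y $ i < yp $ i" "ym $ i < y $ i" "x $ i < xp $ i" "xm $ i < x $ i" for i
      using yp(2)[of i] ym(3)[of i] xp(2)[of i] xm(3)[of i] d by simp_all
    note smono = scaleR_nat_vec_mono
    have "\<forall>\<^sub>F k in sequentially. u0 z + Gfun c t (x - z) - 3 * e \<le> u0 y + Gfun c t (x - y) + 4 * e"
      using evr[OF \<sigma>_lim_bounds[OF yp(1) e]] evr[OF \<sigma>_lim_bounds[OF zm(1) e]]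
        evr[OF Hlp_lim[OF ym(1) xp(1) ymxp e]] evr[OF Hlp_lim[OF zm(1) xm(1) zmxm e]]
        evr[OF eventually_gt_at_top[of 0]]
        evlt[OF Y lims(1)] evgt[OF Y lims(2)] evlt[OF X lims(3)] evgt[OF X lims(4)]
    proof eventually_elim
      case (elim k)
      define n where "n = r k"
      have le: "Y k \<le> yp" "ym \<le> Y k" "X k \<le> xp" "xm \<le> X k" "zm \<le> xm"
        using elim(6-9) zmxm unfolding less_eq_vec_def by (auto intro: less_imp_le)
      have n: "n > 0" using elim(5) by (simp add: n_def)
      let ?E = "evolve S (\<sigma> n) (real n *\<^sub>R X k) (real n * t)"
      have "?E = payoff n (X k) (Y k)" using max[of k] by (simp add: is_max_def n_def)
      also have "\<dots> \<le> ereal (real n * (u0 yp + e)) + ereal (real n * (Gfun c t (xp - ym) + e))"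
        unfolding payoff_def
      proof (rule add_mono)
        show "\<sigma> n (real n *\<^sub>R Y k) \<le> ereal (real n * (u0 yp + e))"
          using monoD[OF \<sigma>_mono smono[OF le(1)], of n n] elim(1) unfolding n_def by (meson order_trans)
        show "Hlp S (real n *\<^sub>R Y k) (real n *\<^sub>R X k) (real n * t) \<le> ereal (real n * (Gfun c t (xp - ym) + e))"
          using Hlp_mono[OF smono[OF le(2)] smono[OF le(3)] order_refl, of S n n "real n * t"] elim(3)
          unfolding n_def by (meson order_trans)
      qed
      finally have up: "?E \<le> ereal (real n * (u0 yp + Gfun c t (xp - ym) + 2 * e))" by (simp add: algebra_simps)
      have "ereal (real n * (u0 zm - e)) + ereal (real n * (Gfun c t (xm - zm) - e)) \<le> payoff n (X k) zm"
        unfolding payoff_def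
      proof (rule add_mono)
        show "ereal (real n * (u0 zm - e)) \<le> \<sigma> n (real n *\<^sub>R zm)" using elim(2) by (simp add: n_def)
        show "ereal (real n * (Gfun c t (xm - zm) - e)) \<le> Hlp S (real n *\<^sub>R zm) (real n *\<^sub>R X k) (real n * t)"
          using Hlp_mono[OF order_refl smono[OF le(4)] order_refl, of S "real n *\<^sub>R zm" n "real n * t"] elim(4)
          unfolding n_def by (meson order_trans)
      qed
      also have "\<dots> \<le> ?E" using n order_trans[OF le(5,4)] by (rule payoff_le_evolve)
      finally have "ereal (real n * (u0 zm + Gfun c t (xm - zm) - 2 * e)) \<le> ?E" by (simp add: algebra_simps)
      then have "ereal (real n * (u0 zm + Gfun c t (xm - zm) - 2 * e)) \<le> ereal (real n * (u0 yp + Gfun c t (xp - ym) + 2 * e))"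
        using up by (rule order_trans)
      then have "u0 zm + Gfun c t (xm - zm) - 2 * e \<le> u0 yp + Gfun c t (xp - ym) + 2 * e" using n by simp
      then show ?case using f1 f2 e by linarith
    qed
    then show "u0 z + Gfun c t (x - z) \<le> u0 y + Gfun c t (x - y) + e'"
      unfolding e_def by simp
  qed
  have val: "ereal (u0 z) + ereal t * gfun c ((1 / t) *\<^sub>R (x - z)) = ereal (u0 z + Gfun c t (x - z))" if "z \<le> x" for z
    using that t by (subst gfun_scaled) auto
  have "ufun c u0 x t = ereal (u0 y + Gfun c t (x - y))"
    unfolding ufun_def
  proof (rule antisym)
    show "(SUP y\<in>{y. y \<le> x}. ereal (u0 y) + ereal t * gfun c ((1 / t) *\<^sub>R (x - y))) \<le> ereal (u0 y + Gfun c t (x - y))"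
      using key val by (intro SUP_least) auto
    show "ereal (u0 y + Gfun c t (x - y)) \<le> (SUP y\<in>{y. y \<le> x}. ereal (u0 y) + ereal t * gfun c ((1 / t) *\<^sub>R (x - y)))"
      using yx by (subst val[symmetric]) (auto intro!: SUP_upper)
  qed
  then show ?thesis unfolding Wpt_def using yx val[OF yx] by simp
qed

lemma maximizers_along:
  assumes r: "filterlim r at_top sequentially" and X: "X \<longlonglongrightarrow> x"
  obtains R where "\<forall>\<^sub>F k in sequentially.
    (\<exists>v. evolve S (\<sigma> (r k)) (real (r k) *\<^sub>R X k) (real (r k) * t) = ereal v) \<and>
    (\<exists>y. is_max (r k) (X k) y) \<and> (\<forall>y. is_max (r k) (X k) y \<longrightarrow> norm_inf y \<le> R)"
proof -
  obtain b where b: "\<And>k. norm (X k) \<le> b"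
    using convergent_imp_Bseq[OF convergentI[OF X]] by (auto simp: Bseq_def)
  define q where "q = nat \<lceil>b\<rceil> + 1"
  have Xq: "\<bar>X k $ i\<bar> \<le> real q" for k i
    using component_le_norm_cart[of "X k" i] b[of k] unfolding q_def by linarith
  have "q > 0" by (simp add: q_def)
  then obtain R where R: "\<forall>\<^sub>F n in sequentially. \<forall>x. (\<forall>i. \<bar>x $ i\<bar> \<le> real q) \<longrightarrow>
      (\<exists>v::real. evolve S (\<sigma> n) (real n *\<^sub>R x) (real n * t) = ereal v) \<and>
      (\<exists>y. is_max n x y) \<and> (\<forall>y. is_max n x y \<longrightarrow> norm_inf y \<le> R)"
    using maximizers[of q] by blast
  from eventually_compose_filterlim[OF R r]
  have "\<forall>\<^sub>F k in sequentially.
    (\<exists>v. evolve S (\<sigma> (r k)) (real (r k) *\<^sub>R X k) (real (r k) * t) = ereal v) \<and>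
    (\<exists>y. is_max (r k) (X k) y) \<and> (\<forall>y. is_max (r k) (X k) y \<longrightarrow> norm_inf y \<le> R)"
    by eventually_elim (use Xq in blast)
  then show ?thesis by (rule that)
qed

text \<open>Maximizers taken from sets asymptotically inside every neighbourhood of B are bounded,
  so a subsequence converges; its limit is optimal at x and lies in the closure of B. The lemma
  serves both the rescaled initial discrepancy set and its complement.\<close>

lemma limit_in_Wset:
  assumes r: "filterlim r at_top sequentially" and X: "X \<longlonglongrightarrow> x"
    and T: "\<And>K e. compact K \<Longrightarrow> e > 0 \<Longrightarrow> \<forall>\<^sub>F n in sequentially. T n \<inter> K \<subseteq> outer_nb B e"
    and max: "\<forall>\<^sub>F k in sequentially. \<exists>y\<in>T (r k). is_max (r k) (X k) y"
  shows "x \<in> Wset c u0 (closure B) t"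
proof -
  obtain R where R: "\<forall>\<^sub>F k in sequentially.
      (\<exists>v. evolve S (\<sigma> (r k)) (real (r k) *\<^sub>R X k) (real (r k) * t) = ereal v) \<and>
      (\<exists>y. is_max (r k) (X k) y) \<and> (\<forall>y. is_max (r k) (X k) y \<longrightarrow> norm_inf y \<le> R)"
    using maximizers_along[OF r X] .
  have "\<forall>\<^sub>F k in sequentially. \<exists>y\<in>T (r k). is_max (r k) (X k) y \<and> norm_inf y \<le> R"
    using max R by eventually_elim blast
  then obtain k0 where k0: "\<And>k. k \<ge> k0 \<Longrightarrow> \<exists>y\<in>T (r k). is_max (r k) (X k) y \<and> norm_inf y \<le> R"
    by (auto simp: eventually_sequentially)
  then have "\<forall>k. \<exists>y\<in>T (r (k + k0)). is_max (r (k + k0)) (X (k + k0)) y \<and> norm_inf y \<le> R" by simp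
  then obtain Y where Y: "\<And>k. Y k \<in> T (r (k + k0))" "\<And>k. is_max (r (k + k0)) (X (k + k0)) (Y k)" "\<And>k. norm_inf (Y k) \<le> R"
    by metis
  define K :: "(real^'d) set" where "K = cbox (\<chi> i. - R) (\<chi> i. R)"
  have K: "compact K" unfolding K_def by (rule compact_cbox)
  have YK: "Y k \<in> K" for k
    unfolding K_def mem_box_cart
  proof
    show "(\<chi> i. - R) $ i \<le> Y k $ i \<and> Y k $ i \<le> (\<chi> i. R) $ i" for i
      using abs_le_norm_inf[of "Y k" i] Y(3)[of k] by (simp add: abs_le_iff)
  qed
  then obtain y s where s: "strict_mono (s :: nat \<Rightarrow> nat)" and y: "(Y \<circ> s) \<longlonglongrightarrow> y"
    using K unfolding compact_def by blast
  define \<rho> where "\<rho> k = s k + k0" for k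
  have rho: "filterlim \<rho> at_top sequentially"
    unfolding \<rho>_def using filterlim_subseq[OF s] by (rule filterlim_compose[OF filterlim_add_const_nat_at_top])
  have rr: "filterlim (\<lambda>k. r (\<rho> k)) at_top sequentially"
    using filterlim_compose[OF r rho] .
  have "x \<in> Wpt c u0 y t"
  proof (rule limit_of_maximizers[OF rr])
    show "(\<lambda>k. X (\<rho> k)) \<longlonglongrightarrow> x" using filterlim_compose[OF X rho] .
    show "(\<lambda>k. Y (s k)) \<longlonglongrightarrow> y" using y by (simp add: o_def)
    show "is_max (r (\<rho> k)) (X (\<rho> k)) (Y (s k))" for k using Y(2)[of "s k"] by (simp add: \<rho>_def)
  qed
  moreover have "y \<in> closure B"
    unfolding closure_approachable
  proof (intro allI impI)
    fix e :: real assume e: "e > 0"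
    have "\<forall>\<^sub>F k in sequentially. T (r (\<rho> k)) \<inter> K \<subseteq> outer_nb B (e/2)"
      using eventually_compose_filterlim[OF T[OF K, of "e/2"] rr] e by simp
    moreover have "\<forall>\<^sub>F k in sequentially. dist (Y (s k)) y < e/2"
      using tendstoD[OF y, of "e/2"] e by (simp only: o_def half_gt_zero)
    ultimately have "\<forall>\<^sub>F k in sequentially. \<exists>w\<in>B. dist w y < e"
    proof eventually_elim
      case (elim k)
      have "Y (s k) \<in> T (r (\<rho> k)) \<inter> K" using Y(1)[of "s k"] YK by (simp add: \<rho>_def)
      then obtain w where "w \<in> B" "dist (Y (s k)) w < e/2" using elim(1) by (auto simp: outer_nb_def)
      then show ?case using elim(2) by (intro bexI[of _ w]) (metis dist_commute dist_triangle_half_r, simp)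
    qed
    then show "\<exists>w\<in>B. dist w y < e" by (auto simp: eventually_sequentially)
  qed
  ultimately show ?thesis unfolding Wset_def by blast
qed

end

section \<open>Two coupled height functions\<close>

locale coupled_heights = height_limit S c t u0 \<sigma>
  for S :: "((real^'d) \<times> real) set" and c t :: real and u0 :: "real^'d \<Rightarrow> real"
    and \<sigma> :: "nat \<Rightarrow> real^'d \<Rightarrow> ereal" +
  fixes \<zeta> :: "nat \<Rightarrow> real^'d \<Rightarrow> ereal" and h :: nat and B :: "(real^'d) set"
  assumes B: "closed B"
    and \<zeta>_Zstar: "\<And>n x. \<zeta> n x \<in> Zstar"
    and \<zeta>_bounds: "\<And>n y. \<sigma> n y \<le> \<zeta> n y \<and> \<zeta> n y \<le> \<sigma> n y + ereal (real h)"
    and A0: "\<And>K e. compact K \<Longrightarrow> e > 0 \<Longrightarrow> \<forall>\<^sub>F n in sequentially.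
      inner_nb B e \<inter> K \<subseteq> scaleset (1 / real n) {x. \<zeta> n x = \<sigma> n x + ereal (real h)} \<inter> K \<and>
      scaleset (1 / real n) {x. \<zeta> n x = \<sigma> n x + ereal (real h)} \<inter> K \<subseteq> outer_nb B e \<inter> K"
begin

definition A :: "nat \<Rightarrow> (real^'d) set" where
  "A n = {x. evolve S (\<zeta> n) x (real n * t) = evolve S (\<sigma> n) x (real n * t) + ereal (real h)}"

lemma scaleset_iff: "n > 0 \<Longrightarrow> x \<in> scaleset (1 / real n) Z \<longleftrightarrow> real n *\<^sub>R x \<in> Z"
proof
  assume n: "n > 0" and "real n *\<^sub>R x \<in> Z"
  moreover have "x = (1 / real n) *\<^sub>R (real n *\<^sub>R x)" using n by simp
  ultimately show "x \<in> scaleset (1 / real n) Z" unfolding scaleset_def by blast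
qed (auto simp: scaleset_def)

text \<open>The \<zeta>-supremum v + h is attained at some y by integrality. There v + h = \<zeta> +
  H \<le> \<sigma> + h + H \<le> v + h, so equality holds throughout: y maximizes for \<sigma> and
  has full discrepancy.\<close>

lemma maximizer_in_A0:
  assumes n: "n > 0" and v: "evolve S (\<sigma> n) (real n *\<^sub>R x) (real n * t) = ereal v" and x: "real n *\<^sub>R x \<in> A n"
  shows "\<exists>y. is_max n x y \<and> \<zeta> n (real n *\<^sub>R y) = \<sigma> n (real n *\<^sub>R y) + ereal (real h)"
proof -
  let ?H = "\<lambda>y. Hlp S (real n *\<^sub>R y) (real n *\<^sub>R x) (real n * t)"
  let ?Z = "(\<lambda>y. \<zeta> n (real n *\<^sub>R y) + ?H y) ` {y. y \<le> x}"
  have "Sup ?Z = evolve S (\<zeta> n) (real n *\<^sub>R x) (real n * t)" using n by (subst evolve_scaled) auto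
  also have "\<dots> = ereal (v + real h)" using x v by (simp add: A_def)
  finally have "ereal (v + real h) \<in> ?Z"
  proof (rule int_Sup_attained(1)[rotated])
    show "a = -\<infinity> \<or> (\<exists>k::int. a = ereal (real_of_int k))" if "a \<in> ?Z" "a < \<infinity>" for a
      using that int_valued[OF \<zeta>_Zstar] by blast
  qed
  then obtain y where y: "y \<le> x" "\<zeta> n (real n *\<^sub>R y) + ?H y = ereal (v + real h)" by auto
  obtain k :: nat where k: "?H y = ereal (real k)" by (rule Hlp_nat)
  have "\<sigma> n (real n *\<^sub>R y) + ?H y \<le> ereal v" using payoff_le_evolve[OF n y(1)] v by (simp add: payoff_def)
  moreover obtain a where a: "\<zeta> n (real n *\<^sub>R y) = ereal a" "a + real k = v + real h"
    using y(2) k by (cases "\<zeta> n (real n *\<^sub>R y)") auto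
  moreover have "ereal a \<le> \<sigma> n (real n *\<^sub>R y) + ereal (real h)" using \<zeta>_bounds[of n "real n *\<^sub>R y"] a by simp
  ultimately have "\<sigma> n (real n *\<^sub>R y) = ereal (a - real h)"
    using k by (cases "\<sigma> n (real n *\<^sub>R y)") auto
  then show ?thesis using y(1) a k v unfolding is_max_def payoff_def by (intro exI[of _ y]) auto
qed

text \<open>A \<sigma>-maximizer with full discrepancy would lift the \<zeta>-height to v + h, its
  largest possible value. This excludes every maximizer, not just one, when x is outside
  \<open>A n\<close>.\<close>

lemma maximizer_notin_A0:
  assumes n: "n > 0" and v: "evolve S (\<sigma> n) (real n *\<^sub>R x) (real n * t) = ereal v" and x: "real n *\<^sub>R x \<notin> A n"
    and y: "is_max n x y"
  shows "\<zeta> n (real n *\<^sub>R y) \<noteq> \<sigma> n (real n *\<^sub>R y) + ereal (real h)"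
proof
  assume eq: "\<zeta> n (real n *\<^sub>R y) = \<sigma> n (real n *\<^sub>R y) + ereal (real h)"
  let ?H = "\<lambda>y. Hlp S (real n *\<^sub>R y) (real n *\<^sub>R x) (real n * t)"
  let ?E = "evolve S (\<zeta> n) (real n *\<^sub>R x) (real n * t)"
  have E: "?E = (SUP y\<in>{y. y \<le> x}. \<zeta> n (real n *\<^sub>R y) + ?H y)" using n by (subst evolve_scaled) auto
  have "?E \<le> ereal (v + real h)"
    unfolding E
  proof (rule SUP_least)
    fix w assume "w \<in> {y. y \<le> x}"
    then have "\<sigma> n (real n *\<^sub>R w) + ?H w \<le> ereal v" using payoff_le_evolve[OF n, of w x] v by (simp add: payoff_def)
    then have le: "(\<sigma> n (real n *\<^sub>R w) + ?H w) + ereal (real h) \<le> ereal v + ereal (real h)"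
      by (rule add_right_mono)
    have "\<zeta> n (real n *\<^sub>R w) + ?H w \<le> \<sigma> n (real n *\<^sub>R w) + ereal (real h) + ?H w"
      using \<zeta>_bounds by (intro add_right_mono) auto
    also have "\<dots> = (\<sigma> n (real n *\<^sub>R w) + ?H w) + ereal (real h)"
      by (simp add: ac_simps)
    finally show "\<zeta> n (real n *\<^sub>R w) + ?H w \<le> ereal (v + real h)"
      using le by simp
  qed
  moreover have "ereal (v + real h) \<le> ?E"
  proof -
    have "ereal (v + real h) = (\<sigma> n (real n *\<^sub>R y) + ?H y) + ereal (real h)"
      using y v by (simp add: is_max_def payoff_def)
    also have "\<dots> = \<zeta> n (real n *\<^sub>R y) + ?H y" unfolding eq by (simp add: ac_simps)
    also have "\<dots> \<le> ?E" unfolding E using y by (intro SUP_upper) (simp add: is_max_def)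
    finally show ?thesis .
  qed
  ultimately have "real n *\<^sub>R x \<in> A n" unfolding A_def using v by auto
  then show False using x by blast
qed

lemma limit_in_A:
  assumes r: "filterlim r at_top sequentially" and X: "X \<longlonglongrightarrow> x"
    and XA: "\<And>k. real (r k) *\<^sub>R X k \<in> A (r k)"
  shows "x \<in> Wset c u0 B t"
proof -
  let ?T = "\<lambda>n. scaleset (1 / real n) {x. \<zeta> n x = \<sigma> n x + ereal (real h)}"
  have "x \<in> Wset c u0 (closure B) t"
  proof (rule limit_in_Wset[OF r X, of ?T])
    show "\<forall>\<^sub>F n in sequentially. ?T n \<inter> K \<subseteq> outer_nb B e" if "compact K" "e > 0" for K e
      using A0[OF that] by (rule eventually_mono) blast
    have "\<forall>\<^sub>F k in sequentially. r k > 0" using r eventually_gt_at_top[of 0] by (simp add: filterlim_iff)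
    moreover obtain R where "\<forall>\<^sub>F k in sequentially.
        (\<exists>v. evolve S (\<sigma> (r k)) (real (r k) *\<^sub>R X k) (real (r k) * t) = ereal v) \<and>
        (\<exists>y. is_max (r k) (X k) y) \<and> (\<forall>y. is_max (r k) (X k) y \<longrightarrow> norm_inf y \<le> R)"
      using maximizers_along[OF r X] .
    ultimately
    show "\<forall>\<^sub>F k in sequentially. \<exists>y\<in>?T (r k). is_max (r k) (X k) y"
    proof eventually_elim
      case (elim k)
      then obtain v where "evolve S (\<sigma> (r k)) (real (r k) *\<^sub>R X k) (real (r k) * t) = ereal v" by blast
      from maximizer_in_A0[OF elim(1) this XA]
      show ?case using elim(1) by (auto simp: scaleset_iff)
    qed
  qed
  then show ?thesis using B by simp
qed

text \<open>The inner inclusion in \<open>A0\<close> is read contrapositively: a point missing from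
  the rescaled initial set is outside B or closer than e to a point outside B, so the limit argument
  applies with the complement of B.\<close>

lemma limit_notin_A:
  assumes r: "filterlim r at_top sequentially" and X: "X \<longlonglongrightarrow> x"
    and XA: "\<And>k. real (r k) *\<^sub>R X k \<notin> A (r k)"
  shows "x \<in> Wset c u0 (closure (- B)) t"
proof (rule limit_in_Wset[OF r X, of "\<lambda>n. - scaleset (1 / real n) {x. \<zeta> n x = \<sigma> n x + ereal (real h)}"])
  let ?T = "\<lambda>n. scaleset (1 / real n) {x. \<zeta> n x = \<sigma> n x + ereal (real h)}"
  show "\<forall>\<^sub>F n in sequentially. - ?T n \<inter> K \<subseteq> outer_nb (- B) e" if "compact K" "e > 0" for K e
    using A0[OF that]
  proof eventually_elim
    case (elim n)
    then have sub: "inner_nb B e \<inter> K \<subseteq> ?T n" by blast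
    show ?case
    proof
      fix w assume w: "w \<in> - ?T n \<inter> K"
      then have "w \<notin> inner_nb B e" using sub by blast
      then show "w \<in> outer_nb (- B) e"
        unfolding inner_nb_def outer_nb_def using that(2) by (cases "w \<in> B") (auto simp: not_le intro: bexI[of _ w])
    qed
  qed
  have "\<forall>\<^sub>F k in sequentially. r k > 0" using r eventually_gt_at_top[of 0] by (simp add: filterlim_iff)
  moreover obtain R where "\<forall>\<^sub>F k in sequentially.
      (\<exists>v. evolve S (\<sigma> (r k)) (real (r k) *\<^sub>R X k) (real (r k) * t) = ereal v) \<and>
      (\<exists>y. is_max (r k) (X k) y) \<and> (\<forall>y. is_max (r k) (X k) y \<longrightarrow> norm_inf y \<le> R)"
    using maximizers_along[OF r X] .
  ultimately
  show "\<forall>\<^sub>F k in sequentially. \<exists>y\<in>- ?T (r k). is_max (r k) (X k) y"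
  proof eventually_elim
    case (elim k)
    then obtain v y where "evolve S (\<sigma> (r k)) (real (r k) *\<^sub>R X k) (real (r k) * t) = ereal v" and y: "is_max (r k) (X k) y" by blast
    from maximizer_notin_A0[OF elim(1) this(1) XA y]
    show ?case using elim(1) y by (auto simp: scaleset_iff)
  qed
qed

lemma A_empty:
  assumes "Wset c u0 B t = {}" "compact K"
  shows "\<forall>\<^sub>F n in sequentially. A n \<inter> scaleset (real n) K = {}"
proof (rule eventually_if_no_subsequence)
  fix r :: "nat \<Rightarrow> nat" assume r: "strict_mono r" "\<And>k. r k > 0" and ne: "\<And>k. A (r k) \<inter> scaleset (real (r k)) K \<noteq> {}"
  have "\<forall>k. \<exists>x\<in>K. real (r k) *\<^sub>R x \<in> A (r k)" using ne unfolding scaleset_def by blast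
  then obtain X where X: "\<And>k. X k \<in> K" "\<And>k. real (r k) *\<^sub>R X k \<in> A (r k)" by metis
  obtain x s where s: "strict_mono (s :: nat \<Rightarrow> nat)" "(X \<circ> s) \<longlonglongrightarrow> x"
    using assms(2) X(1) unfolding compact_def by blast
  have "x \<in> Wset c u0 B t"
    using limit_in_A[OF filterlim_subseq[OF strict_mono_o[OF r(1) s(1)]] s(2)] X(2) by simp
  then show False using assms(1) by blast
qed

text \<open>Next to a boundary point there are points of the set and of its complement, at distance
  less than 1/(k + 1). Both sequences have the same limit, which therefore lies in both sets whose
  intersection is \<open>Xset\<close>.\<close>

lemma frontier_A:
  assumes "compact K" "e > 0"
  shows "\<forall>\<^sub>F n in sequentially. frontier (scaleset (1 / real n) (A n)) \<inter> K \<subseteq> outer_nb (Xset c u0 B t) e \<inter> K"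
proof (rule eventually_if_no_subsequence)
  fix r :: "nat \<Rightarrow> nat" assume r: "strict_mono r" "\<And>k. r k > 0"
    and ne: "\<And>k. \<not> frontier (scaleset (1 / real (r k)) (A (r k))) \<inter> K \<subseteq> outer_nb (Xset c u0 B t) e \<inter> K"
  let ?A = "\<lambda>k. scaleset (1 / real (r k)) (A (r k))"
  have "\<forall>k. \<exists>x\<in>K. x \<in> frontier (?A k) \<and> x \<notin> outer_nb (Xset c u0 B t) e" using ne by blast
  then obtain X where X: "\<And>k. X k \<in> K" "\<And>k. X k \<in> frontier (?A k)" "\<And>k. X k \<notin> outer_nb (Xset c u0 B t) e" by metis
  have "\<exists>a\<in>?A k. dist a (X k) < 1 / real (Suc k)" for k
    using X(2)[of k] unfolding frontier_closures Int_iff closure_approachable by (metis divide_pos_pos of_nat_0_less_iff zero_less_Suc zero_less_one)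
  then obtain a where a: "\<And>k. a k \<in> ?A k" "\<And>k. dist (a k) (X k) < 1 / real (Suc k)" by metis
  have "\<exists>b\<in>- ?A k. dist b (X k) < 1 / real (Suc k)" for k
    using X(2)[of k] unfolding frontier_closures Int_iff closure_approachable by (metis divide_pos_pos of_nat_0_less_iff zero_less_Suc zero_less_one)
  then obtain b where b: "\<And>k. b k \<in> - ?A k" "\<And>k. dist (b k) (X k) < 1 / real (Suc k)" by metis
  obtain x s where s: "strict_mono (s :: nat \<Rightarrow> nat)" "(X \<circ> s) \<longlonglongrightarrow> x"
    using assms(1) X(1) unfolding compact_def by blast
  have lim: "(Z \<circ> s) \<longlonglongrightarrow> x" if "\<And>k. dist (Z k) (X k) < 1 / real (Suc k)" for Z
  proof -
    have "(\<lambda>k. dist (Z k) (X k)) \<longlonglongrightarrow> 0"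
      by (rule tendsto_sandwich[OF _ _ tendsto_const LIMSEQ_inverse_real_of_nat])
        (use that in \<open>auto intro!: always_eventually less_imp_le simp: inverse_eq_divide\<close>)
    then have "(\<lambda>k. dist (Z (s k)) (X (s k))) \<longlonglongrightarrow> 0"
      using LIMSEQ_subseq_LIMSEQ[OF _ s(1)] by (auto simp: o_def)
    then have "(\<lambda>k. Z (s k) - X (s k)) \<longlonglongrightarrow> 0" by (simp add: dist_norm tendsto_norm_zero_iff)
    from tendsto_add[OF this s(2)[unfolded o_def]] show ?thesis by (simp add: o_def)
  qed
  have rs: "filterlim (r \<circ> s) at_top sequentially" using filterlim_subseq[OF strict_mono_o[OF r(1) s(1)]] .
  have "x \<in> Wset c u0 B t"
    using limit_in_A[OF rs lim[OF a(2)]] a(1) r(2) by (simp add: scaleset_iff)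
  moreover have "x \<in> Wset c u0 (closure (- B)) t"
    using limit_notin_A[OF rs lim[OF b(2)]] b(1) r(2) by (simp add: scaleset_iff)
  ultimately have xX: "x \<in> Xset c u0 B t" by (simp add: Xset_def)
  have "\<forall>\<^sub>F k in sequentially. dist ((X \<circ> s) k) x < e" using s(2) assms(2) by (simp add: tendsto_iff)
  then obtain k where "dist (X (s k)) x < e" by (auto simp: eventually_sequentially)
  then show False using X(3)[of "s k"] xX by (auto simp: outer_nb_def)
qed

lemma A_outer:
  assumes "compact K" "e > 0"
  shows "\<forall>\<^sub>F n in sequentially. scaleset (1 / real n) (A n) \<inter> K \<subseteq> outer_nb (Wset c u0 B t) e \<inter> K"
proof (rule eventually_if_no_subsequence)
  fix r :: "nat \<Rightarrow> nat" assume r: "strict_mono r" "\<And>k. r k > 0"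
    and ne: "\<And>k. \<not> scaleset (1 / real (r k)) (A (r k)) \<inter> K \<subseteq> outer_nb (Wset c u0 B t) e \<inter> K"
  have "\<forall>k. \<exists>x\<in>K. x \<in> scaleset (1 / real (r k)) (A (r k)) \<and> x \<notin> outer_nb (Wset c u0 B t) e" using ne by blast
  then obtain X where X: "\<And>k. X k \<in> K" "\<And>k. X k \<in> scaleset (1 / real (r k)) (A (r k))" "\<And>k. X k \<notin> outer_nb (Wset c u0 B t) e" by metis
  obtain x s where s: "strict_mono (s :: nat \<Rightarrow> nat)" "(X \<circ> s) \<longlonglongrightarrow> x"
    using assms(1) X(1) unfolding compact_def by blast
  have rs: "filterlim (r \<circ> s) at_top sequentially" using filterlim_subseq[OF strict_mono_o[OF r(1) s(1)]] .
  have xW: "x \<in> Wset c u0 B t"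
    using limit_in_A[OF rs s(2)] X(2) r(2) by (simp add: scaleset_iff)
  have "\<forall>\<^sub>F k in sequentially. dist ((X \<circ> s) k) x < e" using s(2) assms(2) by (simp add: tendsto_iff)
  then obtain k where "dist (X (s k)) x < e" by (auto simp: eventually_sequentially)
  then show False using X(3)[of "s k"] xW by (auto simp: outer_nb_def)
qed

text \<open>Points missed by the rescaled set converge to a point reached from the closed complement
  of B, yet they keep distance e from the complement of \<open>Wset\<close>.\<close>

lemma A_inner:
  assumes "compact K" "e > 0" and int: "\<forall>x\<in>Wset c u0 (closure (- B)) t. x \<notin> interior (Wset c u0 B t)"
  shows "\<forall>\<^sub>F n in sequentially. inner_nb (Wset c u0 B t) e \<inter> K \<subseteq> scaleset (1 / real n) (A n) \<inter> K"
proof (rule eventually_if_no_subsequence)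
  fix r :: "nat \<Rightarrow> nat" assume r: "strict_mono r" "\<And>k. r k > 0"
    and ne: "\<And>k. \<not> inner_nb (Wset c u0 B t) e \<inter> K \<subseteq> scaleset (1 / real (r k)) (A (r k)) \<inter> K"
  have "\<forall>k. \<exists>x\<in>K. x \<in> inner_nb (Wset c u0 B t) e \<and> x \<notin> scaleset (1 / real (r k)) (A (r k))" using ne by blast
  then obtain X where X: "\<And>k. X k \<in> K" "\<And>k. X k \<in> inner_nb (Wset c u0 B t) e" "\<And>k. X k \<notin> scaleset (1 / real (r k)) (A (r k))" by metis
  obtain x s where s: "strict_mono (s :: nat \<Rightarrow> nat)" "(X \<circ> s) \<longlonglongrightarrow> x"
    using assms(1) X(1) unfolding compact_def by blast
  have rs: "filterlim (r \<circ> s) at_top sequentially" using filterlim_subseq[OF strict_mono_o[OF r(1) s(1)]] .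
  have xW: "x \<in> Wset c u0 (closure (- B)) t"
    using limit_notin_A[OF rs s(2)] X(3) r(2) by (simp add: scaleset_iff)
  have "\<forall>\<^sub>F k in sequentially. dist ((X \<circ> s) k) x < e/2"
    using tendstoD[OF s(2), of "e/2"] assms(2) by (simp only: half_gt_zero)
  then obtain k where k: "dist (X (s k)) x < e/2" by (auto simp: eventually_sequentially)
  \<comment> \<open>Half of the margin e survives at the limit, making x an interior point, which
    the extra hypothesis rules out.\<close>
  have "ball x (e/2) \<subseteq> Wset c u0 B t"
  proof
    fix w assume "w \<in> ball x (e/2)"
    then have "dist (X (s k)) w < e" using k by (metis dist_triangle_half_l mem_ball dist_commute)
    then show "w \<in> Wset c u0 B t" using X(2)[of "s k"] by (force simp: inner_nb_def)
  qed
  then have "x \<in> interior (Wset c u0 B t)" using assms(2) by (intro interiorI[of "ball x (e/2)"]) auto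
  then show False using int xW by blast
qed

end

section \<open>Passage to almost every outcome\<close>

theorem theorem5p1:
  fixes M :: "'w measure"
    and P :: "'w \<Rightarrow> ((real^'d) \<times> real) set"
    and c :: real
    and u0 :: "real^'d \<Rightarrow> real"
    and \<sigma>0 \<zeta>0 :: "nat \<Rightarrow> 'w \<Rightarrow> real^'d \<Rightarrow> ereal"
    and h :: nat and B :: "(real^'d) set" and t :: real
  assumes dim: "CARD('d) \<ge> 2"
    and PPP: "poisson_pp M P"
    and c_def: "AE \<omega> in M. (\<lambda>n. ereal (1 / real n) * Hlp (P \<omega>) 0 (real n *\<^sub>R 1) (real n))
                                \<longlonglongrightarrow> ereal c"
    and u0_mono: "mono u0"
    and u0_lip: "\<forall>x. \<exists>U. open U \<and> x \<in> U \<and> (\<exists>L. L-lipschitz_on U u0)"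
    and u0_growth: "growth_cond (\<lambda>y. ereal (u0 y))"
    and \<sigma>0_state: "\<forall>n \<omega>. \<sigma>0 n \<omega> \<in> StateSpace"
    and \<sigma>0_lim: "\<forall>y. AE \<omega> in M. (\<lambda>n. ereal (1 / real n) * \<sigma>0 n \<omega> (real n *\<^sub>R y)) \<longlonglongrightarrow> ereal (u0 y)"
    and \<sigma>0_bound: "\<forall>(b::real^'d) (C::real). C > 0 \<longrightarrow> (AE \<omega> in M. \<exists>Mb N. \<forall>n\<ge>N. \<forall>y.
                      y \<le> b \<and> norm_inf y \<ge> Mb \<longrightarrow>
                      \<sigma>0 n \<omega> (real n *\<^sub>R y)
                        \<le> ereal (- C * real n * norm_inf y powr (real CARD('d) / (real CARD('d) + 1))))"
    and h_pos: "h > 0"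
    and B_closed: "closed B"
    and t_pos: "t > 0"
    and \<zeta>0_state: "\<forall>n \<omega>. \<zeta>0 n \<omega> \<in> StateSpace"
    and \<zeta>0_bounds: "\<forall>n \<omega> y. \<sigma>0 n \<omega> y \<le> \<zeta>0 n \<omega> y \<and> \<zeta>0 n \<omega> y \<le> \<sigma>0 n \<omega> y + ereal (real h)"
    and A0: "AE \<omega> in M. \<forall>K e. compact K \<longrightarrow> e > 0 \<longrightarrow> (\<forall>\<^sub>F n in sequentially.
                let A = {x. evolve (P \<omega>) (\<zeta>0 n \<omega>) x 0 = evolve (P \<omega>) (\<sigma>0 n \<omega>) x 0 + ereal (real h)} in
                inner_nb B e \<inter> K \<subseteq> scaleset (1 / real n) A \<inter> K \<and>
                scaleset (1 / real n) A \<inter> K \<subseteq> outer_nb B e \<inter> K)"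
  shows
    "(Wset c u0 B t = {} \<longrightarrow>
       (AE \<omega> in M. \<forall>K. compact K \<longrightarrow> (\<forall>\<^sub>F n in sequentially.
          {x. evolve (P \<omega>) (\<zeta>0 n \<omega>) x (real n * t) = evolve (P \<omega>) (\<sigma>0 n \<omega>) x (real n * t) + ereal (real h)}
            \<inter> scaleset (real n) K = {})))
     \<and> (Wset c u0 B t \<noteq> {} \<longrightarrow>
       (AE \<omega> in M. \<forall>K e. compact K \<longrightarrow> e > 0 \<longrightarrow> (\<forall>\<^sub>F n in sequentially.
          frontier (scaleset (1 / real n)
            {x. evolve (P \<omega>) (\<zeta>0 n \<omega>) x (real n * t) = evolve (P \<omega>) (\<sigma>0 n \<omega>) x (real n * t) + ereal (real h)})
            \<inter> K \<subseteq> outer_nb (Xset c u0 B t) e \<inter> K)))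
     \<and> ((\<forall>x\<in>Wset c u0 (closure (- B)) t. x \<notin> interior (Wset c u0 B t)) \<longrightarrow>
       (AE \<omega> in M. \<forall>K e. compact K \<longrightarrow> e > 0 \<longrightarrow> (\<forall>\<^sub>F n in sequentially.
          let A = {x. evolve (P \<omega>) (\<zeta>0 n \<omega>) x (real n * t) = evolve (P \<omega>) (\<sigma>0 n \<omega>) x (real n * t) + ereal (real h)} in
          inner_nb (Wset c u0 B t) e \<inter> K \<subseteq> scaleset (1 / real n) A \<inter> K \<and>
          scaleset (1 / real n) A \<inter> K \<subseteq> outer_nb (Wset c u0 B t) e \<inter> K)))"
proof -
  interpret poisson_limit M P c
    by unfold_locales (fact PPP, fact c_def)
  have cont: "continuous_on UNIV u0"
  proof (rule continuous_at_imp_continuous_on, rule ballI)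
    fix x
    obtain U L where U: "open U" "x \<in> U" "L-lipschitz_on U u0" using u0_lip by blast
    then show "isCont u0 x"
      using lipschitz_on_continuous_on continuous_on_eq_continuous_at by blast
  qed
  have mono\<sigma>: "mono (\<sigma>0 n \<omega>)" and Z\<sigma>: "\<sigma>0 n \<omega> x \<in> Zstar" for n \<omega> x
    using \<sigma>0_state by (auto simp: StateSpace_def)
  have mono\<zeta>: "mono (\<zeta>0 n \<omega>)" and Z\<zeta>: "\<zeta>0 n \<omega> x \<in> Zstar" for n \<omega> x
    using \<zeta>0_state by (auto simp: StateSpace_def)
  have a2: "AE \<omega> in M. \<forall>y\<in>rat_vec. (\<lambda>n. ereal (1 / real n) * \<sigma>0 n \<omega> (real n *\<^sub>R y)) \<longlonglongrightarrow> ereal (u0 y)"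
    using \<sigma>0_lim by (subst AE_ball_countable[OF countable_rat_vec]) blast
  \<comment> \<open>Natural b and C suffice, since any bounded region and any required rate lie
    below some natural number; this permits a single null set.\<close>
  have a3: "AE \<omega> in M. \<forall>(b::nat) (C::nat). C > 0 \<longrightarrow> (\<exists>Mb N. \<forall>n\<ge>N. \<forall>y. y \<le> real b *\<^sub>R 1 \<and> norm_inf y \<ge> Mb \<longrightarrow>
        \<sigma>0 n \<omega> (real n *\<^sub>R y) \<le> ereal (- real C * real n * norm_inf y powr (real CARD('d) / (real CARD('d) + 1))))"
    unfolding AE_all_countable
  proof (intro allI)
    fix b C :: nat
    show "AE \<omega> in M. C > 0 \<longrightarrow> (\<exists>Mb N. \<forall>n\<ge>N. \<forall>y. y \<le> real b *\<^sub>R 1 \<and> norm_inf y \<ge> Mb \<longrightarrow>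
        \<sigma>0 n \<omega> (real n *\<^sub>R y) \<le> ereal (- real C * real n * norm_inf y powr (real CARD('d) / (real CARD('d) + 1))))"
      using \<sigma>0_bound[rule_format, of "real C" "real b *\<^sub>R 1"] by (cases "C > 0") auto
  qed
  have a4: "AE \<omega> in M. \<forall>y\<in>rat_vec. \<forall>x\<in>rat_vec. (\<forall>i. y $ i < x $ i) \<longrightarrow> (\<forall>\<delta>>0. \<forall>\<^sub>F n in sequentially.
          ereal (real n * (Gfun c t (x - y) - \<delta>)) \<le> Hlp (P \<omega>) (real n *\<^sub>R y) (real n *\<^sub>R x) (real n * t) \<and>
          Hlp (P \<omega>) (real n *\<^sub>R y) (real n *\<^sub>R x) (real n * t) \<le> ereal (real n * (Gfun c t (x - y) + \<delta>)))"
    unfolding AE_ball_countable[OF countable_rat_vec]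
  proof (intro ballI)
    fix y x :: "real^'d"
    show "AE \<omega> in M. (\<forall>i. y $ i < x $ i) \<longrightarrow> (\<forall>\<delta>>0. \<forall>\<^sub>F n in sequentially.
          ereal (real n * (Gfun c t (x - y) - \<delta>)) \<le> Hlp (P \<omega>) (real n *\<^sub>R y) (real n *\<^sub>R x) (real n * t) \<and>
          Hlp (P \<omega>) (real n *\<^sub>R y) (real n *\<^sub>R x) (real n * t) \<le> ereal (real n * (Gfun c t (x - y) + \<delta>)))"
    proof (cases "\<forall>i. y $ i < x $ i")
      case True
      then show ?thesis using AE_Hlp_limit[of y x t] t_pos by (simp add: Gfun_def)
    next
      case False
      then show ?thesis by (intro AE_I2) blast
    qed
  qed
  have a5: "AE \<omega> in M. \<forall>b::nat. b > 0 \<longrightarrow> (\<exists>C>0. \<exists>Mb>0. \<forall>\<^sub>F n in sequentially. \<forall>y.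
        y \<le> real b *\<^sub>R 1 \<longrightarrow> Mb \<le> norm_inf y \<longrightarrow>
        Hlp (P \<omega>) (real n *\<^sub>R y) (real n *\<^sub>R (real b *\<^sub>R 1)) (real n * t)
          \<le> ereal (C * real n * norm_inf y powr (real CARD('d) / (real CARD('d) + 1))))"
    unfolding AE_all_countable
  proof
    fix b :: nat
    show "AE \<omega> in M. b > 0 \<longrightarrow> (\<exists>C>0. \<exists>Mb>0. \<forall>\<^sub>F n in sequentially. \<forall>y.
        y \<le> real b *\<^sub>R 1 \<longrightarrow> Mb \<le> norm_inf y \<longrightarrow>
        Hlp (P \<omega>) (real n *\<^sub>R y) (real n *\<^sub>R (real b *\<^sub>R 1)) (real n * t)
          \<le> ereal (C * real n * norm_inf y powr (real CARD('d) / (real CARD('d) + 1))))"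
    proof (cases "b > 0")
      case True
      then have "real b > 0" by simp
      from AE_Hlp_tail[OF this t_pos] obtain C Mb where "C > 0" "Mb > 0" and ae: "AE \<omega> in M. \<forall>\<^sub>F n in sequentially. \<forall>y.
        y \<le> real b *\<^sub>R 1 \<longrightarrow> Mb \<le> norm_inf y \<longrightarrow>
        Hlp (P \<omega>) (real n *\<^sub>R y) (real n *\<^sub>R (real b *\<^sub>R 1)) (real n * t)
          \<le> ereal (C * real n * norm_inf y powr (real CARD('d) / (real CARD('d) + 1)))" .
      from ae show ?thesis by eventually_elim (use \<open>C > 0\<close> \<open>Mb > 0\<close> in blast)
    qed simp
  qed
  have main: "AE \<omega> in M. coupled_heights (P \<omega>) c t u0 (\<lambda>n. \<sigma>0 n \<omega>) (\<lambda>n. \<zeta>0 n \<omega>) h B"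
    using AE_locally_finite a2 a3 a4 a5 A0
  proof eventually_elim
    case (elim \<omega>)
    note e1 = elim(1) and e2 = elim(2) and e3 = elim(3) and e4 = elim(4) and e5 = elim(5) and e6 = elim(6)
    show ?case
    proof (unfold_locales, goal_cases)
      case 1 show ?case by (rule c_nonneg)
    next
      case 2 show ?case by (rule t_pos)
    next
      case 3 show ?case by (rule u0_mono)
    next
      case 4 show ?case by (rule cont)
    next
      case 5 then show ?case using e1 by blast
    next
      case 6 show ?case by (rule Z\<sigma>)
    next
      case 7 show ?case by (rule mono\<sigma>)
    next
      case 8 then show ?case using e2 by blast
    next
      case 9 then show ?case using e3 by blast
    next
      case 10 then show ?case using e4 by blast
    next
      case 11 then show ?case using e5 by blast
    next
      case 12 show ?case by (rule B_closed)
    next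
      case 13 show ?case by (rule Z\<zeta>)
    next
      case 14 show ?case using \<zeta>0_bounds by blast
    next
      case (15 K e)
      \<comment> \<open>The hypothesis speaks of evolved heights at time 0, the locale of initial
        heights; \<open>evolve_0\<close> identifies them.\<close>
      then show ?case using e6 by (simp only: Let_def evolve_0[OF mono\<sigma>] evolve_0[OF mono\<zeta>] simp_thms)
    qed
  qed
  show ?thesis
  proof (intro conjI impI)
    assume "Wset c u0 B t = {}"
    from main show "AE \<omega> in M. \<forall>K. compact K \<longrightarrow> (\<forall>\<^sub>F n in sequentially.
          {x. evolve (P \<omega>) (\<zeta>0 n \<omega>) x (real n * t) = evolve (P \<omega>) (\<sigma>0 n \<omega>) x (real n * t) + ereal (real h)}
            \<inter> scaleset (real n) K = {})"
    proof eventually_elim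
      case (elim \<omega>)
      from coupled_heights.A_empty[OF elim \<open>Wset c u0 B t = {}\<close>] show ?case
        unfolding coupled_heights.A_def[OF elim] by blast
    qed
  next
    from main show "AE \<omega> in M. \<forall>K e. compact K \<longrightarrow> e > 0 \<longrightarrow> (\<forall>\<^sub>F n in sequentially.
          frontier (scaleset (1 / real n)
            {x. evolve (P \<omega>) (\<zeta>0 n \<omega>) x (real n * t) = evolve (P \<omega>) (\<sigma>0 n \<omega>) x (real n * t) + ereal (real h)})
            \<inter> K \<subseteq> outer_nb (Xset c u0 B t) e \<inter> K)"
    proof eventually_elim
      case (elim \<omega>)
      from coupled_heights.frontier_A[OF elim] show ?case
        unfolding coupled_heights.A_def[OF elim] by blast
    qed
  next
    assume int: "\<forall>x\<in>Wset c u0 (closure (- B)) t. x \<notin> interior (Wset c u0 B t)"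
    from main show "AE \<omega> in M. \<forall>K e. compact K \<longrightarrow> e > 0 \<longrightarrow> (\<forall>\<^sub>F n in sequentially.
          let A = {x. evolve (P \<omega>) (\<zeta>0 n \<omega>) x (real n * t) = evolve (P \<omega>) (\<sigma>0 n \<omega>) x (real n * t) + ereal (real h)} in
          inner_nb (Wset c u0 B t) e \<inter> K \<subseteq> scaleset (1 / real n) A \<inter> K \<and>
          scaleset (1 / real n) A \<inter> K \<subseteq> outer_nb (Wset c u0 B t) e \<inter> K)"
    proof eventually_elim
      case (elim \<omega>)
      show ?case
      proof (intro allI impI)
        fix K :: "(real^'d) set" and e :: real
        assume "compact K" "e > 0"
        from eventually_conj[OF coupled_heights.A_inner[OF elim this int] coupled_heights.A_outer[OF elim this]]
        show "\<forall>\<^sub>F n in sequentially.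
          let A = {x. evolve (P \<omega>) (\<zeta>0 n \<omega>) x (real n * t) = evolve (P \<omega>) (\<sigma>0 n \<omega>) x (real n * t) + ereal (real h)} in
          inner_nb (Wset c u0 B t) e \<inter> K \<subseteq> scaleset (1 / real n) A \<inter> K \<and>
          scaleset (1 / real n) A \<inter> K \<subseteq> outer_nb (Wset c u0 B t) e \<inter> K"
          unfolding coupled_heights.A_def[OF elim] Let_def .
      qed
    qed
  qed
qed

end
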